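(* Let $V$ be a left vector space over a division ring whose dimension is an infinite cardinal number $\alpha$, let $\beta\le\alpha$ be an infinite cardinal number, and let $\mathcal{G}$ be $\mathcal{G}_{\beta}(V)$ or $\mathcal{G}^{\beta}(V)$. Let $\mathcal{C},\mathcal{C}'$ be connected components of the Grassmann graph $\Gamma(\mathcal{G})$. If $f$ is a bijection of $\mathcal{C}$ to $\mathcal{C}'$ such that $f$ sends apartments of $\mathcal{C}$ to apartments of $\mathcal{C}'$ and $f^{-1}$ sends apartments of $\mathcal{C}'$ to apartments of $\mathcal{C}$, then $f$ is induced by a semilinear automorphism of $V$, i.e. there is a semilinear automorphism $l:V\to V$ such that $f(X)=l(X)$ for every $X\in\mathcal{C}$.
   Context: For a cardinal number $\beta\le\alpha=\dim V$, $\mathcal{G}_{\beta}(V)$ denotes the set of all subspaces of $V$ of dimension $\beta$ and codimension $\alpha$, and $\mathcal{G}^{\beta}(V)$ denotes the set of all subspaces of $V$ of dimension $\alpha$ and codimension $\beta$. For a basis $B$ of $V$, the apartment of $\mathcal{G}$ defined by $B$ is the set of all elements of $\mathcal{G}$ spanned by subsets of $B$. Elements $X,Y\in\mathcal{G}$ are adjacent if $\dim X/(X\cap Y)=\dim Y/(X\cap Y)=1$. The Grassmann graph $\Gamma(\mathcal{G})$ has vertex set $\mathcal{G}$ and its edges are the pairs of adjacent elements. When $\beta$ is infinite, the connected component containing $X\in\mathcal{G}$ consists of all $Y\in\mathcal{G}$ with $\dim X/(X\cap Y)=\dim Y/(X\cap Y)<\infty$. An apartment of a connected component $\mathcal{C}$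 is any non-empty intersection $\mathcal{A}\cap\mathcal{C}$, where $\mathcal{A}$ is an apartment of $\mathcal{G}$. A semilinear automorphism of $V$ is a bijection $l:V\to V$ such that $l(x+y)=l(x)+l(y)$ for all $x,y\in V$ and there is an automorphism $\sigma$ of the division ring with $l(ax)=\sigma(a)l(x)$ for all vectors $x$ and scalars $a$. *)

theory Defs
  imports Main "HOL.Hull" "HOL-Library.Set_Algebras"
begin

unbundle cardinal_syntax
no_notation elt_set_eq (infix "=o" 50)

text \<open>The library locales for modules and vector spaces require commutative scalars.  The
  following is the same axiomatisation over a division ring; the space \<open>V\<close> is the whole
  type \<open>'v\<close>.\<close>

locale left_vector_space =
  fixes scale :: "'k::division_ring \<Rightarrow> 'v::ab_group_add \<Rightarrow> 'v"  (infixr "*s" 75)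
  assumes scale_right_distrib: "a *s (x + y) = a *s x + a *s y"
    and scale_left_distrib: "(a + b) *s x = a *s x + b *s x"
    and scale_scale: "a *s (b *s x) = (a * b) *s x"
    and scale_one: "1 *s x = x"
begin

definition subspace :: "'v set \<Rightarrow> bool" where
  "subspace X \<longleftrightarrow> 0 \<in> X \<and> (\<forall>x\<in>X. \<forall>y\<in>X. x + y \<in> X) \<and> (\<forall>a. \<forall>x\<in>X. a *s x \<in> X)"

definition span :: "'v set \<Rightarrow> 'v set" where
  "span S = subspace hull S"

definition independent :: "'v set \<Rightarrow> bool" where
  "independent S \<longleftrightarrow> (\<forall>F a. finite F \<and> F \<subseteq> S \<and> (\<Sum>v\<in>F. a v *s v) = 0 \<longrightarrow> (\<forall>v\<in>F. a v = 0))"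

definition is_basis :: "'v set \<Rightarrow> 'v set \<Rightarrow> bool" where
  "is_basis X B \<longleftrightarrow> independent B \<and> span B = X"

text \<open>Dimensions are cardinals, so they are only determined up to \<open>=o\<close>; \<open>has_dim X \<kappa>\<close> reads
  \<open>dim X = \<kappa>\<close>.\<close>

definition has_dim :: "'v set \<Rightarrow> 'c rel \<Rightarrow> bool" where
  "has_dim X \<kappa> \<longleftrightarrow> (\<exists>B. is_basis X B \<and> |B| =o \<kappa>)"

text \<open>The quotient space \<open>Y/X\<close> of subspaces \<open>X \<subseteq> Y\<close> is the set of cosets of \<open>X\<close> in \<open>Y\<close>.
  Its addition is elementwise addition of sets, its zero is \<open>X\<close>, and the product of a scalar \<open>a\<close>
  with a coset \<open>C\<close> is \<open>a C + X\<close> (the summand \<open>X\<close> matters only for \<open>a = 0\<close>).  In a linear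
  combination of cosets it is enough to add \<open>X\<close> once, which also makes the empty linear
  combination equal to the zero \<open>X\<close>.\<close>

definition quotient_space :: "'v set \<Rightarrow> 'v set \<Rightarrow> 'v set set" where
  "quotient_space Y X = (\<lambda>y. {y} + X) ` Y"

definition coset_comb :: "'v set \<Rightarrow> ('v set \<Rightarrow> 'k) \<Rightarrow> 'v set set \<Rightarrow> 'v set" where
  "coset_comb X a F = (\<Sum>C\<in>F. (\<lambda>v. a C *s v) ` C) + X"

definition is_quotient_basis :: "'v set \<Rightarrow> 'v set \<Rightarrow> 'v set set \<Rightarrow> bool" where
  "is_quotient_basis Y X \<B> \<longleftrightarrow>
     \<B> \<subseteq> quotient_space Y X \<and>
     (\<forall>F a. finite F \<and> F \<subseteq> \<B> \<and> coset_comb X a F = X \<longrightarrow> (\<forall>C\<in>F. a C = 0)) \<and>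
     (\<forall>D\<in>quotient_space Y X. \<exists>F a. finite F \<and> F \<subseteq> \<B> \<and> D = coset_comb X a F)"

text \<open>\<open>has_quotient_dim Y X \<kappa>\<close> reads \<open>dim (Y/X) = \<kappa>\<close>.\<close>

definition has_quotient_dim :: "'v set \<Rightarrow> 'v set \<Rightarrow> 'c rel \<Rightarrow> bool" where
  "has_quotient_dim Y X \<kappa> \<longleftrightarrow> (\<exists>\<B>. is_quotient_basis Y X \<B> \<and> |\<B>| =o \<kappa>)"

text \<open>All subspaces of dimension \<open>\<delta>\<close> and codimension \<open>\<gamma>\<close>.  For \<open>\<alpha> = dim V\<close>,
  \<open>grassmannian \<beta> \<alpha>\<close> is \<open>\<G>\<^sub>\<beta>(V)\<close> and \<open>grassmannian \<alpha> \<beta>\<close> is \<open>\<G>\<^sup>\<beta>(V)\<close>.\<close>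

definition grassmannian :: "'c rel \<Rightarrow> 'd rel \<Rightarrow> 'v set set" where
  "grassmannian \<delta> \<gamma> = {X. subspace X \<and> has_dim X \<delta> \<and> has_quotient_dim UNIV X \<gamma>}"

definition adjacent :: "'v set \<Rightarrow> 'v set \<Rightarrow> bool" where
  "adjacent X Y \<longleftrightarrow> has_quotient_dim X (X \<inter> Y) cone \<and> has_quotient_dim Y (X \<inter> Y) cone"

definition grassmann_edges :: "'v set set \<Rightarrow> ('v set \<times> 'v set) set" where
  "grassmann_edges \<G> = {(X, Y). X \<in> \<G> \<and> Y \<in> \<G> \<and> adjacent X Y}"

definition components :: "'v set set \<Rightarrow> 'v set set set" where
  "components \<G> = \<G> // (grassmann_edges \<G>)\<^sup>*"

definition apartment :: "'v set set \<Rightarrow> 'v set \<Rightarrow> 'v set set" where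
  "apartment \<G> B = {X \<in> \<G>. \<exists>S\<subseteq>B. X = span S}"

definition component_apartments :: "'v set set \<Rightarrow> 'v set set \<Rightarrow> 'v set set set" where
  "component_apartments \<G> \<C> =
     {apartment \<G> B \<inter> \<C> | B. is_basis UNIV B \<and> apartment \<G> B \<inter> \<C> \<noteq> {}}"

definition semilinear_automorphism :: "('v \<Rightarrow> 'v) \<Rightarrow> bool" where
  "semilinear_automorphism l \<longleftrightarrow>
     bij l \<and> (\<forall>x y. l (x + y) = l x + l y) \<and>
     (\<exists>\<sigma> :: 'k \<Rightarrow> 'k.
        bij \<sigma> \<and> \<sigma> 1 = 1 \<and> (\<forall>a b. \<sigma> (a + b) = \<sigma> a + \<sigma> b) \<and> (\<forall>a b. \<sigma> (a * b) = \<sigma> a * \<sigma> b) \<and>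
        (\<forall>a x. l (a *s x) = \<sigma> a *s l x))"

end

end

theory Submission
  imports Defs
begin

text \<open>Any two elements of a component lie in a common apartment, and the elements of the apartment
  given by a basis \<open>B\<close> correspond to subsets of \<open>B\<close>.  Call a set of elements of an apartment
  inexact if it is also contained in another apartment.  The maximal inexact sets are the sets
  \<open>{X. i \<in> X \<longrightarrow> j \<in> X}\<close> for distinct basis vectors \<open>i\<close>, \<open>j\<close>, because \<open>i\<close> can then be replaced by
  \<open>i + j\<close>.  They detect adjacency (\<open>adj_iff_inexact\<close>), so \<open>f\<close> preserves adjacency in both
  directions (\<open>adj_image\<close>).

  An isomorphism of Grassmann graphs could still interchange the two kinds of maximal cliques: the
  stars, which consist of the elements above a common hyperplane \<open>U\<close>, and the tops, which consist of
  the elements below a common subspace \<open>W\<close>.  The apartments exclude this (\<open>star_image\<close>).  For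
  \<open>c \<in> B - U\<close> the points \<open>U + \<langle>c\<rangle>\<close> span the projective space of \<open>V/U\<close>, whereas the hyperplanes
  of \<open>W\<close> that omit one vector of a basis do not span the dual of the infinite-dimensional space
  \<open>W\<close>.  Hence \<open>f\<close> induces a bijection \<open>\<phi>\<close> (\<open>hyper_map\<close>) from the hyperplanes of \<open>X\<close> to those of
  \<open>f X\<close>.

  This \<open>\<phi>\<close> is a collineation between dual spaces, and for infinite-dimensional spaces such a map
  need not be induced by a map between the points.  But \<open>\<phi>\<close> maps the faces of a basis of \<open>X\<close> to
  the faces of a basis of \<open>f X\<close>, and this for every basis.  By \<open>hyper_map_contains\<close> this forces the
  hyperplanes through a point \<open>\<langle>b\<rangle>\<close> of \<open>X\<close> to be mapped to the hyperplanes through a point \<open>\<langle>b'\<rangle>\<close>.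
  The point \<open>\<langle>b'\<rangle>\<close> does not depend on \<open>X\<close> (\<open>point_pair_global\<close>), so there is a bijection between
  the points of \<open>V\<close> that induces \<open>f\<close>.  Every line is an intersection of elements of the component
  (\<open>span_iff_class\<close>); therefore this bijection is a collineation, and the fundamental theorem of
  projective geometry (\<open>fundamental_theorem\<close>) yields the semilinear automorphism.

  Dimensions enter only through \<open>component_class\<close>: the Grassmannian is closed under adjacency
  since some linear automorphism maps a subspace to an adjacent one, and no element of a component
  properly contains another one since the relative index is \<open>0\<close> along paths.\<close>

section \<open>Spans and bases over a division ring\<close>

context left_vector_space
begin

lemma scale_zero_left [simp]: "0 *s x = 0"
  by (metis scale_left_distrib add_cancel_right_right)

lemma scale_zero_right [simp]: "a *s 0 = 0"
  by (metis scale_right_distrib add_cancel_right_right)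

lemma scale_minus_left [simp]: "(- a) *s x = - (a *s x)"
  by (metis scale_left_distrib scale_zero_left add_eq_0_iff neg_eq_iff_add_eq_0)

lemma scale_minus_right [simp]: "a *s (- x) = - (a *s x)"
  by (metis scale_right_distrib scale_zero_right add_eq_0_iff neg_eq_iff_add_eq_0)

lemma scale_diff_right: "a *s (x - y) = a *s x - a *s y"
  using scale_right_distrib[of a x "- y"] by simp

lemma scale_diff_left: "(a - b) *s x = a *s x - b *s x"
  using scale_left_distrib[of a "- b" x] by simp

lemma scale_inverse [simp]: "a \<noteq> 0 \<Longrightarrow> inverse a *s a *s x = x"
  by (simp add: scale_scale scale_one)

lemma scale_eq_0_iff [simp]: "a *s x = 0 \<longleftrightarrow> a = 0 \<or> x = 0"
  by (metis scale_inverse scale_zero_left scale_zero_right)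

lemma subspace_0: "subspace X \<Longrightarrow> 0 \<in> X"
  and subspace_add: "subspace X \<Longrightarrow> x \<in> X \<Longrightarrow> y \<in> X \<Longrightarrow> x + y \<in> X"
  and subspace_scale: "subspace X \<Longrightarrow> x \<in> X \<Longrightarrow> a *s x \<in> X"
  by (auto simp: subspace_def)

lemma subspace_neg: "subspace X \<Longrightarrow> x \<in> X \<Longrightarrow> - x \<in> X"
  by (metis scale_minus_left scale_one subspace_scale)

lemma subspace_diff: "subspace X \<Longrightarrow> x \<in> X \<Longrightarrow> y \<in> X \<Longrightarrow> x - y \<in> X"
  using subspace_add[of X x "- y"] subspace_neg[of X y] by simp

lemma subspace_Inter: "(\<And>X. X \<in> M \<Longrightarrow> subspace X) \<Longrightarrow> subspace (\<Inter>M)"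
  unfolding subspace_def by blast

lemma subspace_Int: "subspace X \<Longrightarrow> subspace Y \<Longrightarrow> subspace (X \<inter> Y)"
  unfolding subspace_def by blast

lemma subspace_UNIV: "subspace UNIV"
  unfolding subspace_def by blast

lemma subspace_sum: "subspace X \<Longrightarrow> (\<And>i. i \<in> F \<Longrightarrow> g i \<in> X) \<Longrightarrow> (\<Sum>i\<in>F. g i) \<in> X"
  by (induction F rule: infinite_finite_induct) (auto simp: subspace_0 subspace_add)

lemma subspace_span [simp]: "subspace (span A)"
  unfolding span_def by (rule hull_in) (rule subspace_Inter, simp)

lemma span_superset: "A \<subseteq> span A"
  unfolding span_def by (rule hull_subset)

lemma span_base: "x \<in> A \<Longrightarrow> x \<in> span A"
  using span_superset by blast

lemma span_minimal: "A \<subseteq> X \<Longrightarrow> subspace X \<Longrightarrow> span A \<subseteq> X"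
  unfolding span_def by (rule hull_minimal)

lemma span_mono: "A \<subseteq> A' \<Longrightarrow> span A \<subseteq> span A'"
  by (meson span_minimal span_superset subspace_span subset_trans)

lemma span_subspace [simp]: "subspace X \<Longrightarrow> span X = X"
  by (simp add: span_minimal span_superset subset_antisym)

lemma span_subset_iff: "subspace X \<Longrightarrow> span A \<subseteq> X \<longleftrightarrow> A \<subseteq> X"
  using span_minimal span_superset by blast

lemma span_zero [simp]: "0 \<in> span A"
  by (simp add: subspace_0)

lemmas span_add = subspace_add[OF subspace_span]
lemmas span_scale = subspace_scale[OF subspace_span]
lemmas span_neg = subspace_neg[OF subspace_span]
lemmas span_diff = subspace_diff[OF subspace_span]

lemma span_empty [simp]: "span {} = {0}"
proof
  show "span {} \<subseteq> {0}" by (rule span_minimal) (auto simp: subspace_def)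
qed simp

lemma span_insert: "v \<in> span (insert x A) \<longleftrightarrow> (\<exists>a. v - a *s x \<in> span A)"
proof
  let ?S = "{v. \<exists>a. v - a *s x \<in> span A}"
  have "subspace ?S"
    unfolding subspace_def
  proof (intro conjI ballI allI)
    show "0 \<in> ?S" by (simp add: exI[of _ 0])
    fix v c assume "v \<in> ?S"
    then obtain a where a: "v - a *s x \<in> span A" by blast
    have "c *s v - (c * a) *s x = c *s (v - a *s x)" by (simp add: scale_diff_right scale_scale)
    then have "c *s v - (c * a) *s x \<in> span A" using span_scale[OF a] by simp
    then show "c *s v \<in> ?S" by blast
  next
    fix v w assume "v \<in> ?S" "w \<in> ?S"
    then obtain a b where "v - a *s x \<in> span A" "w - b *s x \<in> span A" by blast
    moreover have "v + w - (a + b) *s x = (v - a *s x) + (w - b *s x)"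
      by (simp add: scale_left_distrib algebra_simps)
    ultimately have "v + w - (a + b) *s x \<in> span A" using span_add by metis
    then show "v + w \<in> ?S" by blast
  qed
  moreover have "insert x A \<subseteq> ?S"
  proof -
    have "x - 1 *s x \<in> span A" by (simp add: scale_one)
    moreover have "y - 0 *s x \<in> span A" if "y \<in> A" for y using that by (simp add: span_base)
    ultimately show ?thesis by blast
  qed
  ultimately have "span (insert x A) \<subseteq> ?S" by (rule span_minimal[rotated])
  then show "v \<in> span (insert x A) \<Longrightarrow> \<exists>a. v - a *s x \<in> span A" by blast
next
  assume "\<exists>a. v - a *s x \<in> span A"
  then obtain a where "v - a *s x \<in> span A" by blast
  then have "v - a *s x \<in> span (insert x A)" using span_mono[of A "insert x A"] by blast
  moreover have "a *s x \<in> span (insert x A)" by (simp add: span_scale span_base)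
  ultimately show "v \<in> span (insert x A)" using span_add by fastforce
qed

lemma span_Un_span: "span (span A \<union> A') = span (A \<union> A')"
proof
  show "span (span A \<union> A') \<subseteq> span (A \<union> A')"
    by (rule span_minimal) (auto intro: span_base subsetD[OF span_mono, of A])
  show "span (A \<union> A') \<subseteq> span (span A \<union> A')" by (rule span_mono) (use span_superset in blast)
qed

lemma span_insert_span: "span (insert x (span A)) = span (insert x A)"
  using span_Un_span[of A "{x}"] by simp

lemma span_Un: "v \<in> span (A \<union> A') \<longleftrightarrow> (\<exists>x\<in>span A. \<exists>y\<in>span A'. v = x + y)"
proof
  let ?S = "{x + y |x y. x \<in> span A \<and> y \<in> span A'}"
  have "subspace ?S"
    unfolding subspace_def
  proof (intro conjI ballI allI)
    show "0 \<in> ?S"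
      using span_zero[of A] span_zero[of A'] add_0_left[of 0] by (intro CollectI exI[of _ 0]) simp
    fix v c assume "v \<in> ?S"
    then show "c *s v \<in> ?S" using scale_right_distrib span_scale by blast
  next
    fix v w assume "v \<in> ?S" "w \<in> ?S"
    then obtain x y x' y' where *: "v = x + y" "w = x' + y'"
      "x \<in> span A" "y \<in> span A'" "x' \<in> span A" "y' \<in> span A'"
      by blast
    then have "v + w = (x + x') + (y + y')" by (simp add: algebra_simps)
    moreover have "x + x' \<in> span A" "y + y' \<in> span A'" using * span_add by auto
    ultimately show "v + w \<in> ?S" by blast
  qed
  moreover have "A \<union> A' \<subseteq> ?S"
  proof
    fix v assume "v \<in> A \<union> A'"
    then have "v = v + 0 \<and> v \<in> span A \<and> 0 \<in> span A' \<or> v = 0 + v \<and> 0 \<in> span A \<and> v \<in> span A'"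
      by (auto intro: span_base)
    then show "v \<in> ?S" by blast
  qed
  ultimately have "span (A \<union> A') \<subseteq> ?S" by (rule span_minimal[rotated])
  then show "v \<in> span (A \<union> A') \<Longrightarrow> \<exists>x\<in>span A. \<exists>y\<in>span A'. v = x + y" by blast
next
  assume "\<exists>x\<in>span A. \<exists>y\<in>span A'. v = x + y"
  then obtain x y where xy: "x \<in> span A" "y \<in> span A'" "v = x + y" by blast
  moreover have "span A \<subseteq> span (A \<union> A')" "span A' \<subseteq> span (A \<union> A')" by (simp_all add: span_mono)
  ultimately show "v \<in> span (A \<union> A')" by (simp add: span_add subsetD)
qed

lemma span_finitary: "v \<in> span A \<Longrightarrow> \<exists>F. finite F \<and> F \<subseteq> A \<and> v \<in> span F"
proof -
  let ?S = "{v. \<exists>F. finite F \<and> F \<subseteq> A \<and> v \<in> span F}"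
  have "subspace ?S"
    unfolding subspace_def
  proof (intro conjI ballI allI)
    show "0 \<in> ?S" by (intro CollectI exI[of _ "{}"]) auto
    fix v c assume "v \<in> ?S"
    then show "c *s v \<in> ?S" using span_scale by blast
  next
    fix v w assume "v \<in> ?S" "w \<in> ?S"
    then obtain F F' where "finite F" "F \<subseteq> A" "v \<in> span F" "finite F'" "F' \<subseteq> A" "w \<in> span F'"
      by blast
    then have "finite (F \<union> F') \<and> F \<union> F' \<subseteq> A \<and> v + w \<in> span (F \<union> F')" using span_Un by blast
    then show "v + w \<in> ?S" by blast
  qed
  moreover have "A \<subseteq> ?S"
  proof
    fix x assume "x \<in> A"
    then have "finite {x} \<and> {x} \<subseteq> A \<and> x \<in> span {x}" by (simp add: span_base)
    then show "x \<in> ?S" by blast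
  qed
  ultimately have "span A \<subseteq> ?S" by (rule span_minimal[rotated])
  then show "v \<in> span A \<Longrightarrow> ?thesis" by blast
qed

lemma span_finite_explicit:
  "finite F \<Longrightarrow> v \<in> span F \<Longrightarrow> \<exists>a. v = (\<Sum>w\<in>F. a w *s w)"
proof (induction F arbitrary: v rule: finite_induct)
  case (insert x F)
  then obtain c where "v - c *s x \<in> span F" using span_insert by blast
  then obtain a where a: "v - c *s x = (\<Sum>w\<in>F. a w *s w)" using insert.IH by blast
  have "(\<Sum>w\<in>F. (a(x := c)) w *s w) = (\<Sum>w\<in>F. a w *s w)" by (rule sum.cong) (use insert.hyps in auto)
  then have "v = (\<Sum>w\<in>insert x F. (a(x := c)) w *s w)"
    using a insert.hyps by (simp add: algebra_simps)
  then show ?case by blast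
qed simp

lemma exchange: "u \<in> span (insert g A) \<Longrightarrow> u \<notin> span A \<Longrightarrow> g \<in> span (insert u A)"
proof -
  assume "u \<in> span (insert g A)" "u \<notin> span A"
  then obtain a where a: "u - a *s g \<in> span A" using span_insert by blast
  with \<open>u \<notin> span A\<close> have "a \<noteq> 0" by auto
  have "inverse a *s (u - a *s g) \<in> span A" using a by (rule span_scale)
  then have "- (g - inverse a *s u) \<in> span A" using \<open>a \<noteq> 0\<close> by (simp add: scale_diff_right)
  then have "g - inverse a *s u \<in> span A" using span_neg by fastforce
  then show "g \<in> span (insert u A)" using span_insert by blast
qed

text \<open>Independence modulo a subspace \<open>X\<close>, in a form that mentions only the operator \<open>span\<close>.  With
  exchange and finitarity it gives the theory of bases without any computation with
  coefficients.\<close>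

definition indep_mod :: "'v set \<Rightarrow> 'v set \<Rightarrow> bool" where
  "indep_mod X S \<longleftrightarrow> (\<forall>v\<in>S. v \<notin> span (X \<union> (S - {v})))"

lemma indep_mod_iff:
  assumes X: "subspace X"
  shows "indep_mod X S \<longleftrightarrow>
    (\<forall>F a. finite F \<and> F \<subseteq> S \<and> (\<Sum>v\<in>F. a v *s v) \<in> X \<longrightarrow> (\<forall>v\<in>F. a v = 0))" (is "_ \<longleftrightarrow> ?lin")
proof
  assume ind: ?lin
  show "indep_mod X S"
    unfolding indep_mod_def
  proof (intro ballI notI)
    fix v assume v: "v \<in> S" "v \<in> span (X \<union> (S - {v}))"
    then obtain x y where xy: "x \<in> X" "y \<in> span (S - {v})" "v = x + y" using span_Un X by auto
    obtain F where F: "finite F" "F \<subseteq> S - {v}" "y \<in> span F" using span_finitary[OF xy(2)] by auto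
    then obtain a where a: "y = (\<Sum>w\<in>F. a w *s w)" using span_finite_explicit by blast
    let ?a = "a(v := - 1)"
    have "(\<Sum>w\<in>F. ?a w *s w) = y" unfolding a by (rule sum.cong) (use F in auto)
    moreover have "v \<notin> F" using F by blast
    ultimately have "(\<Sum>w\<in>insert v F. ?a w *s w) = - v + y" using F by (simp add: scale_one)
    also have "\<dots> = - x" using xy(3) by simp
    finally have "(\<Sum>w\<in>insert v F. ?a w *s w) \<in> X" using subspace_neg[OF X xy(1)] by simp
    moreover have "finite (insert v F)" "insert v F \<subseteq> S" using F v by auto
    ultimately have "?a v = 0" using ind by blast
    then show False by simp
  qed
next
  assume ind: "indep_mod X S"
  show ?lin
  proof (intro allI impI ballI, rule ccontr)
    fix F a v assume F: "finite F \<and> F \<subseteq> S \<and> (\<Sum>v\<in>F. a v *s v) \<in> X" "v \<in> F" "a v \<noteq> 0"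
    have "(\<Sum>w\<in>F. a w *s w) = a v *s v + (\<Sum>w\<in>F - {v}. a w *s w)" using F by (intro sum.remove) auto
    then have "a v *s v = (\<Sum>w\<in>F. a w *s w) - (\<Sum>w\<in>F - {v}. a w *s w)" by simp
    moreover have "(\<Sum>w\<in>F. a w *s w) \<in> span (X \<union> (S - {v}))" using F by (intro span_base) auto
    moreover have "(\<Sum>w\<in>F - {v}. a w *s w) \<in> span (X \<union> (S - {v}))"
      using F by (intro subspace_sum[OF subspace_span] span_scale span_base) auto
    ultimately have "inverse (a v) *s a v *s v \<in> span (X \<union> (S - {v}))"
      using span_scale span_diff by metis
    then show False using F ind unfolding indep_mod_def by auto
  qed
qed

lemma independent_iff: "independent S \<longleftrightarrow> (\<forall>v\<in>S. v \<notin> span (S - {v}))"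
proof -
  have "span ({0} \<union> A) = span A" for A using span_Un_span[of "{}" A] by simp
  then have "(\<forall>v\<in>S. v \<notin> span (S - {v})) \<longleftrightarrow> indep_mod {0} S" unfolding indep_mod_def by simp
  also have "\<dots> \<longleftrightarrow> independent S"
    unfolding independent_def using indep_mod_iff[of "{0}" S] by (simp add: subspace_def)
  finally show ?thesis by simp
qed

lemma independent_mono: "independent S \<Longrightarrow> T \<subseteq> S \<Longrightarrow> independent T"
  unfolding independent_def by blast

lemma independent_empty: "independent {}"
  unfolding independent_def by simp

lemma independent_insert:
  assumes "independent S" "v \<notin> span S"
  shows "independent (insert v S)"
  unfolding independent_iff
proof (intro ballI notI)
  fix w assume w: "w \<in> insert v S" "w \<in> span (insert v S - {w})"
  have "v \<notin> S" using assms span_base by blast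
  show False
  proof (cases "w = v")
    case True
    then show False using w assms \<open>v \<notin> S\<close> by simp
  next
    case False
    then have "w \<in> S" and "insert v S - {w} = insert v (S - {w})" using w by auto
    moreover from \<open>w \<in> S\<close> have "w \<notin> span (S - {w})" using assms independent_iff by blast
    ultimately have "v \<in> span (insert w (S - {w}))" using exchange[of w v "S - {w}"] w by simp
    moreover have "insert w (S - {w}) = S" using \<open>w \<in> S\<close> by blast
    ultimately show False using assms by simp
  qed
qed

lemma independent_nonzero: "independent S \<Longrightarrow> v \<in> S \<Longrightarrow> v \<noteq> 0"
  using independent_iff by auto

text \<open>Zorn's lemma applies because a union of a chain of independent sets is independent, by
  finitarity of \<open>span\<close>.\<close>

lemma independent_extends:
  assumes "independent I" "I \<subseteq> J"
  shows "\<exists>B. independent B \<and> I \<subseteq> B \<and> B \<subseteq> J \<and> span B = span J"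
proof -
  let ?\<A> = "{B. independent B \<and> I \<subseteq> B \<and> B \<subseteq> J}"
  have "\<exists>M\<in>?\<A>. \<forall>X\<in>?\<A>. M \<subseteq> X \<longrightarrow> X = M"
  proof (rule subset_Zorn_nonempty)
    show "?\<A> \<noteq> {}" using assms by blast
    fix \<C> assume \<C>: "\<C> \<noteq> {}" "subset.chain ?\<A> \<C>"
    have "independent (\<Union>\<C>)"
      unfolding independent_iff
    proof (intro ballI notI)
      fix v assume "v \<in> \<Union>\<C>" and v: "v \<in> span (\<Union>\<C> - {v})"
      obtain F where F: "finite F" "F \<subseteq> \<Union>\<C> - {v}" "v \<in> span F" using span_finitary[OF v] by auto
      then have "finite (insert v F)" "insert v F \<subseteq> \<Union>\<C>" using \<open>v \<in> \<Union>\<C>\<close> by auto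
      then obtain B where "B \<in> \<C>" "insert v F \<subseteq> B"
        using \<C> finite_subset_Union_chain[of "insert v F" \<C> ?\<A>] by blast
      moreover have "independent B" using \<open>B \<in> \<C>\<close> \<C> unfolding subset.chain_def by blast
      moreover have "v \<in> span (B - {v})" using F \<open>insert v F \<subseteq> B\<close> span_mono[of F "B - {v}"] by blast
      ultimately show False using independent_iff by blast
    qed
    then show "\<Union>\<C> \<in> ?\<A>" using \<C> unfolding subset.chain_def by blast
  qed
  then obtain B where B: "independent B" "I \<subseteq> B" "B \<subseteq> J"
    and max: "\<And>X. independent X \<Longrightarrow> I \<subseteq> X \<Longrightarrow> X \<subseteq> J \<Longrightarrow> B \<subseteq> X \<Longrightarrow> X = B"
    by auto
  have "J \<subseteq> span B"
  proof
    fix x assume "x \<in> J"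
    show "x \<in> span B"
    proof (rule ccontr)
      assume "x \<notin> span B"
      then have "insert x B = B" using B \<open>x \<in> J\<close> by (intro max independent_insert) auto
      then show False using \<open>x \<notin> span B\<close> span_base by blast
    qed
  qed
  then have "span B = span J" using B span_mono span_minimal subspace_span by (meson subset_antisym)
  then show ?thesis using B by blast
qed

lemma basis_extends:
  assumes "independent I" "I \<subseteq> X" "subspace X"
  shows "\<exists>B. I \<subseteq> B \<and> is_basis X B"
  using independent_extends[OF assms(1,2)] assms(3) unfolding is_basis_def by auto

text \<open>Every vector has a smallest set of basis vectors that spans it, so spans of subsets of a
  basis are determined by, and intersect like, these subsets.\<close>

lemma support_exists:
  assumes "independent B" "v \<in> span B"
  shows "\<exists>F. finite F \<and> F \<subseteq> B \<and> v \<in> span F \<and> (\<forall>S\<subseteq>B. v \<in> span S \<longrightarrow> F \<subseteq> S)"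
proof -
  let ?P = "\<lambda>F. finite F \<and> F \<subseteq> B \<and> v \<in> span F"
  obtain F0 where "?P F0" using span_finitary[OF assms(2)] by auto
  then obtain F where F: "?P F" and min: "\<And>G. ?P G \<Longrightarrow> card F \<le> card G"
    using ex_has_least_nat[of ?P F0 card] by auto
  have "s \<in> S" if S: "S \<subseteq> B" "v \<in> span S" and "s \<in> F" for S s
  proof (rule ccontr)
    assume "s \<notin> S"
    have "card (F - {s}) < card F" using F \<open>s \<in> F\<close> by (intro card_Diff1_less) auto
    then have "v \<notin> span (F - {s})" using min[of "F - {s}"] F by auto
    moreover have "v \<in> span (insert s (F - {s}))" using F \<open>s \<in> F\<close> by (simp add: insert_absorb)
    ultimately have "s \<in> span (insert v (F - {s}))" by (rule exchange[rotated])
    moreover have "v \<in> span (B - {s})" using S \<open>s \<notin> S\<close> span_mono[of S "B - {s}"] by blast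
    then have "insert v (F - {s}) \<subseteq> span (B - {s})" using F span_superset[of "B - {s}"] by blast
    then have "span (insert v (F - {s})) \<subseteq> span (B - {s})" by (rule span_minimal) simp
    ultimately show False using assms F \<open>s \<in> F\<close> independent_iff by blast
  qed
  then show ?thesis using F by blast
qed

lemma independent_span_mem:
  assumes "independent B" "S \<subseteq> B" "b \<in> B" "b \<in> span S"
  shows "b \<in> S"
  using assms span_mono[of S "B - {b}"] unfolding independent_iff by blast

lemma basis_independent: "is_basis X B \<Longrightarrow> independent B"
  unfolding is_basis_def by auto

lemma basis_span: "is_basis UNIV B \<Longrightarrow> v \<in> span B"
  unfolding is_basis_def by auto

text \<open>If \<open>X\<close> is spanned by any subset of a basis \<open>B\<close>, then this subset is \<open>B \<inter> X\<close>; see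
  \<open>adapted_iff\<close> and \<open>adapted_span_Int\<close>.\<close>

definition adapted :: "'v set \<Rightarrow> 'v set \<Rightarrow> bool" where
  "adapted B X \<longleftrightarrow> X = span (B \<inter> X)"

lemma adapted_subspace: "adapted B X \<Longrightarrow> subspace X"
  unfolding adapted_def by (metis subspace_span)

lemma adapted_span: "S \<subseteq> B \<Longrightarrow> adapted B (span S)"
  unfolding adapted_def
  by (metis Int_subset_iff span_minimal span_mono span_superset subset_antisym
      subspace_span inf_le2)

lemma adapted_span_Int: "independent B \<Longrightarrow> S \<subseteq> B \<Longrightarrow> B \<inter> span S = S"
  using independent_span_mem span_base by blast

lemma adapted_iff: "adapted B X \<longleftrightarrow> (\<exists>S\<subseteq>B. X = span S)"
  using adapted_span unfolding adapted_def by blast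

lemma adapted_subset: "adapted B X \<Longrightarrow> adapted B Y \<Longrightarrow> B \<inter> X \<subseteq> Y \<Longrightarrow> X \<subseteq> Y"
  using adapted_subspace span_minimal unfolding adapted_def by blast

lemma adapted_Inter:
  assumes "independent B" "M \<noteq> {}" "\<And>X. X \<in> M \<Longrightarrow> adapted B X"
  shows "adapted B (\<Inter>M)"
proof -
  have "v \<in> span (B \<inter> \<Inter>M)" if v: "v \<in> \<Inter>M" for v
  proof -
    have "v \<in> span (B \<inter> X)" if "X \<in> M" for X
      using v assms(3)[OF that] that unfolding adapted_def by blast
    moreover obtain X where "X \<in> M" using assms(2) by blast
    ultimately have "v \<in> span B" using span_mono[of "B \<inter> X" B] by blast
    then obtain F where F: "F \<subseteq> B" "v \<in> span F" "\<forall>S\<subseteq>B. v \<in> span S \<longrightarrow> F \<subseteq> S"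
      using support_exists[OF assms(1)] by metis
    have "F \<subseteq> X" if "X \<in> M" for X using F(3) \<open>\<And>X. X \<in> M \<Longrightarrow> v \<in> span (B \<inter> X)\<close>[OF that] by blast
    then show ?thesis using F span_mono[of F "B \<inter> \<Inter>M"] by blast
  qed
  moreover have "subspace (\<Inter>M)" using assms(3) adapted_subspace by (intro subspace_Inter) blast
  ultimately show ?thesis unfolding adapted_def using span_minimal[of "B \<inter> \<Inter>M" "\<Inter>M"] by blast
qed

lemma adapted_Int: "independent B \<Longrightarrow> adapted B X \<Longrightarrow> adapted B Y \<Longrightarrow> adapted B (X \<inter> Y)"
  using adapted_Inter[of B "{X, Y}"] by auto

lemma adapted_sum: "adapted B X \<Longrightarrow> adapted B Y \<Longrightarrow> adapted B (span (X \<union> Y))"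
  unfolding adapted_iff by (metis Un_subset_iff span_Un_span sup_commute)

text \<open>Extend a basis of \<open>X \<inter> Y\<close> to one of \<open>X\<close> and then, by vectors of \<open>Y\<close>, to one of
  \<open>X + Y\<close>; by the modular law the result is adapted to \<open>Y\<close> as well.\<close>

lemma common_adapted_basis:
  assumes X: "subspace X" and Y: "subspace Y" and I: "independent I" "I \<subseteq> X \<inter> Y"
  shows "\<exists>B. is_basis UNIV B \<and> I \<subseteq> B \<and> adapted B X \<and> adapted B Y"
proof -
  obtain K where K: "I \<subseteq> K" "independent K" "span K = X \<inter> Y"
    using basis_extends[OF I subspace_Int[OF X Y]] unfolding is_basis_def by auto
  then have "K \<subseteq> X" "K \<subseteq> Y" using span_superset by blast+
  then obtain BX where BX: "K \<subseteq> BX" "independent BX" "span BX = X"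
    using basis_extends[OF K(2) _ X] unfolding is_basis_def by auto
  then obtain BW where BW: "independent BW" "BX \<subseteq> BW" "BW \<subseteq> BX \<union> Y" "span BW = span (BX \<union> Y)"
    using independent_extends[of BX "BX \<union> Y"] by auto
  obtain B where B: "BW \<subseteq> B" "is_basis UNIV B" using basis_extends[OF BW(1) _ subspace_UNIV] by auto
  have "adapted B X" using adapted_span[of BX B] BX BW B by auto
  moreover have "Y = span (K \<union> (BW - BX))"
  proof
    show "span (K \<union> (BW - BX)) \<subseteq> Y" using \<open>K \<subseteq> Y\<close> BW Y by (intro span_minimal) auto
    show "Y \<subseteq> span (K \<union> (BW - BX))"
    proof
      fix y assume y: "y \<in> Y"
      have "y \<in> span (BX \<union> (BW - BX))" using y BW span_base[of y "BX \<union> Y"] by (simp add: Un_absorb1)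
      then obtain x e where xe: "x \<in> X" "e \<in> span (BW - BX)" "y = x + e" using span_Un BX by blast
      have "span (BW - BX) \<subseteq> Y" using BW Y by (intro span_minimal) auto
      then have "x \<in> Y" using xe y Y subspace_diff[of Y y e] by auto
      then have "x \<in> span K" using xe K by blast
      then show "y \<in> span (K \<union> (BW - BX))" using xe span_Un by blast
    qed
  qed
  then have "adapted B Y" using adapted_span[of "K \<union> (BW - BX)" B] BX BW B by blast
  ultimately show ?thesis using B K BX BW by blast
qed

lemma exists_adapted_basis:
  assumes "subspace X" "independent I" "I \<subseteq> X"
  shows "\<exists>B. is_basis UNIV B \<and> I \<subseteq> B \<and> adapted B X"
  using common_adapted_basis[of X X I] assms by auto

lemma basis_exchange:
  assumes B: "is_basis UNIV B" "i \<in> B" and v: "v \<notin> span (B - {i})"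
  shows "is_basis UNIV (insert v (B - {i}))"
proof -
  have "independent (insert v (B - {i}))"
    using assms independent_insert independent_mono[of B "B - {i}"] is_basis_def by blast
  moreover have "v \<in> span (insert i (B - {i}))" using B basis_span by (simp add: insert_absorb)
  then have "i \<in> span (insert v (B - {i}))" using v by (rule exchange)
  then have "B \<subseteq> span (insert v (B - {i}))" using span_superset[of "insert v (B - {i})"] by blast
  then have "span B \<subseteq> span (insert v (B - {i}))" by (rule span_minimal) simp
  ultimately show ?thesis using B unfolding is_basis_def by blast
qed

end

context left_vector_space
begin

section \<open>Hyperplanes and adjacency\<close>

definition hyperplane :: "'v set \<Rightarrow> 'v set \<Rightarrow> bool" where
  "hyperplane K X \<longleftrightarrow> subspace K \<and> (\<exists>x. x \<notin> K \<and> X = span (insert x K))"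

text \<open>By \<open>adjacent_iff\<close> below this is \<open>adjacent\<close>, without the reference to cosets.\<close>

definition adj :: "'v set \<Rightarrow> 'v set \<Rightarrow> bool" where
  "adj X Y \<longleftrightarrow> hyperplane (X \<inter> Y) X \<and> hyperplane (X \<inter> Y) Y"

lemma hyperplane_subspaces: "hyperplane K X \<Longrightarrow> subspace K \<and> subspace X"
  unfolding hyperplane_def by auto

lemma hyperplane_psubset: "hyperplane K X \<Longrightarrow> K \<subset> X"
  unfolding hyperplane_def using span_superset by blast

lemma hyperplane_intro: "subspace K \<Longrightarrow> x \<notin> K \<Longrightarrow> hyperplane K (span (insert x K))"
  unfolding hyperplane_def by blast

lemma span_insert_subspace: "subspace K \<Longrightarrow> v \<in> span (insert x K) \<longleftrightarrow> (\<exists>a. v - a *s x \<in> K)"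
  using span_insert by simp

lemma span_insert_least:
  "subspace X \<Longrightarrow> K \<subseteq> X \<Longrightarrow> x \<in> X \<Longrightarrow> span (insert x K) \<subseteq> X"
  by (rule span_minimal) auto

lemma span_insert_upper: "K \<subseteq> span (insert x K)" "x \<in> span (insert x K)"
  using span_superset[of "insert x K"] by auto

lemma hyperplane_span_insert:
  assumes "hyperplane K X" "x \<in> X" "x \<notin> K"
  shows "X = span (insert x K)"
proof -
  obtain z where z: "subspace K" "z \<notin> K" "X = span (insert z K)"
    using assms unfolding hyperplane_def by auto
  have "z \<in> span (insert x K)" using exchange[of x z K] z assms by simp
  then have "X \<subseteq> span (insert x K)"
    unfolding z(3) by (intro span_insert_least) (auto intro: span_insert_upper span_base)
  moreover have "span (insert x K) \<subseteq> X"
    using assms hyperplane_subspaces[OF assms(1)] hyperplane_psubset[OF assms(1)]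
    by (intro span_insert_least) auto
  ultimately show ?thesis by blast
qed

lemma hyperplane_maximal:
  assumes "hyperplane K X" "subspace L" "K \<subseteq> L" "L \<subseteq> X"
  shows "L = K \<or> L = X"
proof (rule disjCI)
  assume "L \<noteq> X"
  show "L = K"
  proof (rule ccontr)
    assume "L \<noteq> K"
    then obtain x where "x \<in> L" "x \<notin> K" using assms by blast
    then have "X = span (insert x K)" using hyperplane_span_insert assms by blast
    then have "X \<subseteq> L" using span_insert_least assms \<open>x \<in> L\<close> by simp
    then show False using \<open>L \<noteq> X\<close> assms by blast
  qed
qed

lemma hyperplane_subset_eq: "hyperplane K X \<Longrightarrow> hyperplane L X \<Longrightarrow> K \<subseteq> L \<Longrightarrow> K = L"
  using hyperplane_maximal hyperplane_psubset hyperplane_subspaces by (metis order_less_le)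

lemma hyperplane_Int:
  assumes "hyperplane K X" "subspace Y" "Y \<subseteq> X" "\<not> Y \<subseteq> K"
  shows "hyperplane (K \<inter> Y) Y"
proof -
  obtain y where y: "y \<in> Y" "y \<notin> K" using assms by blast
  have X: "X = span (insert y K)" and K: "subspace K"
    using hyperplane_span_insert hyperplane_subspaces assms y by blast+
  have "Y = span (insert y (K \<inter> Y))"
  proof
    show "span (insert y (K \<inter> Y)) \<subseteq> Y" using assms y by (intro span_insert_least) auto
    show "Y \<subseteq> span (insert y (K \<inter> Y))"
    proof
      fix v assume v: "v \<in> Y"
      then obtain a where a: "v - a *s y \<in> K" using X K assms span_insert_subspace by blast
      have "a *s y \<in> Y" using y assms by (intro subspace_scale)
      then have "v - a *s y \<in> Y" using v assms by (intro subspace_diff)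
      then show "v \<in> span (insert y (K \<inter> Y))"
        using a span_insert_subspace[OF subspace_Int[OF K \<open>subspace Y\<close>]] by blast
    qed
  qed
  then show ?thesis using y K assms unfolding hyperplane_def by (auto intro: subspace_Int)
qed

text \<open>If \<open>N = M + \<langle>m\<rangle>\<close>, then \<open>X = M + \<langle>m\<rangle> + \<langle>x\<rangle>\<close>, in which \<open>m\<close> and \<open>x\<close> can be interchanged.\<close>

lemma hyperplane_insert:
  assumes "hyperplane M N" "hyperplane N X" "x \<in> X" "x \<notin> N"
  shows "hyperplane (span (insert x M)) X"
proof -
  obtain m where m: "m \<in> N" "m \<notin> M" using hyperplane_psubset assms by blast
  have M: "subspace M" and "subspace N" "M \<subseteq> N"
    using assms hyperplane_subspaces hyperplane_psubset by blast+
  have N: "N = span (insert m M)" using hyperplane_span_insert assms m by blast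
  have "X = span (insert x N)" using hyperplane_span_insert assms by blast
  also have "\<dots> = span (insert x (insert m M))" unfolding N span_insert_span ..
  also have "\<dots> = span (insert m (span (insert x M)))" by (simp add: span_insert_span insert_commute)
  finally have X: "X = span (insert m (span (insert x M)))" .
  have "m \<notin> span (insert x M)"
  proof
    assume "m \<in> span (insert x M)"
    then have "x \<in> span (insert m M)" using exchange[of m x M] m M by simp
    then show False using N assms by simp
  qed
  then show ?thesis unfolding X by (intro hyperplane_intro) auto
qed

lemma hyperplane_separate:
  assumes "subspace X" "subspace W" "W \<subseteq> X" "x \<in> X" "x \<notin> W"
  shows "\<exists>H. hyperplane H X \<and> W \<subseteq> H \<and> x \<notin> H"
proof -
  obtain A where A: "independent A" "span A = W"
    using basis_extends[OF independent_empty _ assms(2)] unfolding is_basis_def by auto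
  then have "independent (insert x A)" using assms by (simp add: independent_insert)
  moreover have "insert x A \<subseteq> X" using A assms span_superset by blast
  ultimately obtain B where B: "insert x A \<subseteq> B" "independent B" "span B = X"
    using basis_extends[of "insert x A" X] assms unfolding is_basis_def by auto
  have "x \<notin> span (B - {x})" using B unfolding independent_iff by blast
  moreover have "X = span (insert x (span (B - {x})))"
    using B by (simp add: span_insert_span insert_absorb)
  ultimately have "hyperplane (span (B - {x})) X" unfolding hyperplane_def by auto
  moreover have "x \<notin> A" using assms A span_base by blast
  then have "W \<subseteq> span (B - {x})" using A B span_mono[of A "B - {x}"] by blast
  ultimately show ?thesis using \<open>x \<notin> span (B - {x})\<close> by blast
qed

lemma adj_sym: "adj X Y \<Longrightarrow> adj Y X"
  unfolding adj_def by (simp add: Int_commute)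

lemma adj_subspaces: "adj X Y \<Longrightarrow> subspace X \<and> subspace Y"
  unfolding adj_def using hyperplane_subspaces by blast

lemma adj_not_subset: "adj X Y \<Longrightarrow> \<not> X \<subseteq> Y"
  unfolding adj_def using hyperplane_psubset by blast

lemma adj_if_common_hyperplane:
  assumes "hyperplane K X" "hyperplane K Y" "X \<noteq> Y"
  shows "X \<inter> Y = K" "adj X Y"
proof -
  have "X \<inter> Y = K \<or> X \<inter> Y = X" "X \<inter> Y = K \<or> X \<inter> Y = Y"
    using assms hyperplane_psubset hyperplane_subspaces
    by (intro hyperplane_maximal[of K]; auto intro!: subspace_Int)+
  then show "X \<inter> Y = K" using assms by auto
  then show "adj X Y" using assms unfolding adj_def by simp
qed

lemma hyperplanes_not_subset:
  "hyperplane X W \<Longrightarrow> hyperplane Y W \<Longrightarrow> X \<noteq> Y \<Longrightarrow> \<not> X \<subseteq> Y"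
  using hyperplane_subset_eq by blast

lemma adj_if_hyperplanes:
  assumes "hyperplane X W" "hyperplane Y W" "X \<noteq> Y"
  shows "adj X Y" "span (X \<union> Y) = W"
proof -
  have XY: "subspace X" "subspace Y" "X \<subseteq> W" "Y \<subseteq> W" "subspace W"
    using assms hyperplane_psubset hyperplane_subspaces by blast+
  have "\<not> X \<subseteq> Y" "\<not> Y \<subseteq> X" using hyperplanes_not_subset assms by blast+
  then show "adj X Y"
    unfolding adj_def
    using hyperplane_Int[of X W Y] hyperplane_Int[of Y W X] assms XY by (simp add: Int_commute)
  have "span (X \<union> Y) = X \<or> span (X \<union> Y) = W"
    using assms XY span_superset[of "X \<union> Y"] by (intro hyperplane_maximal span_minimal) auto
  then show "span (X \<union> Y) = W" using \<open>\<not> Y \<subseteq> X\<close> span_superset[of "X \<union> Y"] by blast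
qed

lemma hyperplane_span_Un:
  assumes "adj X Y"
  shows "hyperplane X (span (X \<union> Y))"
proof -
  have "hyperplane (X \<inter> Y) Y" using assms adj_def by blast
  then obtain y where y: "y \<in> Y" "y \<notin> X" using hyperplane_psubset by blast
  then have "Y = span (insert y (X \<inter> Y))"
    using hyperplane_span_insert \<open>hyperplane (X \<inter> Y) Y\<close> by blast
  then have "Y \<subseteq> span (insert y X)" using span_mono[of "insert y (X \<inter> Y)" "insert y X"] by blast
  then have "X \<union> Y \<subseteq> span (insert y X)" using span_insert_upper by blast
  then have "span (X \<union> Y) \<subseteq> span (insert y X)" by (rule span_minimal) simp
  moreover have "span (insert y X) \<subseteq> span (X \<union> Y)" using y by (intro span_mono) auto
  ultimately have "span (X \<union> Y) = span (insert y X)" by blast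
  then show ?thesis using y assms adj_subspaces hyperplane_intro by simp
qed

text \<open>If \<open>X \<inter> Y\<close> is not contained in \<open>Z\<close>, then \<open>X \<inter> Z\<close> and \<open>Y \<inter> Z\<close> are distinct hyperplanes of
  \<open>Z\<close>, which therefore span it.\<close>

lemma adjacent_triple:
  assumes "adj X Y" "adj X Z" "adj Y Z"
  shows "X \<inter> Y \<subseteq> Z \<or> Z \<subseteq> span (X \<union> Y)"
proof (rule disjCI)
  assume not: "\<not> Z \<subseteq> span (X \<union> Y)"
  have hyps: "hyperplane (X \<inter> Z) Z" "hyperplane (Y \<inter> Z) Z" "hyperplane (X \<inter> Z) X"
    "hyperplane (X \<inter> Y) X"
    using assms unfolding adj_def by auto
  have "X \<inter> Z = Y \<inter> Z"
  proof (rule ccontr)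
    assume "X \<inter> Z \<noteq> Y \<inter> Z"
    then have "span ((X \<inter> Z) \<union> (Y \<inter> Z)) = Z" using adj_if_hyperplanes hyps by blast
    then show False using not span_mono[of "(X \<inter> Z) \<union> (Y \<inter> Z)" "X \<union> Y"] by blast
  qed
  then have "X \<inter> Z \<subseteq> X \<inter> Y" by blast
  then have "X \<inter> Z = X \<inter> Y" using hyperplane_subset_eq hyps by blast
  then show "X \<inter> Y \<subseteq> Z" by blast
qed

lemma adapted_hyperplane:
  assumes B: "independent B" and N: "hyperplane N X" "adapted B N" "adapted B X"
  shows "\<exists>b\<in>B \<inter> X. N = span (B \<inter> X - {b})"
proof -
  have NX: "N = span (B \<inter> N)" "X = span (B \<inter> X)" "subspace N"
    using N adapted_def adapted_subspace by blast+
  obtain b where b: "b \<in> B" "b \<in> X" "b \<notin> N"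
    using adapted_subset[OF N(3,2)] hyperplane_psubset[OF N(1)] by blast
  have "span (insert b (B \<inter> N)) = span (insert b (span (B \<inter> N)))" by (simp add: span_insert_span)
  then have "X = span (insert b (B \<inter> N))" using hyperplane_span_insert[OF N(1) b(2,3)] NX(1) by simp
  then have "B \<inter> X = insert b (B \<inter> N)"
    using adapted_span_Int[OF B, of "insert b (B \<inter> N)"] b(1) by auto
  then have "N = span (B \<inter> X - {b})" using b NX(1) by (simp add: insert_Diff_if)
  then show ?thesis using b by blast
qed

end

section \<open>Commensurability classes\<close>

text \<open>The properties of a connected component that the proof uses.  In a component whose
  elements have infinite dimension and codimension there is room above and below any element,
  and no element properly contains another one.\<close>

locale commensurability_class = left_vector_space scale
  for scale :: "'k::division_ring \<Rightarrow> 'v::ab_group_add \<Rightarrow> 'v"  (infixr "*s" 75) +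
  fixes C :: "'v set set"
  assumes nonempty: "C \<noteq> {}"
    and subspace: "X \<in> C \<Longrightarrow> subspace X"
    and replace: "X \<in> C \<Longrightarrow> hyperplane K X \<Longrightarrow> y \<notin> K \<Longrightarrow> span (insert y K) \<in> C"
    and antichain: "X \<in> C \<Longrightarrow> Y \<in> C \<Longrightarrow> X \<subseteq> Y \<Longrightarrow> X = Y"
    and commensurable: "X \<in> C \<Longrightarrow> Y \<in> C \<Longrightarrow> \<exists>F. finite F \<and> X \<subseteq> span (Y \<union> F)"
    and infinite_dim: "X \<in> C \<Longrightarrow> finite F \<Longrightarrow> \<not> X \<subseteq> span F"
    and infinite_codim: "X \<in> C \<Longrightarrow> finite F \<Longrightarrow> \<exists>v. v \<notin> span (X \<union> F)"
begin

definition apt :: "'v set \<Rightarrow> 'v set set" where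
  "apt B = {X \<in> C. adapted B X}"

lemma outside: "X \<in> C \<Longrightarrow> \<exists>v. v \<notin> X"
  using infinite_codim[of X "{}"] subspace by auto

text \<open>Without proper inclusions between elements, an element above \<open>K\<close> is only one dimension larger
  than \<open>K\<close>, and dually for elements below \<open>W\<close>.  So the set of elements above \<open>K\<close> and the set of
  elements below \<open>W\<close> are cliques.\<close>

lemma hyperplane_if_subset:
  assumes "X \<in> C" "hyperplane K X" "Z \<in> C" "K \<subseteq> Z"
  shows "hyperplane K Z"
proof -
  have "\<not> Z \<subseteq> K" using antichain assms hyperplane_psubset by blast
  then obtain z where z: "z \<in> Z" "z \<notin> K" by blast
  have "span (insert z K) \<subseteq> Z" using z assms subspace by (intro span_insert_least) auto
  then have "span (insert z K) = Z" using antichain replace z assms by blast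
  then show ?thesis using hyperplane_intro[of K z] z assms hyperplane_subspaces by auto
qed

text \<open>A vector \<open>t\<close> outside of \<open>X\<close> turns every hyperplane of \<open>X\<close> into an intersection of \<open>X\<close> with
  an adjacent element.\<close>

lemma hyperplane_eq_Int:
  assumes X: "X \<in> C" and K: "hyperplane K X" and t: "t \<notin> X"
  shows "span (insert t K) \<in> C" "adj X (span (insert t K))" "X \<inter> span (insert t K) = K"
proof -
  have tK: "t \<notin> K" using K t hyperplane_psubset by blast
  then show "span (insert t K) \<in> C" using replace X K by blast
  have "hyperplane K (span (insert t K))" "X \<noteq> span (insert t K)"
    using hyperplane_intro hyperplane_subspaces[OF K] tK span_insert_upper(2) t by auto
  then show "adj X (span (insert t K))" "X \<inter> span (insert t K) = K"
    using adj_if_common_hyperplane[OF K] by auto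
qed

lemma hyperplane_if_superset:
  assumes "X \<in> C" "hyperplane X W" "Z \<in> C" "Z \<subseteq> W"
  shows "hyperplane Z W"
proof (cases "Z = X")
  case False
  then have "\<not> Z \<subseteq> X" "\<not> X \<subseteq> Z" using antichain assms by blast+
  then have "hyperplane (X \<inter> Z) Z" using hyperplane_Int assms subspace by blast
  moreover obtain x where x: "x \<in> X" "x \<notin> Z" using \<open>\<not> X \<subseteq> Z\<close> by blast
  ultimately have "span (insert x (X \<inter> Z)) \<in> C" using replace assms by blast
  moreover have "span (insert x (X \<inter> Z)) \<subseteq> X"
    using x assms subspace by (intro span_insert_least) auto
  ultimately have "span (insert x (X \<inter> Z)) = X" using antichain assms by blast
  then have "hyperplane (X \<inter> Z) X"
    using hyperplane_intro[of "X \<inter> Z" x] x assms by (simp add: subspace subspace_Int)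
  then have "adj Z X" using \<open>hyperplane (X \<inter> Z) Z\<close> unfolding adj_def by (simp add: Int_commute)
  then have "hyperplane Z (span (Z \<union> X))" by (rule hyperplane_span_Un)
  moreover have "span (Z \<union> X) = W"
  proof -
    have "subspace W" "X \<subseteq> W" using assms hyperplane_subspaces hyperplane_psubset by blast+
    then have "span (Z \<union> X) = X \<or> span (Z \<union> X) = W"
      using assms span_superset[of "Z \<union> X"] by (intro hyperplane_maximal span_minimal) auto
    then show ?thesis using \<open>\<not> Z \<subseteq> X\<close> span_superset[of "Z \<union> X"] by blast
  qed
  ultimately show ?thesis by simp
qed (use assms in simp)

lemma adj_star:
  "X \<in> C \<Longrightarrow> hyperplane K X \<Longrightarrow> Y \<in> C \<Longrightarrow> Z \<in> C \<Longrightarrow> K \<subseteq> Y \<Longrightarrow> K \<subseteq> Z \<Longrightarrow> Y = Z \<or> adj Y Z"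
  using hyperplane_if_subset[of X K] adj_if_common_hyperplane(2)[of K Y Z] by blast

lemma adj_top:
  "X \<in> C \<Longrightarrow> hyperplane X W \<Longrightarrow> Y \<in> C \<Longrightarrow> Z \<in> C \<Longrightarrow> Y \<subseteq> W \<Longrightarrow> Z \<subseteq> W \<Longrightarrow> Y = Z \<or> adj Y Z"
  using hyperplane_if_superset[of X W] adj_if_hyperplanes(1)[of Y W Z] by blast

lemma adj_in_class:
  assumes "X \<in> C" "adj X Y"
  shows "Y \<in> C"
proof -
  have K: "hyperplane (X \<inter> Y) X" "hyperplane (X \<inter> Y) Y" using assms unfolding adj_def by auto
  then obtain y where y: "y \<in> Y" "y \<notin> X \<inter> Y" using hyperplane_psubset by blast
  then have "Y = span (insert y (X \<inter> Y))" using hyperplane_span_insert[OF K(2)] by blast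
  then show ?thesis using replace[OF \<open>X \<in> C\<close> K(1) y(2)] by simp
qed

text \<open>The set of all \<open>Z\<close> with \<open>X \<inter> Y \<subseteq> Z \<subseteq> X + Y\<close> is \<open>{X, Y}\<^sup>\<bottom>\<^sup>\<bottom>\<close> for the relation ``adjacent or
  equal''.\<close>

lemma line_iff:
  assumes X: "X \<in> C" and Y: "Y \<in> C" and Z: "Z \<in> C" and XY: "adj X Y"
  shows "X \<inter> Y \<subseteq> Z \<and> Z \<subseteq> span (X \<union> Y) \<longleftrightarrow>
    (\<forall>R\<in>C. (R = X \<or> adj R X) \<and> (R = Y \<or> adj R Y) \<longrightarrow> R = Z \<or> adj R Z)"
    (is "?line \<longleftrightarrow> ?perp")
proof
  let ?K = "X \<inter> Y" and ?W = "span (X \<union> Y)"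
  have K: "hyperplane ?K X" and K': "hyperplane ?K Y" and W: "hyperplane X ?W"
    using XY hyperplane_span_Un unfolding adj_def by auto
  have sub: "X \<subseteq> ?W" "Y \<subseteq> ?W" using span_superset[of "X \<union> Y"] by auto
  {
    assume line: ?line
    show ?perp
    proof (intro ballI impI)
      fix R assume R: "R \<in> C" "(R = X \<or> adj R X) \<and> (R = Y \<or> adj R Y)"
      have "?K \<subseteq> R \<or> R \<subseteq> ?W" using R adjacent_triple[OF XY, of R] sub by (auto dest: adj_sym)
      then show "R = Z \<or> adj R Z" using adj_star[OF X K R(1) Z] adj_top[OF X W R(1) Z] line by blast
    qed
  next
    assume perp: ?perp
    show ?line
    proof (cases "Z = X \<or> Z = Y")
      case False
      have "adj X Z" "adj Y Z" using perp X Y XY adj_sym[OF XY] False by auto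
      then have *: "?K \<subseteq> Z \<or> Z \<subseteq> ?W" using adjacent_triple XY by blast
      have "Z \<subseteq> ?W" if KZ: "?K \<subseteq> Z"
      proof (rule ccontr)
        assume "\<not> Z \<subseteq> ?W"
        have hKZ: "hyperplane ?K Z" using hyperplane_if_subset X K Z KZ by blast
        have "?K \<subseteq> Z \<inter> ?W" using KZ sub by blast
        then have ZW: "Z \<inter> ?W = ?K"
          using hyperplane_maximal[OF hKZ, of "Z \<inter> ?W"] Z subspace \<open>\<not> Z \<subseteq> ?W\<close>
          by (auto simp: subspace_Int)
        (* An element below W that does not contain X Int Y is adjacent to X and Y, but not to Z. *)
        obtain x where x: "x \<in> X" "x \<notin> ?K" using hyperplane_psubset[OF K] by blast
        have "span {x} \<subseteq> X" using x subspace[OF X] by (intro span_minimal) auto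
        moreover obtain v where "v \<in> X" "v \<notin> span {x}" using infinite_dim[OF X, of "{x}"] by auto
        ultimately obtain N where N: "hyperplane N X" "span {x} \<subseteq> N"
          using hyperplane_separate[OF subspace[OF X], of "span {x}" v] by auto
        obtain y where y: "y \<in> Y" "y \<notin> X" using hyperplane_psubset[OF K'] by blast
        let ?R = "span (insert y N)"
        note R = hyperplane_eq_Int[OF X N(1) y(2)]
        have RW: "?R \<subseteq> ?W"
          using psubset_imp_subset[OF hyperplane_psubset[OF N(1)]] sub y
          by (intro span_insert_least[OF subspace_span]) blast+
        have "N \<noteq> ?K" using N(2) x span_base[of x "{x}"] by blast
        then have notK: "\<not> ?K \<subseteq> ?R" using R(3) hyperplane_subset_eq[OF K N(1)] by blast
        have "?R = Z \<or> adj ?R Z"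
          using perp R(1) adj_top[OF X W R(1) X RW] adj_top[OF X W R(1) Y RW] sub by blast
        moreover have "?R \<noteq> Z" using RW \<open>\<not> Z \<subseteq> ?W\<close> by blast
        ultimately have "hyperplane (?R \<inter> Z) Z" unfolding adj_def by blast
        moreover have "?R \<inter> Z \<subseteq> ?K" using RW ZW by blast
        ultimately have "?R \<inter> Z = ?K" using hyperplane_subset_eq hKZ by blast
        then show False using notK by blast
      qed
      moreover have "?K \<subseteq> Z" if ZW: "Z \<subseteq> ?W"
      proof (rule ccontr)
        assume "\<not> ?K \<subseteq> Z"
        (* An element above X Int Y that is not below W is adjacent to X and Y, but not to Z. *)
        obtain y where "y \<in> Y" "y \<notin> X" using hyperplane_psubset[OF K'] by blast
        then have "?W = span (insert y X)" using hyperplane_span_insert[OF W] sub by blast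
        moreover obtain r where "r \<notin> span (X \<union> {y})" using infinite_codim[OF X, of "{y}"] by blast
        ultimately have r: "r \<notin> ?W" by simp
        let ?R = "span (insert r ?K)"
        have "r \<notin> ?K" using r sub by blast
        then have R: "?R \<in> C" "hyperplane ?K ?R"
          using replace[OF X K] hyperplane_intro hyperplane_subspaces[OF K] by auto
        have "?R \<noteq> Z" using r ZW span_insert_upper(2)[of r ?K] by blast
        moreover have "?R = Z \<or> adj ?R Z"
          using perp R adj_star[OF X K R(1) X] adj_star[OF X K R(1) Y] span_insert_upper(1)[of ?K r]
          by blast
        ultimately have "hyperplane (?R \<inter> Z) ?R" unfolding adj_def by blast
        moreover have "?R \<inter> ?W = ?K"
        proof -
          have "?K \<subseteq> ?R \<inter> ?W" using sub span_insert_upper(1)[of ?K r] by blast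
          then show ?thesis
            using hyperplane_maximal[OF R(2), of "?R \<inter> ?W"] r span_insert_upper(2)[of r ?K]
            by (auto simp: subspace_Int)
        qed
        then have "?R \<inter> Z \<subseteq> ?K" using ZW by blast
        ultimately have "?R \<inter> Z = ?K" using hyperplane_subset_eq R(2) by blast
        then show False using \<open>\<not> ?K \<subseteq> Z\<close> by blast
      qed
      ultimately show ?thesis using * by blast
    qed (use sub in auto)
  }
qed

end

section \<open>Apartments and inexact sets\<close>

context commensurability_class
begin

lemma apt_D: "X \<in> apt B \<Longrightarrow> X \<in> C" "X \<in> apt B \<Longrightarrow> adapted B X"
  unfolding apt_def by auto

lemma apt_swap:
  assumes B: "is_basis UNIV B" and X: "X \<in> apt B" and s: "s \<in> B \<inter> X" and t: "t \<in> B - X"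
  shows "span (insert t (B \<inter> X - {s})) \<in> apt B" (is "?Y \<in> _")
    and "B \<inter> span (insert t (B \<inter> X - {s})) = insert t (B \<inter> X - {s})"
    and "adj X (span (insert t (B \<inter> X - {s})))"
proof -
  let ?K = "span (B \<inter> X - {s})"
  have ind: "independent B" by (rule basis_independent[OF B(1)])
  have XB: "X = span (B \<inter> X)" using X apt_D adapted_def by blast
  show BY: "B \<inter> span (insert t (B \<inter> X - {s})) = insert t (B \<inter> X - {s})"
    using ind s t by (intro adapted_span_Int) auto
  have "s \<notin> ?K" using independent_span_mem[OF ind, of "B \<inter> X - {s}" s] s by auto
  moreover have "X = span (insert s ?K)" using XB s by (simp add: span_insert_span insert_absorb)
  ultimately have K: "hyperplane ?K X" unfolding hyperplane_def by auto
  have "t \<notin> ?K" using t hyperplane_psubset[OF K] by blast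
  then have "span (insert t ?K) \<in> C" and K': "hyperplane ?K (span (insert t ?K))"
    using replace[OF apt_D(1)[OF X] K] hyperplane_intro by auto
  then show "?Y \<in> apt B"
    unfolding apt_def using s t by (auto simp: span_insert_span intro!: adapted_span)
  have "?Y \<noteq> X" using t span_insert_upper(2)[of t "B \<inter> X - {s}"] by blast
  then show "adj X ?Y"
    using adj_if_common_hyperplane(2)[OF K, of ?Y] K' by (simp add: span_insert_span)
qed

lemma apt_infinite:
  assumes "is_basis UNIV B" "X \<in> apt B"
  shows "infinite (B \<inter> X)" "infinite (B - X)"
proof -
  have X: "X \<in> C" "X = span (B \<inter> X)" using apt_D[OF assms(2)] adapted_def by auto
  show "infinite (B \<inter> X)" using infinite_dim[OF X(1), of "B \<inter> X"] X(2) by blast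
  show "infinite (B - X)"
  proof
    assume "finite (B - X)"
    then obtain v where "v \<notin> span (X \<union> (B - X))" using infinite_codim X by blast
    moreover have "span B \<subseteq> span (X \<union> (B - X))" by (rule span_mono) auto
    ultimately show False using basis_span[OF assms(1)] by blast
  qed
qed

text \<open>Finitely many conditions of the form \<open>b \<in> X\<close> or \<open>b \<notin> X\<close> can be enforced by exchanging
  basis vectors one at a time, because \<open>B \<inter> X\<close> and \<open>B - X\<close> are infinite.\<close>

lemma apt_prescribed:
  assumes B: "is_basis UNIV B" "apt B \<noteq> {}"
    and F: "finite F" "F \<subseteq> B" and G: "finite G" "G \<subseteq> B" "F \<inter> G = {}"
  shows "\<exists>X\<in>apt B. F \<subseteq> X \<and> X \<inter> G = {}"
proof -
  have "\<exists>X\<in>apt B. F \<subseteq> X"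
    using F
  proof (induction F rule: finite_induct)
    case (insert b F)
    then obtain X where X: "X \<in> apt B" "F \<subseteq> X" by auto
    show ?case
    proof (cases "b \<in> X")
      case False
      have "\<not> B \<inter> X \<subseteq> F" using apt_infinite(1)[OF B(1) X(1)] insert.hyps finite_subset by blast
      then obtain s where s: "s \<in> B \<inter> X" "s \<notin> F" by blast
      let ?Y = "span (insert b (B \<inter> X - {s}))"
      have "?Y \<in> apt B" using apt_swap(1)[OF B(1) X(1) s(1), of b] False insert.prems by simp
      moreover have "insert b F \<subseteq> ?Y"
        using s X insert.prems span_superset[of "insert b (B \<inter> X - {s})"] by auto
      ultimately show ?thesis by blast
    qed (use X in auto)
  qed (use B in auto)
  then obtain X where "X \<in> apt B" "F \<subseteq> X" by blast
  from G show ?thesis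
  proof (induction G rule: finite_induct)
    case empty
    then show ?case using \<open>X \<in> apt B\<close> \<open>F \<subseteq> X\<close> by auto
  next
    case (insert g G)
    then obtain X where X: "X \<in> apt B" "F \<subseteq> X" "X \<inter> G = {}" by auto
    show ?case
    proof (cases "g \<in> X")
      case True
      have "\<not> B - X \<subseteq> G" using apt_infinite(2)[OF B(1) X(1)] insert.hyps finite_subset by blast
      then obtain t where t: "t \<in> B - X" "t \<notin> G" by blast
      let ?Y = "span (insert t (B \<inter> X - {g}))"
      have g: "g \<in> B \<inter> X" using True insert.prems by blast
      have "?Y \<in> apt B" and Y: "B \<inter> ?Y = insert t (B \<inter> X - {g})"
        using apt_swap[OF B(1) X(1) g t(1)] by auto
      moreover have "F \<subseteq> B \<inter> ?Y" unfolding Y using F X insert.prems by auto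
      moreover have "B \<inter> ?Y \<inter> insert g G = {}" unfolding Y using X t g by auto
      then have "?Y \<inter> insert g G = {}" using insert.prems by blast
      ultimately show ?thesis by blast
    qed (use X in auto)
  qed
qed

definition apts :: "'v set set set" where
  "apts = {apt B | B. is_basis UNIV B \<and> apt B \<noteq> {}}"

text \<open>Here \<open>A\<close> is an apartment and \<open>M\<close> a set of elements of \<open>A\<close>.\<close>

definition inexact :: "'v set set \<Rightarrow> 'v set set \<Rightarrow> bool" where
  "inexact A M \<longleftrightarrow> (\<exists>N\<in>apts. N \<noteq> A \<and> M \<subseteq> N)"

lemma apts_I: "is_basis UNIV B \<Longrightarrow> X \<in> apt B \<Longrightarrow> apt B \<in> apts"
  unfolding apts_def by auto

lemma apts_D: "A \<in> apts \<Longrightarrow> \<exists>B. is_basis UNIV B \<and> A = apt B"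
  unfolding apts_def by auto

lemma apts_subset: "A \<in> apts \<Longrightarrow> A \<subseteq> C"
  using apts_D apt_D(1) by auto

text \<open>Replacing the basis vector \<open>i\<close> by \<open>i + j\<close> changes the apartment but keeps all its elements
  that contain \<open>j\<close> or do not contain \<open>i\<close>.\<close>

lemma inexact_if:
  assumes B: "is_basis UNIV B" "apt B \<noteq> {}" and ij: "i \<in> B" "j \<in> B" "i \<noteq> j"
  shows "inexact (apt B) {X \<in> apt B. i \<in> X \<longrightarrow> j \<in> X}"
proof -
  have ind: "independent B" by (rule basis_independent[OF B(1)])
  let ?B = "insert (i + j) (B - {i})"
  have "i \<notin> span (B - {i})" using ind ij independent_iff by blast
  have "i + j \<notin> span (B - {i})"
  proof
    assume "i + j \<in> span (B - {i})"
    moreover have "j \<in> span (B - {i})" using ij by (intro span_base) auto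
    ultimately have "i + j - j \<in> span (B - {i})" by (rule span_diff)
    then show False using \<open>i \<notin> span (B - {i})\<close> by simp
  qed
  then have B': "is_basis UNIV ?B" using basis_exchange B ij by blast
  have sub: "X \<in> apt ?B" if X: "X \<in> apt B" "i \<in> X \<longrightarrow> j \<in> X" for X
  proof -
    have XC: "X \<in> C" "X = span (B \<inter> X)" "subspace X"
      using apt_D[OF X(1)] adapted_def subspace by auto
    have "B \<inter> X \<subseteq> span (?B \<inter> X)"
    proof
      fix b assume b: "b \<in> B \<inter> X"
      show "b \<in> span (?B \<inter> X)"
      proof (cases "b = i")
        case True
        then have "i + j \<in> ?B \<inter> X" "j \<in> ?B \<inter> X" using X b XC ij by (auto intro: subspace_add)
        then have "i + j - j \<in> span (?B \<inter> X)" by (intro span_diff span_base)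
        then show ?thesis using True by simp
      next
        case False
        then show ?thesis using b by (intro span_base) auto
      qed
    qed
    then have "X \<subseteq> span (?B \<inter> X)" using span_minimal[of "B \<inter> X" "span (?B \<inter> X)"] XC by simp
    moreover have "span (?B \<inter> X) \<subseteq> X" using XC by (intro span_minimal) auto
    ultimately have "adapted ?B X" unfolding adapted_def by blast
    then show ?thesis using XC unfolding apt_def by simp
  qed
  have ne: "apt ?B \<noteq> {}" using apt_prescribed[OF B, of "{}" "{i}"] ij sub by auto
  have "apt ?B \<noteq> apt B"
  proof -
    obtain X where X: "X \<in> apt B" "{i} \<subseteq> X" "X \<inter> {j} = {}"
      using apt_prescribed[OF B, of "{i}" "{j}"] ij by auto
    have "i + j \<notin> X"
    proof
      assume "i + j \<in> X"
      then have "i + j - i \<in> X" using X apt_D subspace by (intro subspace_diff) auto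
      then show False using X by simp
    qed
    then have "?B \<inter> X \<subseteq> B - {i}" by auto
    then have "i \<notin> span (?B \<inter> X)" using \<open>i \<notin> span (B - {i})\<close> span_mono[of "?B \<inter> X"] by blast
    then have "X \<notin> apt ?B" using X unfolding apt_def adapted_def by blast
    then show ?thesis using X by blast
  qed
  then show ?thesis unfolding inexact_def apts_def using sub B' ne by blast
qed

text \<open>If a set of apartment elements separates the basis vectors, then the line of every basis
  vector is an intersection of its elements, so every basis that this set is adapted to contains
  the same lines.\<close>

lemma inexact_only_if:
  assumes B: "is_basis UNIV B" "apt B \<noteq> {}" and M: "M \<subseteq> apt B" and inex: "inexact (apt B) M"
  shows "\<exists>i\<in>B. \<exists>j\<in>B. i \<noteq> j \<and> (\<forall>X\<in>M. i \<in> X \<longrightarrow> j \<in> X)"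
proof (rule ccontr)
  assume "\<not> ?thesis"
  then have sep: "\<exists>X\<in>M. i \<in> X \<and> j \<notin> X" if "i \<in> B" "j \<in> B" "i \<noteq> j" for i j using that by blast
  obtain B' where B': "is_basis UNIV B'" "apt B' \<noteq> apt B" "M \<subseteq> apt B'"
    using inex unfolding inexact_def apts_def by blast
  have ind: "independent B" "independent B'" using basis_independent B(1) B'(1) by auto
  have line: "\<exists>b'\<in>B'. span {b'} = span {b}" if b: "b \<in> B" for b
  proof -
    let ?P = "\<Inter>{X \<in> M. b \<in> X}"
    have "B \<noteq> {b}" using B apt_infinite(1) by (metis ex_in_conv finite.simps finite_Int)
    then obtain c where "c \<in> B" "c \<noteq> b" using b by blast
    then have ne: "{X \<in> M. b \<in> X} \<noteq> {}" using sep[of b c] b by blast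
    have "adapted B ?P" using ne M apt_D by (intro adapted_Inter ind) auto
    moreover have "B \<inter> ?P = {b}" using b sep ne by blast
    ultimately have P: "?P = span {b}" unfolding adapted_def by simp
    have "adapted B' ?P" using ne B' apt_D by (intro adapted_Inter ind) auto
    then have P': "span (B' \<inter> span {b}) = span {b}" unfolding adapted_def P by simp
    have "b \<noteq> 0" using b ind independent_nonzero by blast
    then have "span {b} \<noteq> {0}" using span_base[of b "{b}"] by auto
    then have "B' \<inter> span {b} \<noteq> {}" using P' by auto
    then obtain b' where b': "b' \<in> B'" "b' \<in> span {b}" by blast
    have "b' \<noteq> 0" using b' ind independent_nonzero by blast
    then have "b \<in> span {b'}" using exchange[of b' b "{}"] b' by simp
    then have "span {b'} = span {b}" using b' by (intro subset_antisym span_minimal) auto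
    then show ?thesis using b' by blast
  qed
  have line': "\<exists>b\<in>B. span {b'} = span {b}" if b': "b' \<in> B'" for b'
  proof (rule ccontr)
    assume no: "\<not> ?thesis"
    have "B \<subseteq> span (B' - {b'})"
    proof
      fix b assume b: "b \<in> B"
      then obtain c where c: "c \<in> B'" "span {c} = span {b}" using line by blast
      then have "c \<in> B' - {b'}" using no b by auto
      then have "span {c} \<subseteq> span (B' - {b'})" by (intro span_mono) auto
      then show "b \<in> span (B' - {b'})" using c span_base[of b "{b}"] by auto
    qed
    then have "span B \<subseteq> span (B' - {b'})" by (intro span_minimal) auto
    then have "b' \<in> span (B' - {b'})" using basis_span[OF B(1)] by blast
    then show False using ind(2) b' independent_iff by blast
  qed
  have transfer: "adapted B2 X"
    if "adapted B1 X" and lines: "\<And>b. b \<in> B1 \<Longrightarrow> \<exists>c\<in>B2. span {c} = span {b}" for B1 B2 X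
  proof -
    have X: "X = span (B1 \<inter> X)" "subspace X" using that adapted_def adapted_subspace by blast+
    have "B1 \<inter> X \<subseteq> span (B2 \<inter> X)"
    proof
      fix b assume b: "b \<in> B1 \<inter> X"
      then obtain c where c: "c \<in> B2" "span {c} = span {b}" using lines by blast
      have "c \<in> span {b}" using c span_base[of c "{c}"] by auto
      moreover have "span {b} \<subseteq> X" using b X by (intro span_minimal) auto
      ultimately have "span {c} \<subseteq> span (B2 \<inter> X)" using c by (intro span_mono) auto
      then show "b \<in> span (B2 \<inter> X)" using c span_base[of b "{b}"] by auto
    qed
    then have "X \<subseteq> span (B2 \<inter> X)" using X span_minimal[of "B1 \<inter> X" "span (B2 \<inter> X)"] by simp
    moreover have "span (B2 \<inter> X) \<subseteq> X" using X by (intro span_minimal) auto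
    ultimately show ?thesis unfolding adapted_def by blast
  qed
  have "apt B = apt B'"
    unfolding apt_def using transfer[of B _ B'] transfer[of B' _ B] line line' by metis
  then show False using B' by simp
qed

text \<open>A maximal inexact subset of an apartment is given by an ordered pair \<open>(i, j)\<close> of basis
  vectors; its complement consists of the elements that contain \<open>i\<close> and not \<open>j\<close>.  Those
  complements that contain \<open>X\<close> and \<open>Y\<close> all contain a third element \<open>R\<close> iff
  \<open>X \<inter> Y \<subseteq> R \<subseteq> X + Y\<close>; in the apartment there is such an \<open>R\<close> unless \<open>X\<close> and \<open>Y\<close> are
  adjacent.  That a complement contains \<open>X\<close> and \<open>Y\<close> but not \<open>R\<close> is expressed by an inexact set
  that contains \<open>R\<close> and becomes exact when \<open>X\<close> or \<open>Y\<close> is added.\<close>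

lemma adj_iff_inexact:
  assumes B: "is_basis UNIV B" and X: "X \<in> apt B" and Y: "Y \<in> apt B" and XY: "X \<noteq> Y"
  shows "adj X Y \<longleftrightarrow> (\<forall>R\<in>apt B - {X, Y}. \<exists>M\<subseteq>apt B. R \<in> M \<and> inexact (apt B) M \<and>
    \<not> inexact (apt B) (insert X M) \<and> \<not> inexact (apt B) (insert Y M))" (is "_ \<longleftrightarrow> ?rhs")
proof
  have ind: "independent B" by (rule basis_independent[OF B(1)])
  have ne: "apt B \<noteq> {}" using X by blast
  have XC: "X \<in> C" "Y \<in> C" "adapted B X" "adapted B Y" using X Y apt_D by auto
  {
    assume XY: "adj X Y"
    show ?rhs
    proof
      fix R assume R: "R \<in> apt B - {X, Y}"
      then have RC: "R \<in> C" "adapted B R" using apt_D by auto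
      have "\<exists>i\<in>B. \<exists>j\<in>B. i \<in> X \<inter> Y \<and> j \<notin> X \<union> Y \<and> (i \<in> R \<longrightarrow> j \<in> R)"
      proof (rule ccontr)
        assume no: "\<not> ?thesis"
        let ?K = "B \<inter> (X \<inter> Y)"
        have hyps: "hyperplane (X \<inter> Y) X" "hyperplane (X \<inter> Y) Y" using XY unfolding adj_def by auto
        note ad = adapted_Int[OF ind XC(3,4)]
        (* Otherwise B Int R lies between B Int X Int Y and the union of B Int X and B Int Y, which
           differ by two vectors s and t only; but X, Y and R are incomparable. *)
        have one: "\<exists>s. B \<inter> Z = insert s ?K" if Z: "hyperplane (X \<inter> Y) Z" "adapted B Z" for Z
        proof -
          obtain s where s: "s \<in> B \<inter> Z" "X \<inter> Y = span (B \<inter> Z - {s})"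
            using adapted_hyperplane[OF ind Z(1) ad Z(2)] by blast
          then have "?K = B \<inter> Z - {s}" using adapted_span_Int[OF ind, of "B \<inter> Z - {s}"] by auto
          then show ?thesis using s by blast
        qed
        obtain s t where st: "B \<inter> X = insert s ?K" "B \<inter> Y = insert t ?K"
          using one[OF hyps(1) XC(3)] one[OF hyps(2) XC(4)] by blast
        have "?K \<noteq> {}" using apt_infinite(1)[OF B X] st(1) by auto
        moreover have "\<not> B - X \<subseteq> {t}" using apt_infinite(2)[OF B X] finite_subset by blast
        then have "B - (X \<union> Y) \<noteq> {}" using st(2) by blast
        ultimately have KR: "?K \<subseteq> R" and "B \<inter> R \<subseteq> (B \<inter> X) \<union> (B \<inter> Y)" using no by blast+
        then have "B \<inter> R \<subseteq> insert s (insert t ?K)" unfolding st by blast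
        moreover have "insert s ?K \<subseteq> R \<or> insert t ?K \<subseteq> R \<or> s \<notin> R \<and> t \<notin> R" using KR by blast
        ultimately have "insert s ?K \<subseteq> R \<or> insert t ?K \<subseteq> R \<or> B \<inter> R \<subseteq> insert s ?K" by blast
        then have "B \<inter> X \<subseteq> R \<or> B \<inter> Y \<subseteq> R \<or> B \<inter> R \<subseteq> X"
          unfolding st(1)[symmetric] st(2)[symmetric] by blast
        then have "X \<subseteq> R \<or> Y \<subseteq> R \<or> R \<subseteq> X"
          using adapted_subset[OF XC(3) RC(2)] adapted_subset[OF XC(4) RC(2)]
            adapted_subset[OF RC(2) XC(3)] by blast
        then show False
          using antichain[OF XC(1) RC(1)] antichain[OF XC(2) RC(1)] antichain[OF RC(1) XC(1)] R
          by blast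
      qed
      then obtain i j where ij: "i \<in> B" "j \<in> B" "i \<in> X \<inter> Y" "j \<notin> X \<union> Y" "i \<in> R \<longrightarrow> j \<in> R" by blast
      then have "i \<noteq> j" by blast
      let ?M = "{X \<in> apt B. i \<in> X \<longrightarrow> j \<in> X}"
      (* The set M belonging to (i, j) is maximal: it is not contained in that of another pair. *)
      have exact: "\<not> inexact (apt B) (insert Z ?M)" if Z: "Z \<in> apt B" "i \<in> Z" "j \<notin> Z" for Z
      proof
        assume "inexact (apt B) (insert Z ?M)"
        then obtain k l where kl: "k \<in> B" "l \<in> B" "k \<noteq> l" "\<forall>X\<in>insert Z ?M. k \<in> X \<longrightarrow> l \<in> X"
          using inexact_only_if[OF B ne, of "insert Z ?M"] Z by blast
        have "k = i"
        proof (rule ccontr)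
          assume "k \<noteq> i"
          then obtain S where "S \<in> apt B" "{k} \<subseteq> S" "S \<inter> {l, i} = {}"
            using apt_prescribed[OF B ne, of "{k}" "{l, i}"] kl ij by auto
          then show False using kl by auto
        qed
        moreover have "l = j"
        proof (rule ccontr)
          assume "l \<noteq> j"
          then obtain S where "S \<in> apt B" "{k, j} \<subseteq> S" "S \<inter> {l} = {}"
            using apt_prescribed[OF B ne, of "{k, j}" "{l}"] kl ij by auto
          then show False using kl by auto
        qed
        ultimately show False using kl Z by auto
      qed
      have "inexact (apt B) ?M" using inexact_if[OF B ne] ij \<open>i \<noteq> j\<close> by blast
      moreover have "R \<in> ?M" using R ij by blast
      ultimately show "\<exists>M\<subseteq>apt B. R \<in> M \<and> inexact (apt B) M \<and>
          \<not> inexact (apt B) (insert X M) \<and> \<not> inexact (apt B) (insert Y M)"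
        using exact[OF X] exact[OF Y] ij by (intro exI[of _ ?M]) auto
    qed
  next
    assume rhs: ?rhs
    show "adj X Y"
    proof (rule ccontr)
      assume "\<not> adj X Y"
      obtain s where s: "s \<in> B" "s \<in> X" "s \<notin> Y"
        using adapted_subset[OF XC(3,4)] antichain XC XY by blast
      obtain t where t: "t \<in> B" "t \<in> Y" "t \<notin> X"
        using adapted_subset[OF XC(4,3)] antichain XC XY by blast
      (* Since X Int Y <= R <= X + Y, every complement that contains X and Y contains R. *)
      let ?R = "span (insert t (B \<inter> X - {s}))"
      have R: "?R \<in> apt B" "B \<inter> ?R = insert t (B \<inter> X - {s})" "adj X ?R"
        using apt_swap[OF B X, of s t] s t by auto
      have "?R \<noteq> X" using R adj_not_subset by blast
      moreover have "?R \<noteq> Y" using R \<open>\<not> adj X Y\<close> by blast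
      ultimately obtain M where M: "M \<subseteq> apt B" "?R \<in> M" "inexact (apt B) M"
          "\<not> inexact (apt B) (insert X M)" "\<not> inexact (apt B) (insert Y M)"
        using rhs R(1) by blast
      obtain i j where ij: "i \<in> B" "j \<in> B" "i \<noteq> j" "\<forall>X\<in>M. i \<in> X \<longrightarrow> j \<in> X"
        using inexact_only_if[OF B ne M(1,3)] by blast
      have *: "i \<in> Z \<and> j \<notin> Z" if Z: "Z \<in> apt B" "\<not> inexact (apt B) (insert Z M)" for Z
      proof (rule ccontr)
        assume "\<not> ?thesis"
        then have "insert Z M \<subseteq> {X \<in> apt B. i \<in> X \<longrightarrow> j \<in> X}" using ij M Z by blast
        then have "inexact (apt B) (insert Z M)"
          using inexact_if[OF B ne ij(1-3)] unfolding inexact_def by (meson subset_trans)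
        then show False using Z by blast
      qed
      have "i \<in> X \<inter> Y" "j \<notin> X \<union> Y" using *[OF X M(4)] *[OF Y M(5)] by auto
      then have "i \<in> B \<inter> ?R" "j \<notin> B \<inter> ?R" unfolding R(2) using ij s t by auto
      then show False using ij M(2) by blast
    qed
  }
qed

end

section \<open>Adjacency, lines and stars are preserved\<close>

text \<open>Taking the inverse map \<open>g\<close> as a second parameter makes the situation symmetric, so that
  everything proved for \<open>f\<close> is available for \<open>g\<close> under the qualifier \<open>inv\<close>.\<close>

locale apartment_isomorphism =
  left_vector_space scale +
  source: commensurability_class scale C + target: commensurability_class scale D
  for scale :: "'k::division_ring \<Rightarrow> 'v::ab_group_add \<Rightarrow> 'v"  (infixr "*s" 75)
    and C D :: "'v set set" +
  fixes f g :: "'v set \<Rightarrow> 'v set"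
  assumes f_in: "X \<in> C \<Longrightarrow> f X \<in> D" and g_in: "Y \<in> D \<Longrightarrow> g Y \<in> C"
    and g_f: "X \<in> C \<Longrightarrow> g (f X) = X" and f_g: "Y \<in> D \<Longrightarrow> f (g Y) = Y"
    and f_apts: "A \<in> source.apts \<Longrightarrow> f ` A \<in> target.apts"
    and g_apts: "A \<in> target.apts \<Longrightarrow> g ` A \<in> source.apts"
begin

lemma inverse: "apartment_isomorphism scale D C g f"
  by unfold_locales (auto simp: f_in g_in g_f f_g f_apts g_apts)

lemma f_eq_iff: "X \<in> C \<Longrightarrow> Y \<in> C \<Longrightarrow> f X = f Y \<longleftrightarrow> X = Y"
  using g_f by metis

lemma apt_image:
  assumes "is_basis UNIV B" "X \<in> source.apt B"
  obtains B' where "is_basis UNIV B'" "f ` source.apt B = target.apt B'"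
    "g ` target.apt B' = source.apt B"
proof -
  have "f ` source.apt B \<in> target.apts" by (rule f_apts[OF source.apts_I[OF assms]])
  then obtain B' where "is_basis UNIV B' \<and> f ` source.apt B = target.apt B'"
    using target.apts_D[of "f ` source.apt B"] by auto
  moreover have "g ` f ` source.apt B = source.apt B"
    using g_f source.apt_D(1) by (force simp: image_image)
  ultimately show thesis using that[of B'] by simp
qed

lemma inexact_image:
  assumes A: "A \<in> source.apts" and M: "M \<subseteq> A"
  shows "target.inexact (f ` A) (f ` M) \<longleftrightarrow> source.inexact A M"
proof
  note sub = source.apts_subset and sub' = target.apts_subset
  have gf: "g ` f ` N = N" if "N \<subseteq> C" for N using that g_f by (force simp: image_image)
  have fg: "f ` g ` N = N" if "N \<subseteq> D" for N using that f_g by (force simp: image_image)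
  {
    assume "source.inexact A M"
    then obtain N where N: "N \<in> source.apts" "N \<noteq> A" "M \<subseteq> N" unfolding source.inexact_def by auto
    then have "f ` N \<noteq> f ` A" using gf sub A by metis
    then show "target.inexact (f ` A) (f ` M)"
      unfolding target.inexact_def using N(3) by (intro bexI[OF _ f_apts[OF N(1)]]) auto
  next
    assume "target.inexact (f ` A) (f ` M)"
    then obtain N where N: "N \<in> target.apts" "N \<noteq> f ` A" "f ` M \<subseteq> N"
      unfolding target.inexact_def by auto
    then have "g ` N \<noteq> A" using fg sub' by metis
    moreover have "M \<subseteq> g ` N" using image_mono[OF N(3), of g] gf[of M] M sub[OF A] by auto
    ultimately show "source.inexact A M"
      unfolding source.inexact_def by (intro bexI[OF _ g_apts[OF N(1)]]) auto
  }
qed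

lemma adj_image:
  assumes X: "X \<in> C" and Y: "Y \<in> C" and XY: "adj X Y"
  shows "adj (f X) (f Y)"
proof -
  obtain B where B: "is_basis UNIV B" "adapted B X" "adapted B Y"
    using common_adapted_basis[OF source.subspace[OF X] source.subspace[OF Y] independent_empty]
    by auto
  have XB: "X \<in> source.apt B" and YB: "Y \<in> source.apt B" using X Y B source.apt_def by auto
  obtain B' where B': "is_basis UNIV B'" "f ` source.apt B = target.apt B'"
    "g ` target.apt B' = source.apt B"
    using apt_image[OF B(1) XB] .
  have A: "source.apt B \<in> source.apts" using source.apts_I B(1) XB .
  have ne: "X \<noteq> Y" using XY adj_not_subset by blast
  have "\<exists>M\<subseteq>target.apt B'. R \<in> M \<and> target.inexact (target.apt B') M \<and>
      \<not> target.inexact (target.apt B') (insert (f X) M) \<and>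
      \<not> target.inexact (target.apt B') (insert (f Y) M)"
    if R: "R \<in> target.apt B' - {f X, f Y}" for R
  proof -
    obtain S where S: "S \<in> source.apt B" "R = f S" using R B'(2) by blast
    then have "S \<in> source.apt B - {X, Y}" using R by blast
    then obtain M where M: "M \<subseteq> source.apt B" "S \<in> M" "source.inexact (source.apt B) M"
      "\<not> source.inexact (source.apt B) (insert X M)" "\<not> source.inexact (source.apt B) (insert Y M)"
      using source.adj_iff_inexact[OF B(1) XB YB ne] XY by meson
    have "target.inexact (target.apt B') (f ` M)" using inexact_image[OF A M(1)] M(3) B'(2) by simp
    moreover have "\<not> target.inexact (target.apt B') (insert (f X) (f ` M))"
      using inexact_image[OF A, of "insert X M"] M(1,4) XB B'(2) by simp
    moreover have "\<not> target.inexact (target.apt B') (insert (f Y) (f ` M))"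
      using inexact_image[OF A, of "insert Y M"] M(1,5) YB B'(2) by simp
    moreover have "f ` M \<subseteq> target.apt B'" "R \<in> f ` M" using M B' S by auto
    ultimately show ?thesis by blast
  qed
  moreover have "f X \<in> target.apt B'" "f Y \<in> target.apt B'" "f X \<noteq> f Y"
    using XB YB B'(2) ne f_eq_iff X Y by auto
  ultimately show ?thesis using target.adj_iff_inexact[OF B'(1)] by auto
qed

end

context apartment_isomorphism
begin

(* Each later reopening of the context makes the preceding lemmas available for the inverse. *)
sublocale inv: apartment_isomorphism scale D C g f
  by (rule inverse)

lemma adj_iff: "X \<in> C \<Longrightarrow> Y \<in> C \<Longrightarrow> adj (f X) (f Y) \<longleftrightarrow> adj X Y"
  using adj_image inv.adj_image[of "f X" "f Y"] f_in g_f by metis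

lemma line_image:
  assumes "X \<in> C" "Y \<in> C" "Z \<in> C" "adj X Y"
  shows "f X \<inter> f Y \<subseteq> f Z \<and> f Z \<subseteq> span (f X \<union> f Y) \<longleftrightarrow> X \<inter> Y \<subseteq> Z \<and> Z \<subseteq> span (X \<union> Y)"
proof -
  have eq: "f R = f S \<or> adj (f R) (f S) \<longleftrightarrow> R = S \<or> adj R S" if "R \<in> C" "S \<in> C" for R S
    using adj_iff f_eq_iff that by simp
  have "f X \<inter> f Y \<subseteq> f Z \<and> f Z \<subseteq> span (f X \<union> f Y) \<longleftrightarrow>
      (\<forall>R\<in>D. (R = f X \<or> adj R (f X)) \<and> (R = f Y \<or> adj R (f Y)) \<longrightarrow> R = f Z \<or> adj R (f Z))"
    by (rule target.line_iff[OF f_in f_in f_in adj_image]) (use assms in auto)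
  also have "\<dots> \<longleftrightarrow> (\<forall>R\<in>C. (f R = f X \<or> adj (f R) (f X)) \<and> (f R = f Y \<or> adj (f R) (f Y)) \<longrightarrow>
      f R = f Z \<or> adj (f R) (f Z))"
  proof -
    have "D = f ` C" using f_in f_g g_in by force
    then show ?thesis by simp
  qed
  also have "\<dots> \<longleftrightarrow> (\<forall>R\<in>C. (R = X \<or> adj R X) \<and> (R = Y \<or> adj R Y) \<longrightarrow> R = Z \<or> adj R Z)"
    using eq assms by auto
  also have "\<dots> \<longleftrightarrow> X \<inter> Y \<subseteq> Z \<and> Z \<subseteq> span (X \<union> Y)" using source.line_iff[OF assms] by simp
  finally show ?thesis .
qed

end

context left_vector_space
begin

text \<open>The space spanned by all differences \<open>t - t\<^sub>0\<close> is the hyperplane on which the sum of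
  the coordinates vanishes.  It avoids all basis vectors.\<close>

lemma hyperplane_avoiding_basis:
  assumes T: "independent T" "t\<^sub>0 \<in> T"
  shows "\<exists>H. hyperplane H (span T) \<and> H \<inter> T = {}"
proof -
  let ?E = "\<lambda>G. (\<lambda>t. t - t\<^sub>0) ` G"
  have fin: "t\<^sub>0 \<notin> span (?E G)" if "finite G" "G \<subseteq> T - {t\<^sub>0}" for G
    using that
  proof (induction G rule: finite_induct)
    case empty
    then show ?case using T independent_nonzero by auto
  next
    case (insert u G)
    show ?case
    proof
      assume "t\<^sub>0 \<in> span (?E (insert u G))"
      then obtain a where a: "t\<^sub>0 - a *s (u - t\<^sub>0) \<in> span (?E G)" using span_insert by auto
      have "?E G \<subseteq> span (T - {u})"
      proof
        fix e assume "e \<in> ?E G"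
        then obtain t where "t \<in> G" "e = t - t\<^sub>0" by blast
        then show "e \<in> span (T - {u})" using insert T by (auto intro!: span_diff intro: span_base)
      qed
      then have "span (?E G) \<subseteq> span (T - {u})" by (intro span_minimal) auto
      then have "t\<^sub>0 - a *s (u - t\<^sub>0) \<in> span (T - {u})" using a by blast
      moreover have t0: "t\<^sub>0 \<in> span (T - {u})" using insert T by (intro span_base) auto
      ultimately have "t\<^sub>0 - (t\<^sub>0 - a *s (u - t\<^sub>0)) + a *s t\<^sub>0 \<in> span (T - {u})"
        using span_add[OF span_diff[OF t0] span_scale[OF t0]] by blast
      then have "a *s u \<in> span (T - {u})" by (simp add: scale_diff_right)
      moreover have "u \<notin> span (T - {u})" using T insert.prems independent_iff by blast
      ultimately have "a = 0"
        using span_scale[of "a *s u" "T - {u}" "inverse a"] scale_inverse[of a u] by metis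
      then show False using a insert by simp
    qed
  qed
  let ?H = "span (?E (T - {t\<^sub>0}))"
  have t0: "t\<^sub>0 \<notin> ?H"
  proof
    assume "t\<^sub>0 \<in> ?H"
    then obtain F where F: "finite F" "F \<subseteq> ?E (T - {t\<^sub>0})" "t\<^sub>0 \<in> span F"
      using span_finitary[of "t\<^sub>0"] by auto
    then obtain G where "G \<subseteq> T - {t\<^sub>0}" "finite G" "F = ?E G"
      using finite_subset_image[OF F(1,2)] by auto
    then show False using fin F by blast
  qed
  have "span (insert t\<^sub>0 ?H) = span T"
  proof
    have "?E (T - {t\<^sub>0}) \<subseteq> span T" using T by (auto intro!: span_diff intro: span_base)
    then show "span (insert t\<^sub>0 ?H) \<subseteq> span T"
      using T by (intro span_insert_least span_minimal) (auto intro: span_base)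
    have "t \<in> span (insert t\<^sub>0 ?H)" if "t \<in> T" for t
    proof (cases "t = t\<^sub>0")
      case False
      then have "t - t\<^sub>0 \<in> ?H" using that by (intro span_base) auto
      then have "(t - t\<^sub>0) + t\<^sub>0 \<in> span (insert t\<^sub>0 ?H)" by (intro span_add) (auto intro: span_base)
      then show ?thesis by simp
    qed (auto intro: span_base)
    then show "span T \<subseteq> span (insert t\<^sub>0 ?H)" by (intro span_minimal) auto
  qed
  then have "hyperplane ?H (span T)" using hyperplane_intro[of ?H "t\<^sub>0"] t0 by simp
  moreover have "t \<notin> ?H" if "t \<in> T" for t
  proof
    assume t: "t \<in> ?H"
    have "t - t\<^sub>0 \<in> ?H" using that t t0 by (intro span_base) auto
    then have "t - (t - t\<^sub>0) \<in> ?H" by (rule span_diff[OF t])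
    then show False using t0 by simp
  qed
  ultimately show ?thesis by blast
qed

end

context apartment_isomorphism
begin

text \<open>Suppose that a triangle with common hyperplane \<open>U = X \<inter> Y\<close> is mapped to a triangle in
  \<open>W = f X + f Y\<close>.  Then \<open>f\<close> maps the star of \<open>U\<close> onto the set of elements below \<open>W\<close>.  For a
  basis \<open>B\<close> adapted to \<open>X\<close> and \<open>Y\<close>, the points \<open>U + \<langle>c\<rangle>\<close>, \<open>c \<in> B\<close>, span the projective space
  \<open>V/U\<close>, while their images are hyperplanes of \<open>W\<close>, each of which omits one vector of the new
  basis.  Hence every hyperplane of \<open>W\<close> contains the intersection of finitely many of them, and
  thus a vector of the new basis, which is absurd.\<close>

lemma star_image:
  assumes X: "X \<in> C" and Y: "Y \<in> C" and Z: "Z \<in> C" and XY: "adj X Y" and XYZ: "X \<inter> Y \<subseteq> Z"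
  shows "f X \<inter> f Y \<subseteq> f Z"
proof (cases "Z = X \<or> Z = Y")
  case False
  let ?U = "X \<inter> Y" and ?W = "span (f X \<union> f Y)"
  have U: "hyperplane ?U X" "hyperplane ?U Y" using XY unfolding adj_def by auto
  have XZ: "adj X Z" "adj Y Z"
    using source.adj_star[OF X U(1) X Z] source.adj_star[OF X U(1) Y Z] XYZ False by auto
  have fXY: "adj (f X) (f Y)" "adj (f X) (f Z)" "adj (f Y) (f Z)"
    using adj_image X Y Z XY XZ by auto
  have W: "hyperplane (f X) ?W" using fXY hyperplane_span_Un by blast
  have subW: "f X \<subseteq> ?W" "f Y \<subseteq> ?W" using span_superset[of "f X \<union> f Y"] by auto
  show ?thesis
  proof (rule ccontr)
    assume not: "\<not> f X \<inter> f Y \<subseteq> f Z"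
    then have ZW: "f Z \<subseteq> ?W" using adjacent_triple fXY by blast
    (* Otherwise f R contains the hyperplanes f X Int f Y and f X Int f Z of f X, and hence f X. *)
    have into: "f R \<subseteq> ?W" if R: "R \<in> C" "?U \<subseteq> R" for R
    proof (cases "R = X \<or> R = Y \<or> R = Z")
      case False
      have "adj X R" "adj Y R" "adj Z R"
        using source.adj_star[OF X U(1) _ R(1)] X Y Z XYZ R False by auto
      then have adjs: "adj (f X) (f R)" "adj (f Y) (f R)" "adj (f Z) (f R)"
        using adj_image X Y Z R by auto
      show ?thesis
      proof (rule ccontr)
        assume RW: "\<not> f R \<subseteq> ?W"
        have "span (f X \<union> f Z) \<subseteq> ?W" using subW ZW by (intro span_minimal) auto
        then have "f X \<inter> f Y \<subseteq> f R" "f X \<inter> f Z \<subseteq> f R"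
          using adjacent_triple[OF fXY(1) adjs(1,2)] adjacent_triple[OF fXY(2) adjs(1,3)] RW by auto
        moreover have hyps: "hyperplane (f X \<inter> f Y) (f X)" "hyperplane (f X \<inter> f Z) (f X)"
          using fXY unfolding adj_def by auto
        moreover have "f X \<inter> f Y \<noteq> f X \<inter> f Z" using not by blast
        moreover have "span ((f X \<inter> f Y) \<union> (f X \<inter> f Z)) \<subseteq> f R"
          using calculation(1,2) target.subspace[OF f_in[OF R(1)]] by (intro span_minimal Un_least)
        ultimately have "f X \<subseteq> f R" using adj_if_hyperplanes(2)[OF hyps] by simp
        then show False using adjs(1) adj_not_subset by simp
      qed
    qed (use ZW subW in auto)
    (* Dually: since Z is not below X + Y, an element adjacent to X, Y and Z must be above U. *)
    have onto: "?U \<subseteq> g R" if R: "R \<in> D" "R \<subseteq> ?W" for R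
    proof (cases "R = f X \<or> R = f Y \<or> R = f Z")
      case True
      then show ?thesis using g_f X Y Z XYZ by auto
    next
      case False
      have "adj (f X) R" "adj (f Y) R" "adj (f Z) R"
        using target.adj_top[OF f_in[OF X] W _ R(1)] f_in X Y Z ZW subW R False by auto
      then have "adj (g (f X)) (g R)" "adj (g (f Y)) (g R)" "adj (g (f Z)) (g R)"
        using inv.adj_image f_in X Y Z R by blast+
      then have adjs: "adj X (g R)" "adj Y (g R)" "adj Z (g R)" using g_f X Y Z by auto
      have noline: "\<not> Z \<subseteq> span (X \<union> Y)" using line_image[OF X Y Z XY] not XYZ by blast
      have XZU: "X \<inter> Z = ?U"
        using hyperplane_subset_eq[of ?U X "X \<inter> Z"] U XZ XYZ unfolding adj_def by auto
      show ?thesis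
      proof (rule ccontr)
        assume "\<not> ?U \<subseteq> g R"
        then have gR: "g R \<subseteq> span (X \<union> Y)" "g R \<subseteq> span (X \<union> Z)"
          using adjacent_triple[OF XY adjs(1,2)] adjacent_triple[OF XZ(1) adjs(1,3)] XZU by auto
        have h: "hyperplane X (span (X \<union> Z))" using hyperplane_span_Un XZ by blast
        let ?I = "span (X \<union> Y) \<inter> span (X \<union> Z)"
        have "X \<subseteq> ?I" using span_superset[of "X \<union> Y"] span_superset[of "X \<union> Z"] by auto
        then have "?I = X \<or> ?I = span (X \<union> Z)" by (intro hyperplane_maximal[OF h] subspace_Int) auto
        then have "?I = X" using noline span_superset[of "X \<union> Z"] by blast
        then have "g R \<subseteq> X" using gR by blast
        then show False using adjs(1) adj_not_subset adj_sym by blast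
      qed
    qed
    obtain B where B: "is_basis UNIV B" "adapted B X" "adapted B Y"
      using common_adapted_basis[OF source.subspace[OF X] source.subspace[OF Y] independent_empty]
      by auto
    have ind: "independent B" by (rule basis_independent[OF B(1)])
    have XB: "X \<in> source.apt B" and YB: "Y \<in> source.apt B" using X Y B source.apt_def by auto
    obtain B' where B': "is_basis UNIV B'" "f ` source.apt B = target.apt B'"
      "g ` target.apt B' = source.apt B"
      using apt_image[OF B(1) XB] .
    have ind': "independent B'" by (rule basis_independent[OF B'(1)])
    have fX': "f X \<in> target.apt B'" "f Y \<in> target.apt B'" using XB YB B' by auto
    then have adW: "adapted B' ?W" using adapted_sum target.apt_D by blast
    let ?T = "B' \<inter> ?W"
    have "B' \<inter> f X \<subseteq> ?T" using subW by blast
    then have infT: "infinite ?T"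
      using target.apt_infinite(1)[OF B'(1) fX'(1)] finite_subset by blast
    then obtain t\<^sub>0 where "t\<^sub>0 \<in> ?T" by (metis ex_in_conv finite.emptyI)
    moreover have "span ?T = ?W" using adW unfolding adapted_def by simp
    ultimately obtain H where H: "hyperplane H ?W" "H \<inter> ?T = {}"
      using hyperplane_avoiding_basis[of ?T "t\<^sub>0"] independent_mono[OF ind'] by auto
    obtain k where k: "?W = span (insert k H)" "k \<notin> H" using H unfolding hyperplane_def by blast
    have HD: "H \<in> D"
    proof -
      have fXH: "H \<noteq> f X"
        using H target.apt_infinite(1)[OF B'(1) fX'(1)] \<open>B' \<inter> f X \<subseteq> ?T\<close>
        by (metis Int_absorb1 Int_commute finite.emptyI inf_assoc inf_le2)
      then have "adj (f X) H" using adj_if_hyperplanes W H by metis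
      then show ?thesis using target.adj_in_class f_in X by blast
    qed
    have gH: "g H \<in> C" "?U \<subseteq> g H" using g_in HD onto H hyperplane_psubset by blast+
    then have hU: "hyperplane ?U (g H)" using source.hyperplane_if_subset X U by blast
    then obtain x where x: "x \<notin> ?U" "g H = span (insert x ?U)" unfolding hyperplane_def by blast
    have subU: "subspace ?U" using U hyperplane_subspaces by blast
    let ?P = "\<lambda>x. span (insert x ?U)"
    have PC: "?P y \<in> C" if "y \<notin> ?U" for y using source.replace[OF X U(1) that] .
    (* If y is a combination of c and a vector y0 from the span of F, then the points of y, c and y0
       in the projective space V/U are collinear, and lines are preserved. *)
    have inter: "t \<in> f (?P y)"
      if "finite F" "F \<inter> ?U = {}" "y \<in> span (?U \<union> F)" "y \<notin> ?U" "\<forall>c\<in>F. t \<in> f (?P c)" for F y t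
      using that
    proof (induction F arbitrary: y rule: finite_induct)
      case empty
      then show ?case using subU by simp
    next
      case (insert c F)
      then have c: "c \<notin> ?U" by blast
      obtain a where a: "y - a *s c \<in> span (?U \<union> F)"
        using insert.prems(2) span_insert[of y c "?U \<union> F"] by auto
      let ?y = "y - a *s c"
      have yP: "y \<in> span (insert c (insert z ?U))" if "?y \<in> span (insert z ?U)" for z
        using that span_insert[of y c "insert z ?U"] by blast
      show ?case
      proof (cases "?y \<in> ?U")
        case True
        then have "y \<in> ?P c" using span_insert[of y c ?U] subU by auto
        then have "?P y = ?P c"
          using hyperplane_span_insert[OF hyperplane_intro[OF subU c]] insert.prems(3) by simp
        then show ?thesis using insert.prems(4) by simp
      next
        case y': False
        have t: "t \<in> f (?P ?y)" "t \<in> f (?P c)" using insert.IH[of ?y] insert.prems a y' by auto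
        have cU: "hyperplane ?U (?P c)" "hyperplane ?U (?P ?y)"
          using hyperplane_intro subU c y' by auto
        have U': "?U \<subseteq> ?P y" by (rule span_insert_upper)
        have "f (?P c) \<inter> f (?P ?y) \<subseteq> f (?P y)"
        proof (cases "?P c = ?P ?y")
          case True
          then have "?P ?y \<subseteq> ?P c" by simp
          then have "?y \<in> ?P c" using span_insert_upper(2) by blast
          then have "?y + a *s c \<in> ?P c" by (intro span_add span_scale span_insert_upper(2))
          then have "?P y = ?P c" using hyperplane_span_insert[OF cU(1)] insert.prems(3) by simp
          then show ?thesis by simp
        next
          case False
          have PP: "adj (?P c) (?P ?y)" "?P c \<inter> ?P ?y = ?U"
            using adj_if_common_hyperplane[OF cU False] by auto
          have "?y + a *s c \<in> span (?P c \<union> ?P ?y)"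
            by (intro span_add span_scale span_base UnI1 UnI2) (simp_all add: span_insert_upper(2))
          moreover have "?U \<subseteq> span (?P c \<union> ?P ?y)"
            using PP(2) span_superset[of "?P c \<union> ?P ?y"] by blast
          ultimately have "?P y \<subseteq> span (?P c \<union> ?P ?y)" by (intro span_insert_least) auto
          then show ?thesis
            using line_image[OF PC[OF c] PC[OF y'] PC[OF insert.prems(3)] PP(1)] PP(2) U' by blast
        qed
        then show ?thesis using t by blast
      qed
    qed
    obtain F0 where F0: "finite F0" "F0 \<subseteq> B" "x \<in> span F0"
      using span_finitary[OF basis_span[OF B(1), of x]] by auto
    let ?F = "F0 - ?U"
    have "F0 \<subseteq> ?U \<union> ?F" by blast
    then have xF: "x \<in> span (?U \<union> ?F)" using F0 span_mono by blast
    (* The image of the point of a basis vector is a hyperplane of W adapted to the new basis. *)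
    have omit: "finite (?T - f (?P c))" if c: "c \<in> ?F" for c
    proof -
      have "adapted B ?U" using adapted_Int ind B by blast
      then have "span (insert c (B \<inter> ?U)) = ?P c" unfolding adapted_def by (metis span_insert_span)
      moreover have "insert c (B \<inter> ?U) \<subseteq> B" using c F0 by blast
      ultimately have "adapted B (?P c)" using adapted_span[of "insert c (B \<inter> ?U)" B] by simp
      then have Pc: "?P c \<in> source.apt B" using PC c unfolding source.apt_def by auto
      then have fPc: "f (?P c) \<in> target.apt B'" using B' by blast
      have "f (?P c) \<subseteq> ?W"
        using into[of "?P c"] Pc source.apt_D span_insert_upper(1)[of ?U c] by blast
      then have "hyperplane (f (?P c)) ?W"
        using target.hyperplane_if_superset f_in X W fPc target.apt_D by blast
      then obtain b where "f (?P c) = span (?T - {b})"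
        using adapted_hyperplane[OF ind' _ _ adW] target.apt_D[OF fPc] by blast
      then have "?T - f (?P c) \<subseteq> {b}" using span_base[of _ "?T - {b}"] by blast
      then show ?thesis by (rule finite_subset) simp
    qed
    have "finite (\<Union>c\<in>?F. ?T - f (?P c))" using omit F0 by (intro finite_UN_I) auto
    then have "\<not> ?T \<subseteq> (\<Union>c\<in>?F. ?T - f (?P c))" using infT finite_subset by blast
    then obtain t where t: "t \<in> ?T" "\<forall>c\<in>?F. t \<in> f (?P c)" by blast
    have "t \<in> f (?P x)" using inter[of ?F x t] F0 xF x t by auto
    then have "t \<in> H" using f_g[OF HD] unfolding x(2) by simp
    then show False using H t by blast
  qed
qed auto

end

section \<open>The induced map between points\<close>

context apartment_isomorphism
begin

text \<open>For a hyperplane \<open>K\<close> of an element of \<open>C\<close> two elements above \<open>K\<close> suffice in this intersection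
  (\<open>hyper_map_Int\<close>), since stars are preserved.\<close>

definition hyper_map :: "'v set \<Rightarrow> 'v set" where
  "hyper_map K = \<Inter>{f R | R. R \<in> C \<and> K \<subseteq> R}"

definition point_pair :: "'v set \<Rightarrow> 'v \<Rightarrow> 'v \<Rightarrow> bool" where
  "point_pair X b b' \<longleftrightarrow>
    b' \<in> f X \<and> b' \<noteq> 0 \<and> (\<forall>K. hyperplane K X \<longrightarrow> (b \<in> K \<longleftrightarrow> b' \<in> hyper_map K))"

lemma hyper_map_Int:
  assumes X: "X \<in> C" and Y: "Y \<in> C" and XY: "adj X Y"
  shows "hyper_map (X \<inter> Y) = f X \<inter> f Y"
proof
  show "hyper_map (X \<inter> Y) \<subseteq> f X \<inter> f Y" unfolding hyper_map_def using X Y by auto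
  show "f X \<inter> f Y \<subseteq> hyper_map (X \<inter> Y)" unfolding hyper_map_def using star_image[OF X Y _ XY] by auto
qed

end

context apartment_isomorphism
begin

lemma hyperplane_hyper_map:
  assumes X: "X \<in> C" and K: "hyperplane K X"
  shows "hyperplane (hyper_map K) (f X)"
proof -
  obtain t where "t \<notin> X" using source.outside X by blast
  then have Y: "span (insert t K) \<in> C" "adj X (span (insert t K))" "X \<inter> span (insert t K) = K"
    using source.hyperplane_eq_Int X K by auto
  then show ?thesis using hyper_map_Int[OF X Y(1,2)] adj_image[OF X Y(1,2)] adj_def by simp
qed

lemma inv_hyper_map:
  assumes X: "X \<in> C" and K: "hyperplane K X"
  shows "inv.hyper_map (hyper_map K) = K"
proof -
  obtain t where "t \<notin> X" using source.outside X by blast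
  then have Y: "span (insert t K) \<in> C" "adj X (span (insert t K))" "X \<inter> span (insert t K) = K"
    using source.hyperplane_eq_Int X K by auto
  then have "inv.hyper_map (hyper_map K) = g (f X) \<inter> g (f (span (insert t K)))"
    using hyper_map_Int[OF X Y(1,2)] inv.hyper_map_Int f_in adj_image X by simp
  then show ?thesis using g_f X Y by simp
qed

lemma hyper_map_eq_iff:
  "X \<in> C \<Longrightarrow> hyperplane K X \<Longrightarrow> hyperplane L X \<Longrightarrow> hyper_map K = hyper_map L \<longleftrightarrow> K = L"
  using inv_hyper_map by metis

text \<open>For \<open>t\<close> outside of \<open>X\<close> the hyperplanes of \<open>X\<close> are the intersections of \<open>X\<close> with the
  elements \<open>K + \<langle>t\<rangle>\<close>, and \<open>H \<inter> K\<close> is contained in \<open>L\<close> iff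
  \<open>(H + \<langle>t\<rangle>) \<inter> (K + \<langle>t\<rangle>)\<close> is contained in \<open>L + \<langle>t\<rangle>\<close>.\<close>

lemma hyper_map_pencil:
  assumes X: "X \<in> C" and H: "hyperplane H X" and K: "hyperplane K X" and L: "hyperplane L X"
    and HKL: "H \<inter> K \<subseteq> L"
  shows "hyper_map H \<inter> hyper_map K \<subseteq> hyper_map L"
proof (cases "H = K")
  case True
  then have "H = L" using HKL hyperplane_subset_eq[OF H L] by simp
  then show ?thesis by blast
next
  case False
  obtain t where t: "t \<notin> X" using source.outside X by blast
  let ?e = "\<lambda>K. span (insert t K)"
  note eH = source.hyperplane_eq_Int[OF X H t] and eK = source.hyperplane_eq_Int[OF X K t]
    and eL = source.hyperplane_eq_Int[OF X L t]
  have sub: "subspace H" "subspace K" "subspace L" "subspace X"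
    using H K L hyperplane_subspaces by blast+
  have HX: "H \<subseteq> X" "K \<subseteq> X" "L \<subseteq> X" using H K L hyperplane_psubset by blast+
  have "hyperplane X (?e X)" using hyperplane_intro sub t by blast
  moreover have "?e H \<subseteq> ?e X" "?e K \<subseteq> ?e X" using HX by (auto intro!: span_mono)
  moreover have "?e H \<noteq> ?e K" using eH(3) eK(3) False by metis
  ultimately have adjHK: "adj (?e H) (?e K)" using source.adj_top[OF X] eH eK by blast
  have "?e H \<inter> ?e K \<subseteq> ?e L"
  proof
    fix v assume "v \<in> ?e H \<inter> ?e K"
    then obtain a a' where a: "v - a *s t \<in> H" "v - a' *s t \<in> K"
      using span_insert_subspace sub by blast
    then have "(v - a' *s t) - (v - a *s t) \<in> X"
      using HX sub(4) subspace_diff[of X "v - a' *s t" "v - a *s t"] by blast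
    then have "(a - a') *s t \<in> X" by (simp add: scale_diff_left)
    then have "inverse (a - a') *s (a - a') *s t \<in> X" using sub subspace_scale by blast
    then have "a = a'" using t scale_inverse[of "a - a'" t] by (metis right_minus_eq)
    then have "v - a *s t \<in> L" using a HKL by blast
    then show "v \<in> ?e L" using span_insert_subspace sub by blast
  qed
  then have "f (?e H) \<inter> f (?e K) \<subseteq> f (?e L)" using star_image[OF eH(1) eK(1) eL(1) adjHK] by blast
  then show ?thesis
    using hyper_map_Int[OF X eH(1,2)] hyper_map_Int[OF X eK(1,2)] hyper_map_Int[OF X eL(1,2)]
      eH eK eL by auto
qed

end

context left_vector_space
begin

abbreviation face :: "'v set \<Rightarrow> 'v set \<Rightarrow> 'v \<Rightarrow> 'v set" where
  "face B X b \<equiv> span (B \<inter> X - {b})"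

lemma hyperplane_face:
  assumes "independent B" "adapted B X" "b \<in> B \<inter> X"
  shows "hyperplane (face B X b) X" "b \<notin> face B X b"
proof -
  show "b \<notin> face B X b" using independent_span_mem[OF assms(1), of "B \<inter> X - {b}" b] assms by auto
  moreover have "X = span (insert b (face B X b))"
    using assms unfolding adapted_def by (simp add: span_insert_span insert_absorb)
  ultimately show "hyperplane (face B X b) X" using hyperplane_intro[of "face B X b" b] by simp
qed

lemma face_inj:
  assumes "independent B" "adapted B X" "b \<in> B \<inter> X" "c \<in> B \<inter> X" "face B X b = face B X c"
  shows "b = c"
proof (rule ccontr)
  assume "b \<noteq> c"
  then have "c \<in> face B X b" using assms by (intro span_base) auto
  then show False using hyperplane_face(2)[OF assms(1,2,4)] assms(5) by blast
qed

lemma Inter_faces: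
  assumes "independent B" "adapted B X" "v \<in> X" "\<And>b. b \<in> B \<inter> X \<Longrightarrow> v \<in> face B X b"
  shows "v = 0"
proof -
  have "v \<in> span (B \<inter> X)" using assms adapted_def by blast
  then obtain F where F: "F \<subseteq> B \<inter> X" "v \<in> span F" "\<forall>S\<subseteq>B \<inter> X. v \<in> span S \<longrightarrow> F \<subseteq> S"
    using support_exists[OF independent_mono[OF assms(1), of "B \<inter> X"], of v] by auto
  have "b \<notin> F" if "b \<in> B \<inter> X" for b using F(3)[rule_format, OF _ assms(4)[OF that]] by blast
  then have "F = {}" using F by blast
  then show ?thesis using F by simp
qed

text \<open>If the hyperplane \<open>L\<close> of \<open>X\<close> does not contain the basis vector \<open>b\<close>, then the other basis
  vectors can be moved into \<open>L\<close> along \<open>b\<close>; the hyperplanes opposite to them do not change.\<close>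

lemma shear_basis:
  assumes B: "independent B" and X: "adapted B X" and b: "b \<in> B \<inter> X"
    and L: "hyperplane L X" "b \<notin> L"
  shows "\<exists>B2. is_basis UNIV B2 \<and> adapted B2 X \<and>
    (\<forall>v\<in>B2 \<inter> X. face B2 X v = L \<or> (\<exists>e\<in>B \<inter> X - {b}. face B2 X v = face B X e))"
proof -
  have sub: "subspace L" "subspace X" "L \<subseteq> X"
    using L hyperplane_subspaces hyperplane_psubset by blast+
  have XB: "X = span (B \<inter> X)" using X adapted_def by blast
  have "\<exists>a. e - a *s b \<in> L" if "e \<in> X" for e
    using hyperplane_span_insert[OF L(1), of b] L b that span_insert_subspace sub by auto
  then obtain c where c: "\<And>e. e \<in> X \<Longrightarrow> e - c e *s b \<in> L" by metis
  let ?h = "\<lambda>e. e - c e *s b"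
  let ?E = "?h ` (B \<inter> X - {b})"
  have EL: "?E \<subseteq> L" using c by auto
  have others: "insert b (?E - {?h e}) \<subseteq> span (B \<inter> X - {e})" if e: "e \<in> B \<inter> X - {b}" for e
  proof
    fix v assume "v \<in> insert b (?E - {?h e})"
    then show "v \<in> span (B \<inter> X - {e})"
    proof
      assume "v \<in> ?E - {?h e}"
      then obtain w where "w \<in> B \<inter> X" "w \<noteq> e" "v = ?h w" by blast
      then show ?thesis using e b by (auto intro!: span_diff span_scale intro: span_base)
    qed (use e b in \<open>auto intro: span_base\<close>)
  qed
  have "independent ?E"
    unfolding independent_iff
  proof (intro ballI notI)
    fix v assume v: "v \<in> ?E" "v \<in> span (?E - {v})"
    then obtain e where e: "e \<in> B \<inter> X - {b}" "v = ?h e" by blast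
    have "span (insert b (?E - {?h e})) \<subseteq> face B X e"
      using others[OF e(1)] by (intro span_minimal) auto
    moreover have "v \<in> span (insert b (?E - {?h e}))"
      using v(2) span_mono[of "?E - {v}" "insert b (?E - {?h e})"] e(2) by blast
    moreover have "b \<in> face B X e" using others[OF e(1)] by blast
    ultimately have "v + c e *s b \<in> face B X e" by (intro span_add span_scale) auto
    then have "e \<in> face B X e" using e(2) by simp
    then show False using hyperplane_face(2)[OF B X] e by blast
  qed
  moreover have "span ?E \<subseteq> L" using EL sub by (intro span_minimal)
  ultimately have ind: "independent (insert b ?E)" using L by (intro independent_insert) auto
  have "insert b ?E \<subseteq> X" using EL sub b by blast
  then obtain B2 where B2: "is_basis UNIV B2" "insert b ?E \<subseteq> B2" "adapted B2 X"
    using exists_adapted_basis[OF sub(2) ind] by auto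
  have ind2: "independent B2" by (rule basis_independent[OF B2(1)])
  have "B \<inter> X \<subseteq> span (insert b ?E)"
  proof
    fix e assume e: "e \<in> B \<inter> X"
    show "e \<in> span (insert b ?E)"
    proof (cases "e = b")
      case False
      then have "?h e \<in> span (insert b ?E)" using e by (intro span_base) auto
      then have "?h e + c e *s b \<in> span (insert b ?E)"
        by (intro span_add span_scale) (auto intro: span_base)
      then show ?thesis by simp
    qed (auto intro: span_base)
  qed
  then have "span (B \<inter> X) \<subseteq> span (insert b ?E)" by (intro span_minimal) auto
  then have "X = span (insert b ?E)" using XB span_minimal[OF \<open>insert b ?E \<subseteq> X\<close> sub(2)] by blast
  then have B2X: "B2 \<inter> X = insert b ?E" using adapted_span_Int[OF ind2 B2(2)] by simp
  have "face B2 X v = L \<or> (\<exists>e\<in>B \<inter> X - {b}. face B2 X v = face B X e)" if v: "v \<in> B2 \<inter> X" for v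
  proof -
    note hv = hyperplane_face(1)[OF ind2 B2(3) v]
    show ?thesis
    proof (cases "v = b")
      case True
      then have "face B2 X v \<subseteq> L" unfolding B2X using EL sub by (intro span_minimal) auto
      then show ?thesis using hyperplane_subset_eq[OF hv L(1)] by blast
    next
      case False
      then obtain e where e: "e \<in> B \<inter> X - {b}" "v = ?h e" using v B2X by blast
      have "face B2 X v \<subseteq> face B X e"
        unfolding B2X using others[OF e(1)] e(2) by (intro span_minimal) auto
      then show ?thesis using hyperplane_subset_eq[OF hv hyperplane_face(1)[OF B X]] e by blast
    qed
  qed
  then show ?thesis using B2 by blast
qed

end

context apartment_isomorphism
begin

text \<open>The face opposite to \<open>b\<close> is the intersection of \<open>X\<close> with another element of the same
  apartment, which is obtained by exchanging \<open>b\<close> for a basis vector outside of \<open>X\<close>.\<close>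

lemma face_image:
  assumes B: "is_basis UNIV B" and X: "X \<in> source.apt B"
    and B': "is_basis UNIV B'" "f ` source.apt B = target.apt B'" and b: "b \<in> B \<inter> X"
  shows "\<exists>b'\<in>B' \<inter> f X. hyper_map (face B X b) = face B' (f X) b'"
proof -
  have ind: "independent B" "independent B'" using basis_independent B(1) B'(1) by auto
  have XC: "X \<in> C" "adapted B X" using X source.apt_D by auto
  have "infinite (B - X)" using source.apt_infinite(2)[OF B X] .
  then obtain t where t: "t \<in> B - X" by (metis ex_in_conv finite.emptyI)
  let ?Y = "span (insert t (B \<inter> X - {b}))"
  have Y: "?Y \<in> source.apt B" "B \<inter> ?Y = insert t (B \<inter> X - {b})" "adj X ?Y"
    using source.apt_swap[OF B X b t] .
  then have YC: "?Y \<in> C" "adapted B ?Y" using source.apt_D by auto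
  have "B \<inter> (X \<inter> ?Y) = (B \<inter> ?Y) \<inter> X" by blast
  also have "\<dots> = B \<inter> X - {b}" unfolding Y(2) using t by auto
  finally have "B \<inter> (X \<inter> ?Y) = B \<inter> X - {b}" .
  then have "X \<inter> ?Y = face B X b"
    using adapted_Int[OF ind(1) XC(2) YC(2)] unfolding adapted_def by simp
  then have eq: "hyper_map (face B X b) = f X \<inter> f ?Y"
    using hyper_map_Int[OF XC(1) YC(1) Y(3)] by simp
  have ad: "adapted B' (f X)" "adapted B' (f ?Y)" using X Y(1) B'(2) target.apt_D(2) by blast+
  have "adapted B' (hyper_map (face B X b))" unfolding eq by (rule adapted_Int[OF ind(2) ad])
  then show ?thesis
    using adapted_hyperplane[OF ind(2) _ _ ad(1)] hyperplane_hyper_map[OF XC(1)]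
      hyperplane_face[OF ind(1) XC(2) b] by blast
qed

end

context apartment_isomorphism
begin

lemma face_preimage:
  assumes B: "is_basis UNIV B" and X: "X \<in> source.apt B"
    and B': "is_basis UNIV B'" "f ` source.apt B = target.apt B'" "g ` target.apt B' = source.apt B"
    and b': "b' \<in> B' \<inter> f X"
  shows "\<exists>b\<in>B \<inter> X. hyper_map (face B X b) = face B' (f X) b'"
proof -
  have "f X \<in> target.apt B'" using X B' by blast
  moreover have gfX: "g (f X) = X" "X \<in> C" using X g_f source.apt_D by auto
  ultimately obtain b where b: "b \<in> B \<inter> X" "inv.hyper_map (face B' (f X) b') = face B X b"
    using inv.face_image[OF B'(1) _ B B'(3), of "f X" b'] b' by auto
  have "hyperplane (face B' (f X) b') (f X)"
    using hyperplane_face[OF _ _ b'] B'(1) target.apt_D \<open>f X \<in> target.apt B'\<close> is_basis_def by blast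
  then have "hyper_map (face B X b) = face B' (f X) b'"
    using inv.inv_hyper_map[OF f_in[OF gfX(2)]] b by metis
  then show ?thesis using b by blast
qed

text \<open>Suppose that \<open>b \<in> K\<close> but \<open>b' \<notin> \<phi>(K)\<close>, where \<open>\<phi>\<close> is the induced map on hyperplanes.  The
  hyperplane \<open>\<langle>b'\<rangle> + (\<phi>(face b) \<inter> \<phi>(K))\<close> is \<open>\<phi>(L)\<close> for some \<open>L\<close> that does not contain \<open>b\<close>.  By
  shearing, \<open>L\<close> and all faces except the one opposite to \<open>b\<close> are the faces of another basis.  But
  the images of all these hyperplanes contain \<open>b'\<close>, whereas the faces of a basis of \<open>f X\<close> have
  intersection \<open>0\<close>.\<close>

lemma hyper_map_contains:
  assumes B: "is_basis UNIV B" and X: "X \<in> source.apt B"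
    and B': "is_basis UNIV B'" "f ` source.apt B = target.apt B'"
    and b: "b \<in> B \<inter> X" and b': "b' \<in> B' \<inter> f X"
    and bb': "hyper_map (face B X b) = face B' (f X) b'"
    and K: "hyperplane K X" and bK: "b \<in> K"
  shows "b' \<in> hyper_map K"
proof (rule ccontr)
  assume b'K: "b' \<notin> hyper_map K"
  have ind: "independent B" "independent B'" using basis_independent B(1) B'(1) by auto
  have XC: "X \<in> C" "adapted B X" using X source.apt_D by auto
  have fX: "f X \<in> target.apt B'" using X B' by blast
  then have fXD: "f X \<in> D" "adapted B' (f X)" using target.apt_D by auto
  let ?Kb = "face B X b"
  have Kb: "hyperplane ?Kb X" "b \<notin> ?Kb" using hyperplane_face[OF ind(1) XC(2) b] .
  note hm = hyperplane_hyper_map[OF XC(1)]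
  let ?M = "hyper_map ?Kb \<inter> hyper_map K"
  have "\<not> hyper_map K \<subseteq> hyper_map ?Kb"
    using hyperplane_subset_eq[OF hm[OF K] hm[OF Kb(1)]] hyper_map_eq_iff[OF XC(1) K Kb(1)] bK Kb(2)
    by blast
  then have M: "hyperplane ?M (hyper_map K)"
    using hyperplane_Int[OF hm[OF Kb(1)]] hyperplane_subspaces[OF hm[OF K]]
      psubset_imp_subset[OF hyperplane_psubset[OF hm[OF K]]] by blast
  let ?L' = "span (insert b' ?M)"
  have L': "hyperplane ?L' (f X)" using hyperplane_insert[OF M hm[OF K]] b' b'K by blast
  define L where "L = inv.hyper_map ?L'"
  have L: "hyperplane L X" using inv.hyperplane_hyper_map[OF fXD(1) L'] g_f XC L_def by simp
  have L'L: "hyper_map L = ?L'" using inv.inv_hyper_map[OF fXD(1) L'] L_def by simp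
  have "?M \<subseteq> ?L'" by (rule span_insert_upper)
  then have "inv.hyper_map (hyper_map ?Kb) \<inter> inv.hyper_map (hyper_map K) \<subseteq> L"
    using inv.hyper_map_pencil[OF fXD(1) hm[OF Kb(1)] hm[OF K] L'] L_def by simp
  then have KKL: "?Kb \<inter> K \<subseteq> L" using inv_hyper_map XC K Kb by simp
  have "b' \<in> ?L'" by (rule span_insert_upper)
  then have "L \<noteq> K" using L'L b'K by blast
  have "b \<notin> L"
  proof
    assume "b \<in> L"
    have "K \<subseteq> X" using K hyperplane_psubset by blast
    then have "hyperplane (?Kb \<inter> K) K"
      using hyperplane_Int[OF Kb(1), of K] hyperplane_subspaces[OF K] bK Kb(2) by blast
    then have "K = span (insert b (?Kb \<inter> K))"
      using hyperplane_span_insert[of "?Kb \<inter> K" K b] bK Kb by blast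
    then have "K \<subseteq> L" using span_insert_least[OF _ KKL \<open>b \<in> L\<close>] hyperplane_subspaces[OF L] by blast
    then show False using hyperplane_subset_eq[OF K L] \<open>L \<noteq> K\<close> by blast
  qed
  then obtain B2 where B2: "is_basis UNIV B2" "adapted B2 X"
    "\<forall>v\<in>B2 \<inter> X. face B2 X v = L \<or> (\<exists>e\<in>B \<inter> X - {b}. face B2 X v = face B X e)"
    using shear_basis[OF ind(1) XC(2) b L] by blast
  have XB2: "X \<in> source.apt B2" using XC B2 source.apt_def by simp
  obtain B2' where B2': "is_basis UNIV B2'" "f ` source.apt B2 = target.apt B2'"
    "g ` target.apt B2' = source.apt B2"
    using apt_image[OF B2(1) XB2] .
  have "b' \<in> hyper_map (face B X e)" if e: "e \<in> B \<inter> X - {b}" for e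
  proof -
    obtain e' where e': "e' \<in> B' \<inter> f X" "hyper_map (face B X e) = face B' (f X) e'"
      using face_image[OF B X B', of e] e by blast
    have "e' \<noteq> b'"
    proof
      assume "e' = b'"
      then have "face B X e = face B X b"
        using hyper_map_eq_iff[OF XC(1) hyperplane_face(1)[OF ind(1) XC(2)] Kb(1), of e] e e' bb'
        by simp
      then show False using face_inj[OF ind(1) XC(2), of e b] e b by blast
    qed
    then show ?thesis unfolding e'(2) using b' by (intro span_base) auto
  qed
  then have all: "b' \<in> hyper_map (face B2 X v)" if "v \<in> B2 \<inter> X" for v
    using B2(3) that L'L \<open>b' \<in> ?L'\<close> by metis
  have "b' = 0"
  proof (rule Inter_faces)
    show "independent B2'" by (rule basis_independent[OF B2'(1)])
    show "adapted B2' (f X)" using imageI[OF XB2, of f] unfolding B2'(2) by (rule target.apt_D(2))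
    show "b' \<in> f X" using b' by blast
    fix v' assume "v' \<in> B2' \<inter> f X"
    then show "b' \<in> face B2' (f X) v'" using face_preimage[OF B2(1) XB2 B2'] all by metis
  qed
  then show False using independent_nonzero[OF ind(2)] b' by blast
qed

end

context apartment_isomorphism
begin

text \<open>Both directions of the equivalence are instances of \<open>hyper_map_contains\<close>, one for \<open>f\<close> and
  one for its inverse.\<close>

lemma point_pair_exists:
  assumes X: "X \<in> C" and b: "b \<in> X" "b \<noteq> 0"
  shows "\<exists>b'. point_pair X b b'"
proof -
  have "independent {b}" using independent_insert[OF independent_empty, of b] b by simp
  then obtain B where B: "is_basis UNIV B" "{b} \<subseteq> B" "adapted B X"
    using exists_adapted_basis[OF source.subspace[OF X]] b by blast
  then have XB: "X \<in> source.apt B" using X source.apt_def by simp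
  obtain B' where B': "is_basis UNIV B'" "f ` source.apt B = target.apt B'"
    "g ` target.apt B' = source.apt B"
    using apt_image[OF B(1) XB] .
  have ind: "independent B" "independent B'" using basis_independent B(1) B'(1) by auto
  obtain b' where b': "b' \<in> B' \<inter> f X" "hyper_map (face B X b) = face B' (f X) b'"
    using face_image[OF B(1) XB B'(1,2), of b] B b by blast
  have bB: "b \<in> B \<inter> X" using B b by blast
  have fX: "f X \<in> target.apt B'" using XB B' by blast
  have inv_face: "inv.hyper_map (face B' (f X) b') = face B X b"
    using inv_hyper_map[OF X hyperplane_face(1)[OF ind(1) B(3) bB]] b'(2) by simp
  have "b \<in> K \<longleftrightarrow> b' \<in> hyper_map K" if K: "hyperplane K X" for K
  proof
    assume "b \<in> K"
    then show "b' \<in> hyper_map K" using hyper_map_contains[OF B(1) XB B'(1,2) bB b' K] by blast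
  next
    assume "b' \<in> hyper_map K"
    then have "b \<in> inv.hyper_map (hyper_map K)"
      using inv.hyper_map_contains[OF B'(1) fX B(1) B'(3) b'(1), of b "hyper_map K"]
        hyperplane_hyper_map[OF X K] g_f[OF X] bB inv_face by simp
    then show "b \<in> K" using inv_hyper_map[OF X K] by simp
  qed
  then show ?thesis unfolding point_pair_def using b' independent_nonzero[OF ind(2)] by blast
qed

text \<open>A hyperplane \<open>L\<close> of \<open>Y\<close> other than \<open>K = X \<inter> Y\<close> meets \<open>K\<close> in a hyperplane \<open>M\<close> of \<open>K\<close>.  For
  \<open>x \<in> X - Y\<close> let \<open>N = M + \<langle>x\<rangle>\<close>, a hyperplane of \<open>X\<close>, and \<open>Z = L + N\<close>.  In the triangle \<open>X\<close>, \<open>Y\<close>,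
  \<open>Z\<close> one has \<open>L = Y \<inter> Z\<close> and \<open>N = X \<inter> Z\<close>; so a point of \<open>X \<inter> Y\<close> is on \<open>L\<close> iff it is on \<open>N\<close>,
  and the same holds for the images under \<open>f\<close>.\<close>

lemma point_pair_adj:
  assumes X: "X \<in> C" and Y: "Y \<in> C" and XY: "adj X Y" and b: "b \<in> X \<inter> Y"
    and p: "point_pair X b b'"
  shows "point_pair Y b b'"
proof -
  let ?K = "X \<inter> Y"
  have K: "hyperplane ?K X" "hyperplane ?K Y" using XY unfolding adj_def by auto
  have eqK: "hyper_map ?K = f X \<inter> f Y" using hyper_map_Int[OF X Y XY] .
  then have b'K: "b' \<in> f X \<inter> f Y" using p K(1) b unfolding point_pair_def by blast
  have "b \<in> L \<longleftrightarrow> b' \<in> hyper_map L" if L: "hyperplane L Y" for L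
  proof (cases "L = ?K")
    case True
    then show ?thesis using b b'K eqK by simp
  next
    case False
    have "\<not> ?K \<subseteq> L" using hyperplane_subset_eq[OF K(2) L] False by blast
    then have M: "hyperplane (L \<inter> ?K) ?K"
      using hyperplane_Int[OF L, of ?K] K hyperplane_subspaces by blast
    have "\<not> L \<subseteq> ?K" using hyperplane_subset_eq[OF L K(2)] False by blast
    then obtain y where y: "y \<in> L" "y \<notin> ?K" by blast
    then have yX: "y \<notin> X" using hyperplane_psubset[OF L] by blast
    obtain x where x: "x \<in> X" "x \<notin> Y" using hyperplane_psubset[OF K(1)] by blast
    let ?N = "span (insert x (L \<inter> ?K))"
    let ?Z = "span (insert y ?N)"
    have N: "hyperplane ?N X" using hyperplane_insert[OF M K(1) x(1)] x by blast
    note Z = source.hyperplane_eq_Int[OF X N yX]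
    have "hyperplane (L \<inter> ?K) L"
    proof -
      have "hyperplane (?K \<inter> L) L"
        using hyperplane_Int[OF K(2), of L] hyperplane_subspaces[OF L] hyperplane_psubset[OF L]
          \<open>\<not> L \<subseteq> ?K\<close> by blast
      then show ?thesis by (simp add: Int_commute)
    qed
    then have "L = span (insert y (L \<inter> ?K))" using hyperplane_span_insert y by blast
    then have "span (insert x L) = span (insert x (insert y (L \<inter> ?K)))"
      using span_insert_span by metis
    also have "\<dots> = ?Z" by (simp add: insert_commute span_insert_span)
    finally have "?Z = span (insert x L)" ..
    moreover have "x \<notin> L" using x hyperplane_psubset[OF L] by blast
    ultimately have LZ: "hyperplane L ?Z"
      using hyperplane_intro[of L x] hyperplane_subspaces[OF L] by simp
    have "x \<in> ?Z" using span_insert_upper(2)[of x "L \<inter> ?K"] span_insert_upper(1)[of ?N y] by blast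
    then have "Y \<noteq> ?Z" using x by blast
    note YZ = adj_if_common_hyperplane[OF L LZ this]
    have "x \<notin> ?K" using x by blast
    have "b \<in> ?N \<longleftrightarrow> b \<in> L"
    proof
      assume "b \<in> ?N"
      then obtain a where a: "b - a *s x \<in> L \<inter> ?K"
        using span_insert_subspace[of "L \<inter> ?K"] hyperplane_subspaces[OF M] by blast
      then have "b - (b - a *s x) \<in> ?K"
        using b a hyperplane_subspaces[OF M] subspace_diff[of ?K b "b - a *s x"] by blast
      then have "a *s x \<in> ?K" by simp
      then have "inverse a *s a *s x \<in> ?K" using hyperplane_subspaces[OF M] subspace_scale by blast
      then have "a = 0" using \<open>x \<notin> ?K\<close> scale_inverse[of a x] by metis
      then show "b \<in> L" using a by simp
    next
      assume "b \<in> L"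
      then show "b \<in> ?N" using b span_insert_upper(1)[of "L \<inter> ?K" x] by blast
    qed
    moreover have "hyper_map ?N = f X \<inter> f ?Z" using hyper_map_Int[OF X Z(1,2)] Z(3) by simp
    moreover have "hyper_map L = f Y \<inter> f ?Z" using hyper_map_Int[OF Y Z(1) YZ(2)] YZ(1) by simp
    ultimately show ?thesis using p N b'K unfolding point_pair_def by blast
  qed
  then show ?thesis using p b'K unfolding point_pair_def by blast
qed

end

context commensurability_class
begin

text \<open>Between two elements there is a finite path through elements that contain their intersection,
  found in an apartment that contains both.\<close>

lemma adj_induct:
  assumes X: "X \<in> C" and Y: "Y \<in> C" and b: "b \<in> X \<inter> Y" "b \<noteq> 0" and PX: "P X"
    and step: "\<And>X Z. X \<in> C \<Longrightarrow> Z \<in> C \<Longrightarrow> adj X Z \<Longrightarrow> b \<in> X \<inter> Z \<Longrightarrow> P X \<Longrightarrow> P Z"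
  shows "P Y"
proof -
  have "independent {b}" using independent_insert[OF independent_empty, of b] b by simp
  then obtain B where B: "is_basis UNIV B" "{b} \<subseteq> B" "adapted B X" "adapted B Y"
    using common_adapted_basis[OF subspace[OF X] subspace[OF Y], of "{b}"] b by auto
  have ind: "independent B" by (rule basis_independent[OF B(1)])
  obtain F where F: "finite F" "X \<subseteq> span (Y \<union> F)" using commensurable[OF X Y] by blast
  have "\<forall>v. \<exists>G. finite G \<and> G \<subseteq> B \<and> v \<in> span G" using span_finitary[OF basis_span[OF B(1)]] by blast
  then obtain G where G: "\<And>v. finite (G v) \<and> G v \<subseteq> B \<and> v \<in> span (G v)" by metis
  let ?G = "\<Union>v\<in>F. G v"
  have YB: "span (B \<inter> Y) = Y" using B(4) unfolding adapted_def by simp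
  have "Y \<union> F \<subseteq> span ((B \<inter> Y) \<union> ?G)"
  proof
    fix v assume "v \<in> Y \<union> F"
    then show "v \<in> span ((B \<inter> Y) \<union> ?G)"
    proof
      assume "v \<in> Y"
      then show ?thesis using YB span_mono[of "B \<inter> Y" "(B \<inter> Y) \<union> ?G"] by blast
    next
      assume "v \<in> F"
      then have "span (G v) \<subseteq> span ((B \<inter> Y) \<union> ?G)" by (intro span_mono) auto
      then show ?thesis using G[of v] by blast
    qed
  qed
  then have "span (Y \<union> F) \<subseteq> span ((B \<inter> Y) \<union> ?G)" by (intro span_minimal) auto
  then have "s \<in> ?G" if "s \<in> B \<inter> X - Y" for s
    using independent_span_mem[OF ind, of "(B \<inter> Y) \<union> ?G" s] G F that by blast
  then have fin: "finite (B \<inter> X - Y)" using F G finite_subset[of "B \<inter> X - Y" ?G] by blast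
  have XB: "X \<in> apt B" using X B apt_def by simp
  have "card (B \<inter> X - Y) = n \<Longrightarrow> finite (B \<inter> X - Y) \<Longrightarrow> X \<in> apt B \<Longrightarrow> b \<in> X \<Longrightarrow> P X \<Longrightarrow> P Y" for n
  proof (induction n arbitrary: X)
    case 0
    then have "B \<inter> X \<subseteq> Y" by auto
    then have "X \<subseteq> Y" by (rule adapted_subset[OF apt_D(2)[OF 0(3)] B(4)])
    then have "X = Y" by (rule antichain[OF apt_D(1)[OF 0(3)] Y])
    then show ?case using 0 by simp
  next
    case (Suc n)
    have "B \<inter> X - Y \<noteq> {}" using Suc.prems(1) by (metis card.empty nat.distinct(1))
    then obtain s where s: "s \<in> B \<inter> X - Y" by blast
    have "\<not> B \<inter> Y \<subseteq> X"
      using adapted_subset[OF B(4) apt_D(2)[OF Suc.prems(3)]] s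
        antichain[OF Y apt_D(1)[OF Suc.prems(3)]] by blast
    then obtain t where t: "t \<in> B \<inter> Y - X" by blast
    let ?Z = "span (insert t (B \<inter> X - {s}))"
    have Z: "?Z \<in> apt B" "B \<inter> ?Z = insert t (B \<inter> X - {s})" "adj X ?Z"
      using apt_swap[OF B(1) Suc.prems(3), of s t] s t by auto
    have "B \<inter> ?Z - Y = (B \<inter> X - Y) - {s}" unfolding Z(2) using t by auto
    moreover have "b \<in> ?Z" using s b B(2) Suc.prems(4) by (intro span_base) auto
    moreover have "P ?Z"
      using step[OF apt_D(1)[OF Suc.prems(3)] apt_D(1)[OF Z(1)] Z(3)] \<open>b \<in> ?Z\<close> Suc.prems by blast
    ultimately show ?case using Suc.IH[of ?Z] Z(1) Suc.prems(1,2) s by simp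
  qed
  then show ?thesis using fin XB b PX by blast
qed

end

context apartment_isomorphism
begin

lemma point_pair_global:
  assumes "X \<in> C" "Y \<in> C" "b \<in> X \<inter> Y" "b \<noteq> 0" "point_pair X b b'"
  shows "point_pair Y b b'"
  using assms(5) point_pair_adj by (rule source.adj_induct[OF assms(1-4)])

lemma point_pair_inverse:
  assumes "X \<in> C" "b \<in> X" "b \<noteq> 0" "point_pair X b b'"
  shows "inv.point_pair (f X) b' b"
  unfolding inv.point_pair_def
proof (intro conjI allI impI)
  show "b \<in> g (f X)" "b \<noteq> 0" using assms g_f by auto
  fix K assume K: "hyperplane K (f X)"
  have "hyperplane (inv.hyper_map K) X" using inv.hyperplane_hyper_map[OF f_in K] assms g_f by simp
  then show "b' \<in> K \<longleftrightarrow> b \<in> inv.hyper_map K"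
    using assms(4) inv.inv_hyper_map[OF f_in K] assms(1) unfolding point_pair_def by auto
qed

end

context commensurability_class
begin

lemma exists_superset:
  assumes "finite F"
  shows "\<exists>X\<in>C. F \<subseteq> X"
  using assms
proof (induction F rule: finite_induct)
  case empty
  then show ?case using nonempty by blast
next
  case (insert b F)
  then obtain X where X: "X \<in> C" "F \<subseteq> X" by blast
  obtain y where "y \<in> X" "y \<notin> span F" using infinite_dim[OF X(1) insert.hyps(1)] by blast
  moreover have "span F \<subseteq> X" using span_minimal X subspace by blast
  ultimately obtain H where H: "hyperplane H X" "span F \<subseteq> H"
    using hyperplane_separate[OF subspace[OF X(1)], of "span F" y] by auto
  have FH: "F \<subseteq> H" using H(2) span_superset[of F] by blast
  show ?case
  proof (cases "b \<in> H")
    case True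
    then show ?thesis using X FH hyperplane_psubset[OF H(1)] by blast
  next
    case False
    then have "span (insert b H) \<in> C" using replace X H by blast
    moreover have "insert b F \<subseteq> span (insert b H)"
      using FH span_insert_upper(1)[of H b] span_insert_upper(2)[of b H] by blast
    ultimately show ?thesis by blast
  qed
qed

text \<open>A hyperplane \<open>H\<close> of some \<open>X\<close> that contains \<open>F\<close> and not \<open>x\<close> can be enlarged by a vector
  outside of \<open>X\<close> to an element of the class that does not contain \<open>x\<close> either.\<close>

lemma span_iff_class:
  assumes "finite F"
  shows "x \<in> span F \<longleftrightarrow> (\<forall>X\<in>C. F \<subseteq> X \<longrightarrow> x \<in> X)"
proof
  show "x \<in> span F \<Longrightarrow> \<forall>X\<in>C. F \<subseteq> X \<longrightarrow> x \<in> X" using span_minimal subspace by blast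
  assume all: "\<forall>X\<in>C. F \<subseteq> X \<longrightarrow> x \<in> X"
  show "x \<in> span F"
  proof (rule ccontr)
    assume x: "x \<notin> span F"
    obtain X where X: "X \<in> C" "F \<subseteq> X" using exists_superset[OF assms] by blast
    have "span F \<subseteq> X" using span_minimal X subspace by blast
    then obtain H where H: "hyperplane H X" "span F \<subseteq> H" "x \<notin> H"
      using hyperplane_separate[OF subspace[OF X(1)], of "span F" x] x all X by auto
    obtain t where t: "t \<notin> X" using outside X by blast
    note Y = hyperplane_eq_Int[OF X(1) H(1) t]
    have "F \<subseteq> span (insert t H)"
      using H(2) span_superset[of F] span_insert_upper(1)[of H t] by blast
    then have "x \<in> X \<inter> span (insert t H)" using all X Y(1) by blast
    then show False using Y(3) H(3) by blast
  qed
qed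

end

context apartment_isomorphism
begin

lemma point_map_exists:
  "\<exists>p. \<forall>b. b \<noteq> 0 \<longrightarrow> p b \<noteq> 0 \<and> (\<forall>X\<in>C. b \<in> X \<longleftrightarrow> p b \<in> f X)"
proof -
  have "\<exists>b'. b \<noteq> 0 \<longrightarrow> b' \<noteq> 0 \<and> (\<forall>X\<in>C. b \<in> X \<longleftrightarrow> b' \<in> f X)" for b
  proof (cases "b = 0")
    case False
    obtain Y where Y: "Y \<in> C" "b \<in> Y" using source.exists_superset[of "{b}"] by auto
    obtain b' where b': "point_pair Y b b'" using point_pair_exists[OF Y False] by blast
    then have b'0: "b' \<noteq> 0" "b' \<in> f Y" unfolding point_pair_def by auto
    have "b \<in> X \<longleftrightarrow> b' \<in> f X" if X: "X \<in> C" for X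
    proof
      assume "b \<in> X"
      then have "point_pair X b b'" using point_pair_global[OF Y(1) X _ False b'] Y by blast
      then show "b' \<in> f X" unfolding point_pair_def by blast
    next
      assume "b' \<in> f X"
      then have "inv.point_pair (f X) b' b"
        using inv.point_pair_global[OF f_in[OF Y(1)] f_in[OF X] _ b'0(1)] b'0
          point_pair_inverse[OF Y False b'] by blast
      then show "b \<in> X" using g_f[OF X] unfolding inv.point_pair_def by simp
    qed
    then show ?thesis using b'0 by blast
  qed auto
  then show ?thesis by metis
qed

end

section \<open>The fundamental theorem of projective geometry\<close>

context left_vector_space
begin

definition ind2 :: "'v \<Rightarrow> 'v \<Rightarrow> bool" where
  "ind2 x y \<longleftrightarrow> (\<forall>a b. a *s x + b *s y = 0 \<longrightarrow> a = 0 \<and> b = 0)"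

definition ind3 :: "'v \<Rightarrow> 'v \<Rightarrow> 'v \<Rightarrow> bool" where
  "ind3 x y z \<longleftrightarrow> (\<forall>a b c. a *s x + b *s y + c *s z = 0 \<longrightarrow> a = 0 \<and> b = 0 \<and> c = 0)"

lemma span_1: "v \<in> span {x} \<longleftrightarrow> (\<exists>a. v = a *s x)"
  using span_insert[of v x "{}"] by simp

lemma span_2: "v \<in> span {x, y} \<longleftrightarrow> (\<exists>a b. v = a *s x + b *s y)"
proof -
  have "v \<in> span {x, y} \<longleftrightarrow> (\<exists>a b. v - a *s x = b *s y)"
    using span_insert[of v x "{y}"] span_1 by simp
  then show ?thesis by (simp add: diff_eq_eq add.commute)
qed

lemma ind2_iff: "ind2 x y \<longleftrightarrow> x \<noteq> 0 \<and> y \<notin> span {x}"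
proof
  assume *: "ind2 x y"
  have "x \<noteq> 0" using *[unfolded ind2_def, rule_format, of 1 0] by auto
  moreover have "y \<noteq> a *s x" for a
    using *[unfolded ind2_def, rule_format, of a "- 1"] by (auto simp: scale_one)
  ultimately show "x \<noteq> 0 \<and> y \<notin> span {x}" using span_1 by blast
next
  assume *: "x \<noteq> 0 \<and> y \<notin> span {x}"
  show "ind2 x y"
    unfolding ind2_def
  proof (intro allI impI)
    fix a b assume ab: "a *s x + b *s y = 0"
    have "b = 0"
    proof (rule ccontr)
      assume b: "b \<noteq> 0"
      have "b *s y = - (a *s x)" using ab by (simp add: add_eq_0_iff)
      then have "inverse b *s b *s y = (- (inverse b * a)) *s x" by (simp add: scale_scale)
      then have "y = (- (inverse b * a)) *s x" using b by simp
      then show False using * span_1 by blast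
    qed
    then show "a = 0 \<and> b = 0" using ab * by simp
  qed
qed

lemma ind2_sym: "ind2 x y \<Longrightarrow> ind2 y x"
  unfolding ind2_def by (metis add.commute)

lemma ind3_iff: "ind3 x y z \<longleftrightarrow> ind2 x y \<and> z \<notin> span {x, y}"
proof
  assume *: "ind3 x y z"
  have "ind2 x y" unfolding ind2_def using *[unfolded ind3_def, rule_format, of _ _ 0] by auto
  moreover have "z \<noteq> a *s x + b *s y" for a b
    using *[unfolded ind3_def, rule_format, of a b "- 1"] by (auto simp: scale_one)
  ultimately show "ind2 x y \<and> z \<notin> span {x, y}" using span_2 by blast
next
  assume *: "ind2 x y \<and> z \<notin> span {x, y}"
  show "ind3 x y z"
    unfolding ind3_def
  proof (intro allI impI)
    fix a b c assume abc: "a *s x + b *s y + c *s z = 0"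
    have "c = 0"
    proof (rule ccontr)
      assume c: "c \<noteq> 0"
      have "c *s z = - (a *s x + b *s y)" using abc by (simp add: add_eq_0_iff)
      then have "inverse c *s c *s z = (- (inverse c * a)) *s x + (- (inverse c * b)) *s y"
        by (simp add: scale_scale scale_diff_right scale_right_distrib)
      then show False using * c span_2 scale_inverse by metis
    qed
    then show "a = 0 \<and> b = 0 \<and> c = 0" using abc * unfolding ind2_def by auto
  qed
qed

lemma ind3_swap: "ind3 x y z \<Longrightarrow> ind3 y x z" "ind3 x y z \<Longrightarrow> ind3 x z y"
  unfolding ind3_def by (metis add.commute, metis add.commute add.assoc)

lemma ind3_ind2: "ind3 x y z \<Longrightarrow> ind2 x y" "ind3 x y z \<Longrightarrow> ind2 y z" "ind3 x y z \<Longrightarrow> ind2 x z"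
  using ind3_iff ind3_swap ind2_sym by blast+

lemma ind3_coeffs:
  assumes "ind3 x y z" "a *s x + b *s y + c *s z = a' *s x + b' *s y + c' *s z"
  shows "a = a' \<and> b = b' \<and> c = c'"
proof -
  have "(a - a') *s x + (b - b') *s y + (c - c') *s z = 0"
    using assms(2) by (simp add: scale_diff_left algebra_simps)
  then have "a - a' = 0 \<and> b - b' = 0 \<and> c - c' = 0" using assms(1) unfolding ind3_def by blast
  then show ?thesis by simp
qed

lemma ind2_coeffs:
  assumes "ind2 x y" "a *s x + b *s y = a' *s x + b' *s y"
  shows "a = a' \<and> b = b'"
proof -
  have "(a - a') *s x + (b - b') *s y = 0"
    using assms(2) by (simp add: scale_diff_left algebra_simps)
  then have "a - a' = 0 \<and> b - b' = 0" using assms(1) unfolding ind2_def by blast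
  then show ?thesis by simp
qed

lemma scale_cancel: "x \<noteq> 0 \<Longrightarrow> a *s x = b *s x \<longleftrightarrow> a = b"
  using scale_diff_left[of a b x] by auto

lemma ind3_outside: "ind2 x y \<Longrightarrow> x \<in> span S \<Longrightarrow> y \<in> span S \<Longrightarrow> z \<notin> span S \<Longrightarrow> ind3 x y z"
  using ind3_iff span_minimal[of "{x, y}" "span S"] by auto

lemma ind2_outside: "x \<noteq> 0 \<Longrightarrow> x \<in> span S \<Longrightarrow> z \<notin> span S \<Longrightarrow> ind2 x z"
  using ind2_iff span_minimal[of "{x}" "span S"] by auto

lemma common_line: "u \<in> span {q} \<Longrightarrow> v \<in> span {q} \<Longrightarrow> u \<noteq> 0 \<Longrightarrow> \<exists>d. v = d *s u"
  unfolding span_1 by (metis scale_inverse scale_scale scale_zero_left)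

end

text \<open>A collineation is given by a representative \<open>p v\<close> of the image of the point \<open>\<langle>v\<rangle>\<close>.\<close>

locale collineation = left_vector_space scale
  for scale :: "'k::division_ring \<Rightarrow> 'v::ab_group_add \<Rightarrow> 'v"  (infixr "*s" 75) +
  fixes p :: "'v \<Rightarrow> 'v"
  assumes nonzero: "v \<noteq> 0 \<Longrightarrow> p v \<noteq> 0"
    and line: "u \<noteq> 0 \<Longrightarrow> v \<noteq> 0 \<Longrightarrow> w \<noteq> 0 \<Longrightarrow> u \<in> span {v, w} \<longleftrightarrow> p u \<in> span {p v, p w}"
    and onto: "w \<noteq> 0 \<Longrightarrow> \<exists>v. v \<noteq> 0 \<and> w \<in> span {p v}"
    and dim4: "\<exists>w. w \<notin> span {x, y, z}"
begin

text \<open>The image of the point \<open>\<langle>x\<rangle>\<close> is \<open>\<langle>x'\<rangle>\<close>.\<close>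

definition rep :: "'v \<Rightarrow> 'v \<Rightarrow> bool" where
  "rep x x' \<longleftrightarrow> x \<noteq> 0 \<and> x' \<noteq> 0 \<and> x' \<in> span {p x}"

text \<open>The relation says that \<open>x \<mapsto> x'\<close>, \<open>y \<mapsto> y'\<close> are values of the same linear lift, for
  this lift must map the line of \<open>x - y\<close> to that of \<open>x' - y'\<close>.\<close>

definition compat :: "'v \<Rightarrow> 'v \<Rightarrow> 'v \<Rightarrow> 'v \<Rightarrow> bool" where
  "compat x x' y y' \<longleftrightarrow> rep x x' \<and> rep y y' \<and> rep (x - y) (x' - y')"

lemma rep_span: "rep x x' \<Longrightarrow> span {x'} = span {p x}"
proof -
  assume *: "rep x x'"
  then have "p x \<in> span {x'}" using exchange[of x' "p x" "{}"] unfolding rep_def by simp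
  then show ?thesis using * unfolding rep_def by (intro subset_antisym span_minimal) auto
qed

lemma rep_p: "x \<noteq> 0 \<Longrightarrow> rep x (p x)"
  unfolding rep_def using nonzero by (simp add: span_base)

lemma rep_line:
  assumes "rep u u'" "rep v v'" "rep w w'"
  shows "u \<in> span {v, w} \<longleftrightarrow> u' \<in> span {v', w'}"
proof -
  have nz: "u \<noteq> 0" "v \<noteq> 0" "w \<noteq> 0" using assms rep_def by auto
  have "span {v', w'} = span (span {v'} \<union> span {w'})"
    by (metis span_Un_span Un_commute insert_is_Un)
  also have "\<dots> = span {p v, p w}"
    unfolding rep_span[OF assms(2)] rep_span[OF assms(3)]
    by (metis span_Un_span Un_commute insert_is_Un)
  finally have "u' \<in> span {v', w'} \<longleftrightarrow> span {u'} \<subseteq> span {p v, p w}"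
    using span_subset_iff[of "span {p v, p w}" "{u'}"] by simp
  also have "\<dots> \<longleftrightarrow> p u \<in> span {p v, p w}"
    unfolding rep_span[OF assms(1)] using span_subset_iff[of "span {p v, p w}" "{p u}"] by simp
  finally show ?thesis using line nz by simp
qed

lemma rep_ind2: "rep x x' \<Longrightarrow> rep y y' \<Longrightarrow> ind2 x y \<longleftrightarrow> ind2 x' y'"
  using rep_line[of y y' x x' x x'] ind2_iff rep_def by auto

lemma rep_ind3: "rep x x' \<Longrightarrow> rep y y' \<Longrightarrow> rep z z' \<Longrightarrow> ind3 x y z \<longleftrightarrow> ind3 x' y' z'"
  using rep_line[of z z' x x' y y'] ind3_iff rep_ind2 by auto

lemma rep_same: "rep x x' \<Longrightarrow> rep x x'' \<Longrightarrow> \<exists>d. d \<noteq> 0 \<and> x'' = d *s x'"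
  using common_line[of x' "p x" x''] unfolding rep_def by auto

lemma rep_scale: "rep x x' \<Longrightarrow> d \<noteq> 0 \<Longrightarrow> rep x (d *s x')"
  unfolding rep_def by (auto intro: span_scale)

lemma rep_minus:
  assumes "rep x x'"
  shows "rep (- x) (- x')"
proof -
  have x: "x \<noteq> 0" "- x \<noteq> 0" using assms rep_def by auto
  have "- x \<in> span {x, x}" by (intro span_neg span_base) auto
  then have "p (- x) \<in> span {x'}" using rep_line[OF rep_p[OF x(2)] assms assms] by simp
  then obtain d where d: "p (- x) = d *s x'" using span_1 by blast
  then have "d \<noteq> 0" using nonzero[OF x(2)] by auto
  then have "- x' = (- inverse d) *s p (- x)" using d by simp
  then show ?thesis using rep_scale[OF rep_p[OF x(2)], of "- inverse d"] \<open>d \<noteq> 0\<close> by simp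
qed

lemma compat_sym: "compat x x' y y' \<Longrightarrow> compat y y' x x'"
  using rep_minus[of "x - y" "x' - y'"] unfolding compat_def by simp

text \<open>The line of \<open>x - y\<close> is mapped into \<open>\<langle>x', p y\<rangle>\<close>, and to neither of the two points that span
  it, so after scaling it contains \<open>x' - y'\<close> for some multiple \<open>y'\<close> of \<open>p y\<close>.\<close>

lemma compat_exists:
  assumes xy: "ind2 x y" and x': "rep x x'"
  shows "\<exists>y'. compat x x' y y'"
proof -
  have "y \<noteq> 0" "x - y \<noteq> 0"
    using ind2_sym[OF xy] ind2_iff[of y x] xy ind2_iff[of x y] span_base[of x "{x}"] by auto
  then have y: "rep y (p y)" and d: "rep (x - y) (p (x - y))" using rep_p by auto
  have "x - y \<in> span {x, y}" by (intro span_diff span_base) auto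
  then have "p (x - y) \<in> span {x', p y}" using rep_line[OF d x' y] by blast
  then obtain a b where ab: "p (x - y) = a *s x' + b *s p y" using span_2 by blast
  have "a \<noteq> 0"
  proof
    assume "a = 0"
    then have "p (x - y) \<in> span {p y, p y}" using ab span_1 by auto
    then have "x - y \<in> span {y}" using rep_line[OF d y y] by simp
    then have "x - y + y \<in> span {y}" by (intro span_add) (auto intro: span_base)
    then show False using ind2_sym[OF xy] ind2_iff by simp
  qed
  have "b \<noteq> 0"
  proof
    assume "b = 0"
    then have "p (x - y) \<in> span {x', x'}" using ab span_1 by auto
    then have "x - y \<in> span {x}" using rep_line[OF d x' x'] by simp
    then have "x - (x - y) \<in> span {x}" by (rule span_diff[OF span_base[of x "{x}"], rotated]) simp
    then show False using xy ind2_iff by simp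
  qed
  let ?y' = "(- (inverse a * b)) *s p y"
  have "rep y ?y'" using rep_scale[OF y, of "- (inverse a * b)"] \<open>a \<noteq> 0\<close> \<open>b \<noteq> 0\<close> by simp
  moreover have "x' - ?y' = inverse a *s p (x - y)"
    unfolding ab using \<open>a \<noteq> 0\<close> by (simp add: scale_right_distrib scale_scale scale_one)
  then have "rep (x - y) (x' - ?y')" using rep_scale[OF d, of "inverse a"] \<open>a \<noteq> 0\<close> by simp
  ultimately show ?thesis using x' unfolding compat_def by blast
qed

lemma compat_unique:
  assumes xy: "ind2 x y" and c: "compat x x' y y'" "compat x x' y y''"
  shows "y' = y''"
proof -
  have reps: "rep x x'" "rep y y'" "rep y y''" "rep (x - y) (x' - y')" "rep (x - y) (x' - y'')"
    using c compat_def by auto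
  then have ind: "ind2 x' y'" using rep_ind2 xy by blast
  obtain d where d: "x' - y'' = d *s (x' - y')" using rep_same reps by blast
  obtain c where c: "y'' = c *s y'" using rep_same reps by blast
  have "1 *s x' + (- c) *s y' = d *s x' + (- d) *s y'"
    using d unfolding c by (simp add: scale_diff_right scale_one)
  then have "1 = d \<and> - c = - d" by (rule ind2_coeffs[OF ind])
  then show ?thesis using c by (simp add: scale_one)
qed

text \<open>The line of \<open>x - z = (x - y) + (y - z)\<close> is mapped into \<open>\<langle>x' - y', y' - z'\<rangle>\<close> and into
  \<open>\<langle>x', z'\<rangle>\<close>, which meet in the line of \<open>x' - z'\<close>.\<close>

lemma compat_trans:
  assumes ind: "ind3 x y z" and c: "compat x x' y y'" "compat y y' z z'"
  shows "compat x x' z z'"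
proof -
  have reps: "rep x x'" "rep y y'" "rep z z'" "rep (x - y) (x' - y')" "rep (y - z) (y' - z')"
    using c compat_def by auto
  have ind': "ind3 x' y' z'" using ind reps rep_ind3 by blast
  have "x - z \<noteq> 0" using ind3_ind2(3)[OF ind] ind2_iff[of x z] span_base[of x "{x}"] by auto
  then have q: "rep (x - z) (p (x - z))" by (rule rep_p)
  have "x - z \<in> span {x, z}" by (intro span_diff span_base) auto
  then obtain a b where ab: "p (x - z) = a *s x' + b *s z'"
    using rep_line[OF q reps(1,3)] span_2 by blast
  have "(x - y) + (y - z) \<in> span {x - y, y - z}" by (intro span_add span_base) auto
  then have "x - z \<in> span {x - y, y - z}" by simp
  then obtain c d where cd: "p (x - z) = c *s (x' - y') + d *s (y' - z')"
    using rep_line[OF q reps(4,5)] span_2 by blast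
  have "a *s x' + 0 *s y' + b *s z' = c *s x' + (d - c) *s y' + (- d) *s z'"
    using ab cd by (simp add: scale_diff_right scale_diff_left algebra_simps)
  then have eq: "a = c \<and> 0 = d - c \<and> b = - d" by (rule ind3_coeffs[OF ind'])
  then have "p (x - z) = a *s (x' - z')" using ab by (simp add: scale_diff_right)
  moreover have "a \<noteq> 0" using calculation q rep_def by auto
  ultimately have "rep (x - z) (x' - z')" using rep_scale[OF q, of "inverse a"] by simp
  then show ?thesis using reps compat_def by blast
qed

text \<open>The value at \<open>x\<close> is determined by compatibility with a fixed vector \<open>e\<close>, or with a second
  vector \<open>e2\<close> in case \<open>x\<close> is a multiple of \<open>e\<close>.  A fourth dimension provides a vector \<open>z\<close>
  independent of those considered, and compatibility of \<open>x\<close> and \<open>y\<close> follows by transitivity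
  through \<open>z\<close>.\<close>

lemma compatible_lift_exists:
  "\<exists>l. l 0 = 0 \<and> (\<forall>x. x \<noteq> 0 \<longrightarrow> rep x (l x)) \<and> (\<forall>x y. ind2 x y \<longrightarrow> compat x (l x) y (l y))"
proof -
  obtain e where "e \<notin> span {0, 0, 0}" using dim4 by blast
  then have e: "e \<noteq> 0" by auto
  have e': "rep e (p e)" using rep_p e by blast
  obtain e2 where "e2 \<notin> span {e, e, e}" using dim4 by blast
  then have e2: "ind2 e e2" using ind2_iff e by simp
  obtain e2' where e2': "compat e (p e) e2 e2'" using compat_exists[OF e2 e'] by blast
  have e2'': "rep e2 e2'" using e2' compat_def by blast
  have ind_e2: "ind2 e2 x" if "x \<noteq> 0" "\<not> ind2 e x" for x
  proof -
    have "x \<in> span {e}" using that e ind2_iff by blast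
    then have "\<not> e2 \<in> span {x}" using e2 ind2_iff span_minimal[of "{x}" "span {e}"] by auto
    then show ?thesis using ind2_iff ind2_sym that by blast
  qed
  have "\<exists>x'. if x = 0 then x' = 0 else if ind2 e x then compat e (p e) x x' else compat e2 e2' x x'"
    for x
    using compat_exists[OF _ e', of x] compat_exists[OF ind_e2 e2'', of x] by (cases "x = 0") auto
  then obtain l where l: "\<And>x. if x = 0 then l x = 0 else if ind2 e x then compat e (p e) x (l x)
      else compat e2 e2' x (l x)"
    by metis
  have l0: "l 0 = 0" and le: "\<And>x. ind2 e x \<Longrightarrow> compat e (p e) x (l x)"
    and le2: "\<And>x. x \<noteq> 0 \<Longrightarrow> \<not> ind2 e x \<Longrightarrow> compat e2 e2' x (l x)"
    using l ind2_iff[of e 0] span_zero[of "{e}"] by (force, metis, metis)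
  have rep_l: "rep x (l x)" if "x \<noteq> 0" for x using le[of x] le2[of x] that compat_def by blast
  have l_e2: "l e2 = e2'" using compat_unique[OF e2 le[OF e2] e2'] .
  have A: "compat x (l x) y (l y)" if "ind3 e x y" for x y
    using compat_trans[OF ind3_swap(1)[OF that] compat_sym[OF le] le] ind3_ind2[OF that] by blast
  have B: "compat x (l x) y (l y)" if xy: "ind2 x y" "ind2 e x" "ind2 e y" for x y
  proof -
    obtain z where z: "z \<notin> span {e, x, y}" using dim4 by blast
    have "ind3 e x z" "ind3 e y z" "ind3 x y z"
      using ind3_outside[OF _ _ _ z] xy span_base[of _ "{e, x, y}"] by auto
    then show ?thesis using compat_trans[of x z y] A ind3_swap by blast
  qed
  have C: "compat x (l x) y (l y)" if xy: "ind2 x y" "\<not> ind2 e x" "ind2 e y" for x y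
  proof -
    obtain z where z: "z \<notin> span {e, e2, y}" using dim4 by blast
    have x0: "x \<noteq> 0" using xy ind2_iff by blast
    have "x \<in> span {e}" using xy(2) e ind2_iff by blast
    then have x: "x \<in> span {e, e2, y}" using span_mono[of "{e}" "{e, e2, y}"] by auto
    have xe2: "ind2 x e2" using ind2_sym ind_e2 x0 xy by blast
    have in_span: "e \<in> span {e, e2, y}" "e2 \<in> span {e, e2, y}" "y \<in> span {e, e2, y}"
      by (auto intro: span_base)
    have nz: "e2 \<noteq> 0" "y \<noteq> 0" using ind2_sym[OF e2] ind2_sym[OF xy(1)] ind2_iff by blast+
    have i: "ind3 x e2 z" "ind3 x y z"
      using ind3_outside[OF xe2 x in_span(2) z] ind3_outside[OF xy(1) x in_span(3) z] .
    have j: "ind2 e z" "ind2 e2 z" "ind2 y z" using ind2_outside z in_span e nz by blast+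
    have "compat x (l x) e2 (l e2)" using compat_sym[OF le2[OF x0 xy(2)]] l_e2 by simp
    then have "compat x (l x) z (l z)" using compat_trans[OF i(1)] B[OF j(2) e2 j(1)] by blast
    then show ?thesis
      using compat_trans[OF ind3_swap(2)[OF i(2)]] B[OF ind2_sym[OF j(3)] j(1) xy(3)] by blast
  qed
  have "compat x (l x) y (l y)" if xy: "ind2 x y" for x y
  proof -
    have "ind2 e x \<or> ind2 e y"
    proof (rule ccontr)
      assume "\<not> (ind2 e x \<or> ind2 e y)"
      then have "x \<in> span {e}" "y \<in> span {e}" using e ind2_iff by blast+
      moreover have "x \<noteq> 0" using xy ind2_iff by blast
      ultimately show False using common_line[of x e y] xy ind2_iff span_1 by blast
    qed
    then show ?thesis using B[OF xy] C[OF xy] compat_sym[OF C[OF ind2_sym[OF xy]]] by blast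
  qed
  then show ?thesis using l0 rep_l by blast
qed

lemma ind2_exists: "x \<noteq> 0 \<Longrightarrow> \<exists>y. ind2 x y"
  using dim4[of x x x] ind2_iff by auto

lemma ind2_minus: "ind2 x y \<Longrightarrow> ind2 x (- y)"
  unfolding ind2_def by (metis scale_minus_left scale_minus_right minus_minus neg_equal_0_iff_equal)

lemma ind2_add: "ind2 x y \<Longrightarrow> ind2 (x + y) y"
proof -
  assume *: "ind2 x y"
  show ?thesis
    unfolding ind2_def
  proof (intro allI impI)
    fix a b assume "a *s (x + y) + b *s y = 0"
    then have "a *s x + (a + b) *s y = 0"
      by (simp add: scale_right_distrib scale_left_distrib add.assoc)
    then have "a = 0" "a + b = 0" using * unfolding ind2_def by blast+
    then show "a = 0 \<and> b = 0" by simp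
  qed
qed

context
  fixes l :: "'v \<Rightarrow> 'v"
  assumes l_0: "l 0 = 0" and l_rep: "\<And>x. x \<noteq> 0 \<Longrightarrow> rep x (l x)"
    and l_compat: "\<And>x y. ind2 x y \<Longrightarrow> compat x (l x) y (l y)"
begin

lemma l_nonzero: "x \<noteq> 0 \<Longrightarrow> l x \<noteq> 0"
  using l_rep rep_def by blast

text \<open>The vector \<open>x - y - z\<close> can be reached through \<open>x - y\<close> and through \<open>x - z\<close>.  Comparing the
  coefficients of its image for both ways shows that the multiple \<open>l (x - y)\<close> of \<open>l x - l y\<close> has
  factor \<open>1\<close>.\<close>

lemma l_diff_ind:
  assumes xy: "ind2 x y"
  shows "l (x - y) = l x - l y"
proof -
  obtain z where z: "z \<notin> span {x, y, y}" using dim4 by blast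
  have in_span: "x \<in> span {x, y, y}" "y \<in> span {x, y, y}" by (auto intro: span_base)
  have i: "ind3 x y z" by (rule ind3_outside[OF xy in_span z])
  have nz: "x \<noteq> 0" "y \<noteq> 0" "z \<noteq> 0" using i ind3_ind2 ind2_iff ind2_sym by blast+
  have xy0: "x - y \<noteq> 0" using xy ind2_iff[of x y] span_base[of x "{x}"] by auto
  have j: "ind2 (x - y) z" by (rule ind2_outside[OF xy0 span_diff[OF in_span] z])
  have reps: "rep (x - y) (l x - l y)" "rep (x - z) (l x - l z)" "rep (x - y) (l (x - y))"
    "rep (x - y - z) (l (x - y) - l z)" "rep y (l y)" "rep z (l z)"
    using l_compat[OF xy] l_compat[OF ind3_ind2(3)[OF i]] l_compat[OF j] compat_def l_rep nz xy0
    by blast+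
  have i': "ind3 (l x) (l y) (l z)" using rep_ind3[OF l_rep l_rep l_rep] nz i by blast
  obtain t where t: "l (x - y) = t *s (l x - l y)" using rep_same[OF reps(1,3)] by blast
  have "(x - z) - y \<in> span {x - z, y}" by (intro span_diff span_base) auto
  then have "x - y - z \<in> span {x - z, y}" by (simp add: algebra_simps)
  then obtain a b where ab: "l (x - y) - l z = a *s (l x - l z) + b *s l y"
    using rep_line[OF reps(4,2,5)] span_2 by blast
  have "t *s l x + (- t) *s l y + (- 1) *s l z = a *s l x + b *s l y + (- a) *s l z"
    using ab unfolding t by (simp add: scale_diff_right scale_one algebra_simps)
  then have "t = a \<and> - t = b \<and> - 1 = - a" by (rule ind3_coeffs[OF i'])
  then show ?thesis using t by (auto simp: scale_one)
qed

lemma l_minus: "l (- v) = - l v"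
proof (cases "v = 0")
  case False
  then obtain y where "ind2 v y" using ind2_exists by blast
  then have "ind2 (v + y) y" by (rule ind2_add)
  then show ?thesis using l_diff_ind[of "v + y" y] l_diff_ind[OF ind2_sym, of "v + y" y] by simp
qed (simp add: l_0)

lemma l_add_ind: "ind2 x y \<Longrightarrow> l (x + y) = l x + l y"
  using l_diff_ind[OF ind2_minus] l_minus by fastforce

lemma l_add: "l (x + y) = l x + l y"
proof (cases "x = 0 \<or> y = 0 \<or> x + y = 0")
  case True
  then show ?thesis using l_minus[of x] by (auto simp: l_0 add_eq_0_iff)
next
  case False
  obtain z where z: "z \<notin> span {x, y, y}" using dim4 by blast
  have in_span: "x \<in> span {x, y, y}" "y \<in> span {x, y, y}" by (auto intro: span_base)
  have "y + z \<notin> span {x, y, y}" using span_diff[OF _ in_span(2), of "y + z"] z by auto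
  then have "l (x + (y + z)) = l x + (l y + l z)"
    using l_add_ind[of x "y + z"] l_add_ind[of y z] ind2_outside in_span z False by metis
  moreover have "l ((x + y) + z) = l (x + y) + l z"
    using ind2_outside[OF _ span_add[OF in_span] z] False by (intro l_add_ind) auto
  ultimately show ?thesis by (simp add: add.assoc)
qed

lemma l_scale_exists: "\<exists>s. l (a *s x) = s *s l x"
proof (cases "x = 0 \<or> a = 0")
  case False
  then have x: "rep x (l x)" and ax: "rep (a *s x) (l (a *s x))" using l_rep by auto
  have "a *s x \<in> span {x, x}" by (intro span_scale span_base) auto
  then have "l (a *s x) \<in> span {l x, l x}" using rep_line[OF ax x x] by blast
  then show ?thesis using span_1 by simp
qed (auto simp: l_0 intro: exI[of _ 0])

text \<open>For independent \<open>x\<close> and \<open>y\<close>, comparing \<open>l (a x + a y)\<close> with \<open>l (a x) + l (a y)\<close> shows that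
  the factor belonging to \<open>a\<close> is the same for \<open>x\<close> and \<open>y\<close>.\<close>

lemma l_scale: "\<exists>\<sigma>. \<forall>a x. l (a *s x) = \<sigma> a *s l x"
proof -
  have ind: "s = t" if "ind2 x y" "l (a *s x) = s *s l x" "l (a *s y) = t *s l y" for a s t x y
  proof -
    have i: "ind2 (l x) (l y)" using rep_ind2[OF l_rep l_rep] that(1) ind2_sym ind2_iff by blast
    obtain r where "l (a *s (x + y)) = r *s l (x + y)" using l_scale_exists by blast
    then have "s *s l x + t *s l y = r *s l x + r *s l y"
      using that by (simp add: scale_right_distrib l_add)
    then show ?thesis using ind2_coeffs[OF i] by blast
  qed
  obtain x0 where "x0 \<notin> span {0, 0, 0}" using dim4 by blast
  then have x0: "x0 \<noteq> 0" by auto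
  have "\<forall>a. \<exists>s. l (a *s x0) = s *s l x0" using l_scale_exists by blast
  then obtain \<sigma> where \<sigma>: "\<And>a. l (a *s x0) = \<sigma> a *s l x0" by metis
  have "l (a *s x) = \<sigma> a *s l x" for a x
  proof (cases "x = 0")
    case False
    obtain z where z: "z \<notin> span {x, x0, x0}" using dim4 by blast
    have zz: "ind2 x z" "ind2 x0 z"
      using ind2_outside[OF _ _ z] False x0 span_base[of _ "{x, x0, x0}"] by auto
    obtain s t where "l (a *s x) = s *s l x" "l (a *s z) = t *s l z" using l_scale_exists by metis
    then show ?thesis using ind[OF zz(1)] ind[OF zz(2) \<sigma>] by metis
  qed (simp add: l_0)
  then show ?thesis by blast
qed

lemma l_semilinear: "semilinear_automorphism l"
proof -
  obtain \<sigma> where \<sigma>: "\<And>a x. l (a *s x) = \<sigma> a *s l x" using l_scale by blast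
  obtain x where "x \<notin> span {0, 0, 0}" using dim4 by blast
  then have x: "x \<noteq> 0" by auto
  then have lx: "l x \<noteq> 0" by (rule l_nonzero)
  have \<sigma>1: "\<sigma> 1 = 1" using \<sigma>[of 1 x] scale_cancel[OF lx, of 1 "\<sigma> 1"] by (simp add: scale_one)
  have \<sigma>_add: "\<sigma> (a + b) = \<sigma> a + \<sigma> b" for a b
    using scale_cancel[OF lx, of "\<sigma> (a + b)" "\<sigma> a + \<sigma> b"] \<sigma>[of "a + b" x]
    by (simp add: scale_left_distrib l_add \<sigma>)
  have \<sigma>_mult: "\<sigma> (a * b) = \<sigma> a * \<sigma> b" for a b
    using scale_cancel[OF lx, of "\<sigma> (a * b)" "\<sigma> a * \<sigma> b"] \<sigma>[of "a * b" x] \<sigma>[of a "b *s x"] \<sigma>[of b x]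
    by (simp add: scale_scale)
  have \<sigma>_0: "\<sigma> a = 0 \<longleftrightarrow> a = 0" for a using \<sigma>[of a x] l_nonzero[of "a *s x"] x lx l_0 by auto
  have "inj \<sigma>"
  proof (rule injI)
    fix a b assume "\<sigma> a = \<sigma> b"
    then have "\<sigma> (a - b) = 0" using \<sigma>_add[of "a - b" b] by simp
    then show "a = b" using \<sigma>_0 by simp
  qed
  (* For independent x, y the point of l x + c l y has a preimage a x + b y on the line of x and y,
     and then c is the value at a\<^sup>-\<^sup>1 b. *)
  moreover have "c \<in> range \<sigma>" for c
  proof -
    obtain y where xy: "ind2 x y" using ind2_exists x by blast
    then have y: "y \<noteq> 0" using ind2_sym ind2_iff by blast
    have i: "ind2 (l x) (l y)" using rep_ind2[OF l_rep l_rep] xy x y by blast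
    let ?w = "l x + c *s l y"
    have w: "?w \<noteq> 0"
    proof
      assume "?w = 0"
      then have "1 *s l x + c *s l y = 0" by (simp add: scale_one)
      then show False using i unfolding ind2_def by (metis one_neq_zero)
    qed
    then obtain v where v: "v \<noteq> 0" "?w \<in> span {p v}" using onto by blast
    then have rv: "rep v ?w" using w rep_def by blast
    have "?w \<in> span {l x, l y}" by (intro span_add span_scale span_base) auto
    then obtain a b where ab: "v = a *s x + b *s y"
      using rep_line[OF rv l_rep[OF x] l_rep[OF y]] span_2 by blast
    obtain d where d: "d \<noteq> 0" "l v = d *s ?w" using rep_same[OF rv l_rep[OF v(1)]] by blast
    have "\<sigma> a *s l x + \<sigma> b *s l y = d *s l x + (d * c) *s l y"
      using d(2) unfolding ab by (simp add: l_add \<sigma> scale_right_distrib scale_scale)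
    then have eq: "\<sigma> a = d \<and> \<sigma> b = d * c" by (rule ind2_coeffs[OF i])
    then have "a \<noteq> 0" using d \<sigma>_0 by blast
    then have "\<sigma> (inverse a) * d = 1" using \<sigma>_mult[of "inverse a" a] \<sigma>1 eq by simp
    then have "\<sigma> (inverse a * b) = c"
      using \<sigma>_mult[of "inverse a" b] eq by (simp add: mult.assoc[symmetric])
    then show ?thesis by blast
  qed
  ultimately have bij_\<sigma>: "bij \<sigma>" unfolding bij_def by auto
  have "inj l"
  proof (rule injI)
    fix u v assume "l u = l v"
    then have "l (u - v) = 0" using l_add[of "u - v" v] by simp
    then show "u = v" using l_nonzero[of "u - v"] by auto
  qed
  moreover have "w \<in> range l" for w
  proof (cases "w = 0")
    case True
    then show ?thesis using l_0 by (metis rangeI)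
  next
    case False
    then obtain v where v: "v \<noteq> 0" "w \<in> span {p v}" using onto by blast
    then have "rep v w" using False rep_def by blast
    then obtain d where "w = d *s l v" using rep_same l_rep v by blast
    moreover obtain a where "d = \<sigma> a" using bij_\<sigma> by (metis bij_pointE)
    ultimately have "w = l (a *s v)" by (simp add: \<sigma>)
    then show ?thesis by blast
  qed
  ultimately have "bij l" unfolding bij_def by auto
  then show ?thesis
    unfolding semilinear_automorphism_def using l_add bij_\<sigma> \<sigma>1 \<sigma>_add \<sigma>_mult \<sigma> by blast
qed

end

theorem fundamental_theorem:
  "\<exists>l. semilinear_automorphism l \<and> l 0 = 0 \<and> (\<forall>v. v \<noteq> 0 \<longrightarrow> span {l v} = span {p v})"
  using compatible_lift_exists l_semilinear rep_span by metis

end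

section \<open>Components of Grassmannians are commensurability classes\<close>

context left_vector_space
begin

lemma coset_eq_iff:
  assumes "subspace K"
  shows "{x} + K = {y} + K \<longleftrightarrow> x - y \<in> K"
proof
  assume *: "{x} + K = {y} + K"
  have "x + 0 \<in> {x} + K" using assms subspace_0 by (intro set_plus_intro) auto
  then have "x \<in> {y} + K" using * by simp
  then show "x - y \<in> K" by (auto elim!: set_plus_elim)
next
  assume *: "x - y \<in> K"
  show "{x} + K = {y} + K"
  proof (intro set_eqI iffI)
    fix v assume "v \<in> {x} + K"
    then obtain k where "k \<in> K" "v = x + k" by (auto elim!: set_plus_elim)
    then have "(x - y) + k \<in> K" "v = y + ((x - y) + k)" using * assms subspace_add by auto
    then show "v \<in> {y} + K" by (metis set_plus_intro singletonI)
  next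
    fix v assume "v \<in> {y} + K"
    then obtain k where k: "k \<in> K" "v = y + k" by (auto elim!: set_plus_elim)
    then have "k - (x - y) \<in> K" "v = x + (k - (x - y))" using * assms subspace_diff by auto
    then show "v \<in> {x} + K" by (metis set_plus_intro singletonI)
  qed
qed

lemma coset_zero: "subspace K \<Longrightarrow> {0} + K = K"
  by (metis set_zero add_0_left)

lemma scale_coset_plus:
  assumes "subspace K"
  shows "(\<lambda>v. a *s v) ` ({x} + K) + K = {a *s x} + K"
proof (intro set_eqI iffI)
  fix v assume "v \<in> (\<lambda>v. a *s v) ` ({x} + K) + K"
  then obtain k k' where k: "k \<in> K" "k' \<in> K" "v = a *s (x + k) + k'" by (auto elim!: set_plus_elim)
  then have "a *s k + k' \<in> K" "v = a *s x + (a *s k + k')"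
    using assms by (auto simp: scale_right_distrib add.assoc intro: subspace_add subspace_scale)
  then show "v \<in> {a *s x} + K" by (metis set_plus_intro singletonI)
next
  fix v assume "v \<in> {a *s x} + K"
  then obtain k where k: "k \<in> K" "v = a *s x + k" by (auto elim!: set_plus_elim)
  have "x + 0 \<in> {x} + K" using assms subspace_0 by (intro set_plus_intro) auto
  then show "v \<in> (\<lambda>v. a *s v) ` ({x} + K) + K"
    using k by (intro set_plus_intro[of "a *s x" _ k K, folded k(2)]) auto
qed

lemma coset_comb_eq:
  assumes K: "subspace K" and F: "finite F" "\<And>C. C \<in> F \<Longrightarrow> C = {r C} + K"
  shows "coset_comb K a F = {\<Sum>C\<in>F. a C *s r C} + K"
  using F
proof (induction F rule: finite_induct)
  case empty
  then show ?case unfolding coset_comb_def using coset_zero[OF K] by (simp add: add.commute)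
next
  case (insert C F)
  let ?S = "\<lambda>F. \<Sum>C\<in>F. (\<lambda>v. a C *s v) ` C"
  have C: "C = {r C} + K" using insert by blast
  let ?u = "a C *s r C" and ?s = "\<Sum>C\<in>F. a C *s r C"
  have u: "(\<lambda>v. a C *s v) ` C + K = {?u} + K"
    using scale_coset_plus[OF K, of "a C" "r C"] C[symmetric] by simp
  have s: "?S F + K = {?s} + K" using insert.IH insert.prems unfolding coset_comb_def by simp
  have "coset_comb K a (insert C F) = ((\<lambda>v. a C *s v) ` C + ?S F) + K"
    unfolding coset_comb_def using insert.hyps by simp
  also have "\<dots> = (\<lambda>v. a C *s v) ` C + ({?s} + K)" unfolding s[symmetric] by (rule add.assoc)
  also have "\<dots> = {?s} + ({?u} + K)" unfolding u[symmetric] by (rule add.left_commute)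
  also have "\<dots> = {?u + ?s} + K"
    by (simp add: add.assoc[symmetric] set_plus_def[of "{_}" "{_}"] add.commute[of ?s ?u])
  finally show ?case using insert.hyps by simp
qed

text \<open>In terms of representatives \<open>r C\<close> of the cosets, a basis of the quotient is a set that is
  linearly independent modulo \<open>X\<close> and spans \<open>Y\<close> modulo \<open>X\<close>.\<close>

lemma quotient_basis_iff:
  assumes X: "subspace X" and r: "\<And>C. C \<in> \<B> \<Longrightarrow> r C \<in> Y \<and> C = {r C} + X"
  shows "is_quotient_basis Y X \<B> \<longleftrightarrow> indep_mod X (r ` \<B>) \<and> Y \<subseteq> span (X \<union> r ` \<B>)"
proof -
  have inj: "inj_on r \<B>" using r by (metis inj_onI)
  have sums: "(\<Sum>w\<in>r ` F. a w *s w) = (\<Sum>C\<in>F. a (r C) *s r C)" if "F \<subseteq> \<B>" for F a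
    using sum.reindex[OF inj_on_subset[OF inj that]] by simp
  have comb: "{y} + X = coset_comb X a F \<longleftrightarrow> y - (\<Sum>C\<in>F. a C *s r C) \<in> X"
    if "finite F" "F \<subseteq> \<B>" for F a y
  proof -
    have "coset_comb X a F = {\<Sum>C\<in>F. a C *s r C} + X"
      by (rule coset_comb_eq[OF X that(1)]) (use r that(2) in blast)
    then show ?thesis using coset_eq_iff[OF X] by simp
  qed
  have comb_0: "coset_comb X a F = X \<longleftrightarrow> (\<Sum>C\<in>F. a C *s r C) \<in> X"
    if "finite F" "F \<subseteq> \<B>" for F a
    using comb[OF that, of 0 a] coset_zero[OF X] subspace_neg[OF X] by force
  have "(\<forall>F a. finite F \<and> F \<subseteq> \<B> \<and> coset_comb X a F = X \<longrightarrow> (\<forall>C\<in>F. a C = 0)) \<longleftrightarrow>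
      indep_mod X (r ` \<B>)" (is "?ind \<longleftrightarrow> _")
  proof
    assume ind: ?ind
    show "indep_mod X (r ` \<B>)"
      unfolding indep_mod_iff[OF X]
    proof (intro allI impI ballI)
      fix G a v assume G: "finite G \<and> G \<subseteq> r ` \<B> \<and> (\<Sum>w\<in>G. a w *s w) \<in> X" "v \<in> G"
      then obtain F where F: "F \<subseteq> \<B>" "finite F" "G = r ` F"
        using finite_subset_image[of G r \<B>] by blast
      then have "coset_comb X (a \<circ> r) F = X"
        using G sums[OF F(1), of a] comb_0[OF F(2,1), of "a \<circ> r"] by simp
      then have "\<forall>C\<in>F. (a \<circ> r) C = 0" using ind F(1,2) by blast
      then show "a v = 0" using G(2) F(3) by auto
    qed
  next
    assume ind: "indep_mod X (r ` \<B>)"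
    show ?ind
    proof (intro allI impI ballI)
      fix F a C assume F: "finite F \<and> F \<subseteq> \<B> \<and> coset_comb X a F = X" "C \<in> F"
      let ?a = "\<lambda>w. a ({w} + X)"
      have a: "?a (r C) = a C" if "C \<in> F" for C using r[of C] that F(1) by auto
      then have "(\<Sum>w\<in>r ` F. ?a w *s w) = (\<Sum>C\<in>F. a C *s r C)" using F(1) by (subst sums) auto
      then have "(\<Sum>w\<in>r ` F. ?a w *s w) \<in> X" using comb_0[of F a] F(1) by simp
      then have "\<forall>w\<in>r ` F. ?a w = 0"
        using ind[unfolded indep_mod_iff[OF X], THEN spec[of _ "r ` F"], THEN spec[of _ ?a]] F(1)
        by auto
      then show "a C = 0" using a[OF F(2)] F(2) by simp
    qed
  qed
  moreover have "(\<forall>D\<in>quotient_space Y X. \<exists>F a. finite F \<and> F \<subseteq> \<B> \<and> D = coset_comb X a F) \<longleftrightarrow>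
      Y \<subseteq> span (X \<union> r ` \<B>)" (is "?spn \<longleftrightarrow> _")
  proof
    assume spn: ?spn
    show "Y \<subseteq> span (X \<union> r ` \<B>)"
    proof
      fix y assume "y \<in> Y"
      then have y: "{y} + X \<in> quotient_space Y X" unfolding quotient_space_def by (rule imageI)
      obtain F a where F: "finite F" "F \<subseteq> \<B>" "{y} + X = coset_comb X a F"
        using bspec[OF spn y] by (elim exE conjE)
      then have "y - (\<Sum>C\<in>F. a C *s r C) \<in> span (X \<union> r ` \<B>)"
        using comb span_base[of _ "X \<union> r ` \<B>"] by blast
      moreover have "(\<Sum>C\<in>F. a C *s r C) \<in> span (X \<union> r ` \<B>)"
        using F(2) by (intro subspace_sum[OF subspace_span] span_scale span_base) auto
      ultimately show "y \<in> span (X \<union> r ` \<B>)" using span_add by fastforce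
    qed
  next
    assume spn: "Y \<subseteq> span (X \<union> r ` \<B>)"
    show ?spn
    proof
      fix D assume "D \<in> quotient_space Y X"
      then obtain y where y: "y \<in> Y" "D = {y} + X" unfolding quotient_space_def by blast
      have "y \<in> span (X \<union> r ` \<B>)" using y(1) spn by blast
      then obtain x z where "x \<in> span X" and z: "z \<in> span (r ` \<B>)" and xz: "y = x + z"
        using span_Un[of y X "r ` \<B>"] by blast
      then have x: "x \<in> X" using X by simp
      obtain G where G: "finite G" "G \<subseteq> r ` \<B>" "z \<in> span G" using span_finitary[OF z] by auto
      obtain F where F: "F \<subseteq> \<B>" "finite F" "G = r ` F" using finite_subset_image[OF G(1,2)] by blast
      obtain a where a: "z = (\<Sum>w\<in>G. a w *s w)" using span_finite_explicit[OF G(1,3)] by blast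
      have "D = coset_comb X (a \<circ> r) F"
        using comb[OF F(2,1), of y "a \<circ> r"] sums[OF F(1), of a] x xz a F(3) y(2) by simp
      then show "\<exists>F a. finite F \<and> F \<subseteq> \<B> \<and> D = coset_comb X a F" using F by blast
    qed
  qed
  moreover have "\<B> \<subseteq> quotient_space Y X" unfolding quotient_space_def using r by blast
  ultimately show ?thesis unfolding is_quotient_basis_def by argo
qed

lemma quotient_dim_iff:
  assumes X: "subspace X"
  shows "has_quotient_dim Y X \<kappa> \<longleftrightarrow>
    (\<exists>R\<subseteq>Y. indep_mod X R \<and> Y \<subseteq> span (X \<union> R) \<and> |R| =o \<kappa>)"
proof
  assume "has_quotient_dim Y X \<kappa>"
  then obtain \<B> where \<B>: "is_quotient_basis Y X \<B>" "|\<B>| =o \<kappa>"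
    unfolding has_quotient_dim_def by blast
  have "\<forall>C\<in>\<B>. \<exists>y. y \<in> Y \<and> C = {y} + X"
    using \<B>(1) unfolding is_quotient_basis_def quotient_space_def by auto
  then obtain r where "\<forall>C\<in>\<B>. r C \<in> Y \<and> C = {r C} + X"
    using bchoice[of \<B> "\<lambda>C y. y \<in> Y \<and> C = {y} + X"] by blast
  note r = bspec[OF this]
  have "bij_betw r \<B> (r ` \<B>)" using r by (metis inj_onI inj_on_imp_bij_betw)
  then have "|r ` \<B>| =o \<kappa>"
    using ordIso_symmetric[OF card_of_ordIsoI] ordIso_transitive \<B>(2) by blast
  then show "\<exists>R\<subseteq>Y. indep_mod X R \<and> Y \<subseteq> span (X \<union> R) \<and> |R| =o \<kappa>"
    using quotient_basis_iff[OF X r] \<B>(1) r by (intro exI[of _ "r ` \<B>"]) auto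
next
  assume "\<exists>R\<subseteq>Y. indep_mod X R \<and> Y \<subseteq> span (X \<union> R) \<and> |R| =o \<kappa>"
  then obtain R where R: "R \<subseteq> Y" "indep_mod X R" "Y \<subseteq> span (X \<union> R)" "|R| =o \<kappa>" by blast
  let ?c = "\<lambda>w. {w} + X"
  have inj: "inj_on ?c R"
  proof (rule inj_onI, rule ccontr)
    fix v w assume vw: "v \<in> R" "w \<in> R" "{v} + X = {w} + X" "v \<noteq> w"
    then have "(v - w) + w \<in> span (X \<union> (R - {v}))"
      using coset_eq_iff[OF X] by (intro span_add span_base) auto
    then show False using R(2) vw(1) unfolding indep_mod_def by simp
  qed
  let ?r = "inv_into R ?c"
  have r: "?r (?c w) = w" if "w \<in> R" for w using inv_into_f_f[OF inj that] .
  then have "?r ` ?c ` R = R" by (force simp: image_image)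
  moreover have "?r C \<in> Y \<and> C = {?r C} + X" if "C \<in> ?c ` R" for C using that r R(1) by auto
  ultimately have "is_quotient_basis Y X (?c ` R)"
    using quotient_basis_iff[OF X, of "?c ` R" ?r Y] R by simp
  moreover have "|?c ` R| =o \<kappa>"
    using ordIso_symmetric[OF card_of_ordIsoI[OF inj_on_imp_bij_betw[OF inj]]] R(4)
    by (rule ordIso_transitive)
  ultimately show "has_quotient_dim Y X \<kappa>" unfolding has_quotient_dim_def by blast
qed

lemma quotient_dim_one:
  assumes K: "subspace K" and X: "subspace X" and KX: "K \<subseteq> X"
  shows "has_quotient_dim X K cone \<longleftrightarrow> hyperplane K X"
  unfolding quotient_dim_iff[OF K]
proof
  assume "\<exists>R\<subseteq>X. indep_mod K R \<and> X \<subseteq> span (K \<union> R) \<and> |R| =o cone"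
  then obtain R where R: "R \<subseteq> X" "indep_mod K R" "X \<subseteq> span (K \<union> R)" "|R| =o |{()}|"
    unfolding cone_def by blast
  obtain h where "bij_betw h {()} R"
    using card_of_ordIso[of "{()}" R] ordIso_symmetric[OF R(4)] by blast
  then obtain d where d: "R = {d}" unfolding bij_betw_def by auto
  then have "d \<notin> K" "X = span (insert d K)"
    using R K span_insert_least[OF X KX, of d] unfolding indep_mod_def by auto
  then show "hyperplane K X" using hyperplane_intro K by blast
next
  assume "hyperplane K X"
  then obtain x where x: "x \<notin> K" "X = span (insert x K)" unfolding hyperplane_def by blast
  moreover have "|{x}| =o cone"
    unfolding cone_def by (rule card_of_ordIsoI[of "\<lambda>_. ()"]) (simp add: bij_betw_def)
  ultimately show "\<exists>R\<subseteq>X. indep_mod K R \<and> X \<subseteq> span (K \<union> R) \<and> |R| =o cone"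
    using K span_insert_upper(2)[of x K] by (intro exI[of _ "{x}"]) (simp add: indep_mod_def)
qed

lemma adjacent_iff: "subspace X \<Longrightarrow> subspace Y \<Longrightarrow> adjacent X Y \<longleftrightarrow> adj X Y"
  unfolding adjacent_def adj_def using quotient_dim_one subspace_Int by simp

lemma indep_mod_mono: "indep_mod X F \<Longrightarrow> G \<subseteq> F \<Longrightarrow> indep_mod X G"
  unfolding indep_mod_def using span_mono[of "X \<union> (G - {_})" "X \<union> (F - {_})"] by blast

lemma indep_mod_insert_base:
  assumes F: "indep_mod X F" and g: "g \<notin> span (X \<union> F)"
  shows "indep_mod (insert g X) F"
  unfolding indep_mod_def
proof (intro ballI notI)
  fix v assume v: "v \<in> F" "v \<in> span (insert g X \<union> (F - {v}))"
  then have "g \<in> span (insert v (X \<union> (F - {v})))"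
    using exchange[of v g "X \<union> (F - {v})"] F unfolding indep_mod_def by simp
  moreover have "insert v (X \<union> (F - {v})) = X \<union> F" using v by blast
  ultimately show False using g by simp
qed

text \<open>The vector \<open>u\<close> can be any element of a smallest \<open>E \<subseteq> F\<close> with \<open>g \<in> span (X \<union> E)\<close>.\<close>

lemma indep_mod_exchange:
  assumes F: "finite F" "indep_mod X F" and g: "g \<in> span (X \<union> F)" "g \<notin> span X"
  shows "\<exists>u\<in>F. indep_mod (insert g X) (F - {u}) \<and> u \<in> span (insert g X \<union> (F - {u}))"
proof -
  let ?P = "\<lambda>E. E \<subseteq> F \<and> g \<in> span (X \<union> E)"
  obtain E where E: "?P E" and min: "\<And>E'. ?P E' \<Longrightarrow> card E \<le> card E'"
    using ex_has_least_nat[of ?P F card] g by auto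
  have "E \<noteq> {}" using E g by auto
  then obtain u where u: "u \<in> E" by blast
  have "finite E" using E F finite_subset by blast
  then have "card (E - {u}) < card E" using u by (intro card_Diff1_less) auto
  then have "g \<notin> span (X \<union> (E - {u}))" using min[of "E - {u}"] E by auto
  moreover have "insert u (X \<union> (E - {u})) = X \<union> E" using u by blast
  ultimately have uE: "u \<in> span (insert g (X \<union> (E - {u})))"
    using exchange[of g u "X \<union> (E - {u})"] E by simp
  have "insert g (X \<union> (E - {u})) \<subseteq> insert g X \<union> (F - {u})" using E by blast
  then have "u \<in> span (insert g X \<union> (F - {u}))" using uE span_mono by blast
  moreover have "g \<notin> span (X \<union> (F - {u}))"
  proof
    assume g': "g \<in> span (X \<union> (F - {u}))"
    have "insert g (X \<union> (E - {u})) \<subseteq> span (X \<union> (F - {u}))"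
      using g' E span_superset[of "X \<union> (F - {u})"] by blast
    then have "u \<in> span (X \<union> (F - {u}))"
      using uE span_minimal[of "insert g (X \<union> (E - {u}))" "span (X \<union> (F - {u}))"] by auto
    then show False using F u E unfolding indep_mod_def by blast
  qed
  ultimately show ?thesis
    using indep_mod_insert_base[OF indep_mod_mono[OF F(2)], of "F - {u}" g] u E by blast
qed

lemma indep_mod_insert:
  assumes "finite F" "indep_mod (insert x X) F" "x \<notin> span X"
  shows "indep_mod X (insert x F)"
  unfolding indep_mod_def
proof (intro ballI notI)
  fix v assume v: "v \<in> insert x F" "v \<in> span (X \<union> (insert x F - {v}))"
  have F: "indep_mod X F"
    using assms(2) span_mono[of "X \<union> _" "insert x X \<union> _"] unfolding indep_mod_def by blast
  show False
  proof (cases "v = x")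
    case True
    then have "x \<in> span (X \<union> F)" using v(2) span_mono[of "X \<union> (insert x F - {x})" "X \<union> F"] by blast
    then show False
      using indep_mod_exchange[OF assms(1) F _ assms(3)] assms(2) unfolding indep_mod_def by blast
  next
    case False
    then have "X \<union> (insert x F - {v}) = insert x X \<union> (F - {v})" by blast
    then show False using v False assms(2) unfolding indep_mod_def by auto
  qed
qed

lemma steinitz:
  assumes "finite G" "finite F" "F \<subseteq> span (X \<union> G)" "indep_mod X F"
  shows "card F \<le> card G"
  using assms
proof (induction G arbitrary: X F rule: finite_induct)
  case empty
  have "F = {}"
  proof (rule ccontr)
    assume "F \<noteq> {}"
    then obtain v where "v \<in> F" by blast
    then show False using empty span_mono[of X "X \<union> (F - {v})"] unfolding indep_mod_def by auto
  qed
  then show ?case by simp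
next
  case (insert g G)
  have F: "F \<subseteq> span (insert g X \<union> G)" using insert.prems by simp
  show ?case
  proof (cases "g \<in> span (X \<union> F) \<and> g \<notin> span X")
    case True
    then obtain u where u: "u \<in> F" "indep_mod (insert g X) (F - {u})"
      using indep_mod_exchange insert.prems by blast
    then have "card (F - {u}) \<le> card G"
      using insert.IH[of "F - {u}" "insert g X"] insert.prems F by auto
    then show ?thesis using u insert by (simp add: card_Diff_singleton)
  next
    case False
    have "indep_mod (insert g X) F"
    proof (cases "g \<in> span X")
      case True
      have "span (insert g X \<union> E) \<subseteq> span (X \<union> E)" for E
      proof (rule span_minimal)
        have "g \<in> span (X \<union> E)" using True span_mono[of X "X \<union> E"] by blast
        then show "insert g X \<union> E \<subseteq> span (X \<union> E)" using span_superset[of "X \<union> E"] by blast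
      qed simp
      then show ?thesis using insert.prems(3) unfolding indep_mod_def by blast
    next
      case gX: False
      then show ?thesis using False indep_mod_insert_base insert.prems(3) by blast
    qed
    then have "card F \<le> card G" using insert.IH[of F "insert g X"] insert.prems F by auto
    then show ?thesis using insert.hyps by simp
  qed
qed

text \<open>The relative index of adjacent subspaces is \<open>0\<close>, and the index is additive along paths.  This
  is stated without dimensions: \<open>Y\<close> together with \<open>card G\<close> vectors cannot span more than \<open>card G\<close>
  dimensions above \<open>X\<close>.\<close>

lemma path_index:
  assumes "(X, Y) \<in> {(X, Y). adj X Y}\<^sup>*" "finite F" "finite G" "indep_mod X F"
    "X \<union> F \<subseteq> span (Y \<union> G)"
  shows "card F \<le> card G"
  using assms
proof (induction arbitrary: F G rule: converse_rtrancl_induct)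
  case base
  then show ?case using steinitz by blast
next
  case (step X X1)
  let ?K = "X \<inter> X1"
  have adj: "hyperplane ?K X" "hyperplane ?K X1" using step.hyps(1) unfolding adj_def by auto
  obtain x where x: "x \<in> X" "x \<notin> X1" using hyperplane_psubset[OF adj(1)] by blast
  obtain x1 where x1: "x1 \<in> X1" "x1 \<notin> X" using hyperplane_psubset[OF adj(2)] by blast
  have X: "X = span (insert x ?K)" and X1: "X1 = span (insert x1 ?K)"
    using hyperplane_span_insert adj x x1 by blast+
  have K: "subspace ?K" using adj hyperplane_subspaces by blast
  have sp: "span (X1 \<union> E) = span (insert x1 ?K \<union> E)" for E
    using span_Un_span[of "insert x1 ?K" E] X1 by simp
  have sp': "span (X \<union> E) = span (insert x ?K \<union> E)" for E
    using span_Un_span[of "insert x ?K" E] X by simp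
  have XF: "span (X \<union> F) \<subseteq> span (Y \<union> G)" using step.prems(4) by (intro span_minimal) auto
  have xF: "x \<notin> F"
    using step.prems(3) x(1) span_base[of x "X \<union> (F - {x})"] unfolding indep_mod_def by blast
  let ?F = "insert x F"
  have "indep_mod (insert x ?K) F" using step.prems(3) sp' unfolding indep_mod_def by simp
  then have F: "indep_mod ?K ?F" using indep_mod_insert step.prems(1) x K by simp
  have FG: "?F \<subseteq> span (Y \<union> G)" "?K \<subseteq> span (Y \<union> G)" using step.prems(4) x by auto
  (* Passing from X to X1, the set F is replaced by a subset of insert x F.  Either one vector can
     be dropped, or the index on the other side grows by one as well. *)
  show ?case
  proof (cases "x1 \<in> span (?K \<union> ?F)")
    case True
    moreover have "x1 \<notin> span ?K" using x1 K by simp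
    ultimately obtain u where u: "u \<in> ?F" "indep_mod (insert x1 ?K) (?F - {u})"
      using indep_mod_exchange[OF _ F] step.prems(1) by blast
    have "span (?K \<union> ?F) \<subseteq> span (Y \<union> G)" using FG by (intro span_minimal) auto
    then have "span (insert x1 ?K) \<subseteq> span (Y \<union> G)"
      using True FG by (intro span_insert_least[OF subspace_span]) auto
    then have "X1 \<subseteq> span (Y \<union> G)" by (rule X1[THEN ord_eq_le_trans])
    then have "card (?F - {u}) \<le> card G"
      using u FG step.prems(1,2) sp unfolding indep_mod_def
      by (intro step.IH) (auto simp: indep_mod_def)
    then show ?thesis using u xF step.prems(1) by (simp add: card_Diff_singleton)
  next
    case False
    then have "indep_mod (insert x1 ?K) ?F" using indep_mod_insert_base F by blast
    moreover have "span (Y \<union> G) \<subseteq> span (Y \<union> insert x1 G)" "x1 \<in> span (Y \<union> insert x1 G)"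
      by (auto intro!: span_mono span_base)
    then have "span (insert x1 ?K) \<subseteq> span (Y \<union> insert x1 G)"
      using FG by (intro span_insert_least[OF subspace_span]) auto
    then have "X1 \<subseteq> span (Y \<union> insert x1 G)" by (rule X1[THEN ord_eq_le_trans])
    then have "X1 \<union> ?F \<subseteq> span (Y \<union> insert x1 G)"
      using FG \<open>span (Y \<union> G) \<subseteq> span (Y \<union> insert x1 G)\<close> by blast
    ultimately have "card ?F \<le> card (insert x1 G)"
      using step.prems(1,2) sp by (intro step.IH) (auto simp: indep_mod_def)
    then show ?thesis using xF step.prems(1,2) card_insert_le_m1[of "Suc (card G)" G x1] by simp
  qed
qed

lemma path_commensurable:
  assumes "(X, Y) \<in> {(X, Y). adj X Y}\<^sup>*" "subspace Y"
  shows "\<exists>F. finite F \<and> X \<subseteq> span (Y \<union> F)"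
  using assms
proof (induction rule: converse_rtrancl_induct)
  case base
  then show ?case by (intro exI[of _ "{}"]) simp
next
  case (step X X1)
  then obtain F where F: "finite F" "X1 \<subseteq> span (Y \<union> F)" by blast
  obtain x where x: "X = span (insert x (X \<inter> X1))"
    using step.hyps(1) unfolding adj_def hyperplane_def by blast
  have "span (Y \<union> F) \<subseteq> span (Y \<union> insert x F)" "x \<in> span (Y \<union> insert x F)"
    by (auto intro!: span_mono span_base)
  then have "span (insert x (X \<inter> X1)) \<subseteq> span (Y \<union> insert x F)"
    using F by (intro span_insert_least) auto
  then show ?case using F x by (intro exI[of _ "insert x F"]) simp
qed

lemma Cinfinite_card_infinite: "|A| =o \<kappa> \<Longrightarrow> Cinfinite \<kappa> \<Longrightarrow> infinite A"
  using Cinfinite_cong[of \<kappa> "|A|"] ordIso_symmetric unfolding cinfinite_def Field_card_of by blast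

lemma infinite_dim_not_finitely_generated:
  assumes "has_dim X \<delta>" "Cinfinite \<delta>" "finite F"
  shows "\<not> X \<subseteq> span F"
proof
  assume XF: "X \<subseteq> span F"
  obtain B where B: "independent B" "span B = X" "infinite B"
    using assms Cinfinite_card_infinite unfolding has_dim_def is_basis_def by blast
  obtain G where G: "finite G" "card G = Suc (card F)" "G \<subseteq> B"
    using infinite_arbitrarily_large[OF B(3)] by blast
  have "indep_mod {} G"
    using independent_mono[OF B(1) G(3)] unfolding indep_mod_def independent_iff by simp
  moreover have "G \<subseteq> span ({} \<union> F)" using G XF B span_superset[of B] by auto
  ultimately show False using steinitz[OF assms(3) G(1)] G(2) by fastforce
qed

lemma infinite_codim_not_cofinite:
  assumes X: "subspace X" and "has_quotient_dim UNIV X \<gamma>" "Cinfinite \<gamma>" "finite F"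
  shows "\<exists>v. v \<notin> span (X \<union> F)"
proof (rule ccontr)
  assume all: "\<nexists>v. v \<notin> span (X \<union> F)"
  obtain R where R: "indep_mod X R" "|R| =o \<gamma>"
    using assms(2) unfolding quotient_dim_iff[OF X] by blast
  have "infinite R" by (rule Cinfinite_card_infinite[OF R(2) assms(3)])
  obtain G where G: "finite G" "card G = Suc (card F)" "G \<subseteq> R"
    using infinite_arbitrarily_large[OF \<open>infinite R\<close>] by blast
  then have "card G \<le> card F"
    using all by (intro steinitz[OF assms(4) G(1) _ indep_mod_mono[OF R(1) G(3)]]) auto
  then show False using G(2) by simp
qed

text \<open>The linear involution \<open>v \<mapsto> v + \<xi>(v) (y - x)\<close> exchanges \<open>x \<in> X\<close> and \<open>y \<in> Y\<close> and fixes
  \<open>X \<inter> Y\<close>, provided that \<open>\<xi>\<close> is a linear functional that vanishes on \<open>X \<inter> Y\<close> and satisfies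
  \<open>\<xi>(x) = 1\<close>, \<open>\<xi>(y) = -1\<close>.  It is given by a hyperplane \<open>H\<close> of \<open>V\<close> that contains \<open>X \<inter> Y\<close> and
  \<open>x + y\<close>, but not \<open>x\<close>.\<close>

lemma adj_linear:
  assumes "adj X Y"
  shows "\<exists>T. bij T \<and> (\<forall>u v. T (u + v) = T u + T v) \<and> (\<forall>a v. T (a *s v) = a *s T v) \<and> T ` X = Y"
proof -
  let ?K = "X \<inter> Y"
  have adj: "hyperplane ?K X" "hyperplane ?K Y" using assms unfolding adj_def by auto
  have K: "subspace ?K" "subspace X" "subspace Y" using adj hyperplane_subspaces by blast+
  obtain x where x: "x \<in> X" "x \<notin> Y" using hyperplane_psubset[OF adj(1)] by blast
  obtain y where y: "y \<in> Y" "y \<notin> X" using hyperplane_psubset[OF adj(2)] by blast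
  have X: "X = span (insert x ?K)" and Y: "Y = span (insert y ?K)"
    using hyperplane_span_insert adj x y by blast+
  have "x \<notin> span (insert (x + y) ?K)"
  proof
    assume "x \<in> span (insert (x + y) ?K)"
    then have "x + y \<in> X" using exchange[of x "x + y" ?K] x K X by auto
    then have "x + y - x \<in> X" using x K subspace_diff by blast
    then show False using y by simp
  qed
  then obtain H where H: "hyperplane H UNIV" "span (insert (x + y) ?K) \<subseteq> H" "x \<notin> H"
    using hyperplane_separate[OF subspace_UNIV, of "span (insert (x + y) ?K)" x] by auto
  have subH: "subspace H" using H hyperplane_subspaces by blast
  have KH: "?K \<subseteq> H" "x + y \<in> H"
    using H(2) span_insert_upper(1)[of ?K "x + y"] span_insert_upper(2)[of "x + y" ?K] by auto
  have "\<exists>a. v - a *s x \<in> H" for v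
    using hyperplane_span_insert[OF H(1) _ H(3)] span_insert_subspace[OF subH] by blast
  then obtain \<xi> where \<xi>: "\<And>v. v - \<xi> v *s x \<in> H" by metis
  have uniq: "\<xi> v = a" if "v - a *s x \<in> H" for v a
  proof (rule ccontr)
    assume "\<xi> v \<noteq> a"
    have "(v - a *s x) - (v - \<xi> v *s x) \<in> H" using subspace_diff[OF subH that \<xi>] .
    then have "(\<xi> v - a) *s x \<in> H" by (simp add: scale_diff_left)
    then have "inverse (\<xi> v - a) *s (\<xi> v - a) *s x \<in> H" using subspace_scale subH by blast
    then show False using H(3) \<open>\<xi> v \<noteq> a\<close> by simp
  qed
  have \<xi>_add: "\<xi> (u + v) = \<xi> u + \<xi> v" for u v
    using subspace_add[OF subH \<xi>[of u] \<xi>[of v]]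
    by (intro uniq) (simp add: scale_left_distrib algebra_simps)
  have \<xi>_scale: "\<xi> (a *s v) = a * \<xi> v" for a v
    using subspace_scale[OF subH \<xi>[of v], of a]
    by (intro uniq) (simp add: scale_diff_right scale_scale)
  have \<xi>_H: "\<xi> v = 0" if "v \<in> H" for v using that by (intro uniq) simp
  have \<xi>_x: "\<xi> x = 1" using subspace_0[OF subH] by (intro uniq) (simp add: scale_one)
  have \<xi>_y: "\<xi> y = - 1" using KH by (intro uniq) (simp add: scale_one add.commute)
  have \<xi>_minus: "\<xi> (- v) = - \<xi> v" for v
    using \<xi>_add[of v "- v"] \<xi>_H[OF subspace_0[OF subH]] by (simp add: add_eq_0_iff)
  have \<xi>_xy: "\<xi> (y - x) = - 1 - 1" using \<xi>_add[of y "- x"] \<xi>_y \<xi>_x \<xi>_minus[of x] by simp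
  define T where "T = (\<lambda>v. v + \<xi> v *s (y - x))"
  have T_add: "T (u + v) = T u + T v" for u v
    unfolding T_def by (simp add: \<xi>_add scale_left_distrib)
  have T_scale: "T (a *s v) = a *s T v" for a v
    unfolding T_def by (simp add: \<xi>_scale scale_right_distrib scale_scale)
  have "\<xi> (T v) = - \<xi> v" for v unfolding T_def by (simp add: \<xi>_add \<xi>_scale \<xi>_xy mult_2_right)
  then have TT: "T (T v) = v" for v
    unfolding T_def[of, THEN fun_cong, of "T v"] by (simp add: T_def)
  have T_x: "T x = y" and T_y: "T y = x" unfolding T_def \<xi>_x \<xi>_y by (simp_all add: scale_one)
  have T_K: "T v = v" if "v \<in> ?K" for v unfolding T_def using \<xi>_H that KH by auto
  have TX: "T v \<in> Y" if v: "v \<in> X" for v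
  proof -
    obtain a where a: "v - a *s x \<in> ?K"
      using span_insert_subspace[OF K(1)] equalityD1[OF X, THEN subsetD, OF v] by blast
    have "T v = T ((v - a *s x) + a *s x)" by simp
    also have "\<dots> = (v - a *s x) + a *s y" using T_K[OF a] by (simp only: T_add T_scale T_x)
    finally show ?thesis using a y K subspace_add subspace_scale by simp
  qed
  have TY: "T v \<in> X" if v: "v \<in> Y" for v
  proof -
    obtain a where a: "v - a *s y \<in> ?K"
      using span_insert_subspace[OF K(1)] equalityD1[OF Y, THEN subsetD, OF v] by blast
    have "T v = T ((v - a *s y) + a *s y)" by simp
    also have "\<dots> = (v - a *s y) + a *s x" using T_K[OF a] by (simp only: T_add T_scale T_y)
    finally show ?thesis using a x K subspace_add subspace_scale by simp
  qed
  have "T ` X = Y" using TX TY TT by (metis imageI image_subsetI subsetI subset_antisym)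
  moreover have "bij T" using TT by (metis bijI')
  ultimately show ?thesis using T_add T_scale by blast
qed

lemma grassmannian_linear_image:
  assumes T: "bij T" "\<And>u v. T (u + v) = T u + T v" "\<And>a v. T (a *s v) = a *s T v"
    and X: "X \<in> grassmannian \<delta> \<gamma>"
  shows "T ` X \<in> grassmannian \<delta> \<gamma>"
proof -
  have inj: "inj T" using T bij_is_inj by blast
  have X': "subspace X" "has_dim X \<delta>" "has_quotient_dim UNIV X \<gamma>" using X grassmannian_def by auto
  have T_0: "T 0 = 0" using T(3)[of 0 0] by simp
  have sub: "subspace (T ` S)" if "subspace S" for S
    unfolding subspace_def
  proof (intro conjI ballI allI)
    show "0 \<in> T ` S" using T_0 subspace_0[OF that] by (metis imageI)
    fix u assume "u \<in> T ` S"
    then obtain s where s: "s \<in> S" "u = T s" by blast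
    show "a *s u \<in> T ` S" for a using s T(3) subspace_scale[OF that] by (metis imageI)
    fix v assume "v \<in> T ` S"
    then obtain s' where "s' \<in> S" "v = T s'" by blast
    then show "u + v \<in> T ` S" using s T(2) subspace_add[OF that] by (metis imageI)
  qed
  have pre: "subspace (T -` S)" if "subspace S" for S
    using that unfolding subspace_def by (simp add: T T_0)
  have spn: "span (T ` S) = T ` span S" for S
  proof
    show "span (T ` S) \<subseteq> T ` span S" by (intro span_minimal sub image_mono span_superset) simp
    have "S \<subseteq> T -` span (T ` S)" using span_superset by blast
    then have "span S \<subseteq> T -` span (T ` S)" by (intro span_minimal pre) auto
    then show "T ` span S \<subseteq> span (T ` S)" by blast
  qed
  have indep: "indep_mod (T ` Z) (T ` R)" if "indep_mod Z R" for Z R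
    unfolding indep_mod_def
  proof (intro ballI notI)
    fix v assume "v \<in> T ` R" "v \<in> span (T ` Z \<union> (T ` R - {v}))"
    then obtain b where b: "b \<in> R" "T b \<in> span (T ` Z \<union> (T ` R - {T b}))" by blast
    have "T ` Z \<union> (T ` R - {T b}) = T ` (Z \<union> (R - {b}))"
      using inj image_set_diff[of T R "{b}"] by (simp add: image_Un)
    then have "b \<in> span (Z \<union> (R - {b}))" using b(2) spn inj inj_image_mem_iff by metis
    then show False using that b(1) unfolding indep_mod_def by blast
  qed
  have card: "|T ` R| =o \<kappa>" if "|R| =o \<kappa>" for R and \<kappa> :: "'e rel"
  proof -
    have "bij_betw T R (T ` R)" by (rule inj_on_imp_bij_betw[OF inj_on_subset[OF inj subset_UNIV]])
    then show ?thesis using ordIso_symmetric[OF card_of_ordIsoI] ordIso_transitive that by blast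
  qed
  obtain B where B: "independent B" "span B = X" "|B| =o \<delta>"
    using X'(2) unfolding has_dim_def is_basis_def by blast
  have "independent (T ` B)"
    using indep[of "{}" B] B(1) unfolding indep_mod_def independent_iff by simp
  then have "has_dim (T ` X) \<delta>" unfolding has_dim_def is_basis_def using B spn card by blast
  moreover obtain R where R: "indep_mod X R" "UNIV \<subseteq> span (X \<union> R)" "|R| =o \<gamma>"
    using X'(3) unfolding quotient_dim_iff[OF X'(1)] by blast
  have "UNIV \<subseteq> span (T ` X \<union> T ` R)"
    using R(2) spn[of "X \<union> R"] T(1) by (simp add: image_Un bij_is_surj top.extremum_unique)
  then have "has_quotient_dim UNIV (T ` X) \<gamma>"
    unfolding quotient_dim_iff[OF sub[OF X'(1)]] using indep[OF R(1)] card[OF R(3)] by blast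
  ultimately show ?thesis unfolding grassmannian_def using sub X'(1) by blast
qed

lemma grassmannian_adj: "X \<in> grassmannian \<delta> \<gamma> \<Longrightarrow> adj X Y \<Longrightarrow> Y \<in> grassmannian \<delta> \<gamma>"
  using adj_linear[of X Y] grassmannian_linear_image[of _ X \<delta> \<gamma>] by blast

text \<open>Symmetry of the edge relation turns membership in the same component into a path between any
  two elements, to which \<open>path_index\<close> and \<open>path_commensurable\<close> apply.\<close>

lemma component_class:
  fixes \<delta> :: "'c rel" and \<gamma> :: "'d rel"
  assumes inf: "Cinfinite \<delta>" "Cinfinite \<gamma>" and C: "C \<in> components (grassmannian \<delta> \<gamma>)"
  shows "commensurability_class scale C" "C \<subseteq> grassmannian \<delta> \<gamma>"
proof -
  let ?\<G> = "grassmannian \<delta> \<gamma>"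
  let ?E = "grassmann_edges ?\<G>"
  obtain X0 where X0: "X0 \<in> ?\<G>" "C = ?E\<^sup>* `` {X0}"
    using C unfolding components_def by (elim quotientE)
  have sub\<G>: "subspace X" if "X \<in> ?\<G>" for X using that grassmannian_def by blast
  have edge: "(X, Y) \<in> ?E \<longleftrightarrow> X \<in> ?\<G> \<and> Y \<in> ?\<G> \<and> adj X Y" for X Y
    unfolding grassmann_edges_def using adjacent_iff sub\<G> by blast
  have C\<G>: "X \<in> ?\<G>" if "X \<in> C" for X
  proof -
    have "(X0, X) \<in> ?E\<^sup>*" using that X0 by blast
    then show ?thesis by (induction rule: rtrancl_induct) (use X0 edge in auto)
  qed
  then show "C \<subseteq> ?\<G>" by blast
  have "sym ?E" unfolding sym_def using edge adj_sym by blast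
  then have symE: "sym (?E\<^sup>*)" by (rule sym_rtrancl)
  have path: "(X, Y) \<in> {(X, Y). adj X Y}\<^sup>*" if "X \<in> C" "Y \<in> C" for X Y
  proof -
    have "(X, X0) \<in> ?E\<^sup>*" "(X0, Y) \<in> ?E\<^sup>*" using that X0 symE unfolding sym_def by blast+
    then have "(X, Y) \<in> ?E\<^sup>*" by (rule rtrancl_trans)
    moreover have "?E \<subseteq> {(X, Y). adj X Y}" using edge by auto
    ultimately show ?thesis using rtrancl_mono by blast
  qed
  have adjC: "Y \<in> C" if "X \<in> C" "adj X Y" for X Y
  proof -
    have "(X, Y) \<in> ?E" using edge C\<G>[OF that(1)] grassmannian_adj that(2) by blast
    moreover have "(X0, X) \<in> ?E\<^sup>*" using that(1) X0(2) by simp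
    ultimately have "(X0, Y) \<in> ?E\<^sup>*" by (rule rtrancl_into_rtrancl[rotated])
    then show ?thesis using X0(2) by simp
  qed
  show "commensurability_class scale C"
  proof unfold_locales
    show "C \<noteq> {}" using X0 by blast
    show "subspace X" if "X \<in> C" for X using sub\<G> C\<G> that by blast
    show "span (insert y K) \<in> C" if "X \<in> C" "hyperplane K X" "y \<notin> K" for X K y
    proof (cases "span (insert y K) = X")
      case False
      have "hyperplane K (span (insert y K))"
        using hyperplane_intro hyperplane_subspaces that by blast
      then show ?thesis using adjC that adj_if_common_hyperplane(2) False by metis
    qed (use that in simp)
    show "X = Y" if XY: "X \<in> C" "Y \<in> C" "X \<subseteq> Y" for X Y
    proof (rule ccontr)
      assume "X \<noteq> Y"
      then obtain y where y: "y \<in> Y" "y \<notin> X" using XY by blast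
      have "indep_mod X {y}" unfolding indep_mod_def using y sub\<G>[OF C\<G>[OF XY(1)]] by simp
      moreover have "X \<union> {y} \<subseteq> span (Y \<union> {})" using XY y span_superset[of Y] by auto
      ultimately show False using path_index[OF path[OF XY(1,2)], of "{y}" "{}"] by simp
    qed
    show "\<exists>F. finite F \<and> X \<subseteq> span (Y \<union> F)" if "X \<in> C" "Y \<in> C" for X Y
      by (rule path_commensurable[OF path[OF that] sub\<G>[OF C\<G>[OF that(2)]]])
    show "\<not> X \<subseteq> span F" if "X \<in> C" "finite F" for X F
      using infinite_dim_not_finitely_generated[OF _ inf(1) that(2)] C\<G>[OF that(1)]
      unfolding grassmannian_def by blast
    show "\<exists>v. v \<notin> span (X \<union> F)" if "X \<in> C" "finite F" for X F
      using infinite_codim_not_cofinite[OF _ _ inf(2) that(2)] C\<G>[OF that(1)]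
      unfolding grassmannian_def by blast
  qed
qed

end

section \<open>Apartment isomorphisms are induced by semilinear automorphisms\<close>

context apartment_isomorphism
begin

lemma collineation_exists:
  "\<exists>p. collineation scale p \<and> (\<forall>b X. b \<noteq> 0 \<longrightarrow> X \<in> C \<longrightarrow> (b \<in> X \<longleftrightarrow> p b \<in> f X))"
proof -
  obtain p where p: "\<And>b. b \<noteq> 0 \<Longrightarrow> p b \<noteq> 0" "\<And>b X. b \<noteq> 0 \<Longrightarrow> X \<in> C \<Longrightarrow> b \<in> X \<longleftrightarrow> p b \<in> f X"
    using point_map_exists by metis
  obtain q where q: "\<And>b. b \<noteq> 0 \<Longrightarrow> q b \<noteq> 0" "\<And>b X. b \<noteq> 0 \<Longrightarrow> X \<in> D \<Longrightarrow> b \<in> X \<longleftrightarrow> q b \<in> g X"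
    using inv.point_map_exists by metis
  have D: "D = f ` C" using f_in f_g g_in by force
  have line: "u \<in> span {v, w} \<longleftrightarrow> p u \<in> span {p v, p w}" if "u \<noteq> 0" "v \<noteq> 0" "w \<noteq> 0" for u v w
    using source.span_iff_class[of "{v, w}" u] target.span_iff_class[of "{p v, p w}" "p u"]
      p(2) that
    unfolding D by auto
  have onto: "\<exists>v. v \<noteq> 0 \<and> w \<in> span {p v}" if w: "w \<noteq> 0" for w
  proof -
    have "w \<in> f X" if "X \<in> C" "p (q w) \<in> f X" for X
      using p(2)[OF q(1)[OF w] that(1)] q(2)[OF w f_in[OF that(1)]] g_f[OF that(1)] that(2) by simp
    then have "w \<in> span {p (q w)}" using target.span_iff_class[of "{p (q w)}" w] unfolding D by auto
    then show ?thesis using q(1)[OF w] by blast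
  qed
  have "\<exists>w. w \<notin> span {x, y, z}" for x y z
  proof -
    obtain X where "X \<in> C" using source.nonempty by blast
    then show ?thesis using source.infinite_dim[of X "{x, y, z}"] by blast
  qed
  then have "collineation scale p" using p(1) line onto by unfold_locales auto
  then show ?thesis using p(2) by blast
qed

lemma induced_by_semilinear: "\<exists>l. semilinear_automorphism l \<and> (\<forall>X\<in>C. f X = l ` X)"
proof -
  obtain p where "collineation scale p"
    and p: "\<And>b X. b \<noteq> 0 \<Longrightarrow> X \<in> C \<Longrightarrow> b \<in> X \<longleftrightarrow> p b \<in> f X"
    using collineation_exists by auto
  then interpret p: collineation scale p by simp
  obtain l where l: "semilinear_automorphism l" "l 0 = 0" "\<And>v. v \<noteq> 0 \<Longrightarrow> span {l v} = span {p v}"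
    using p.fundamental_theorem by blast
  have mem: "l b \<in> f X \<longleftrightarrow> b \<in> X" if X: "X \<in> C" for b X
  proof (cases "b = 0")
    case True
    then show ?thesis
      using l(2) subspace_0 source.subspace[OF X] target.subspace[OF f_in[OF X]] by simp
  next
    case False
    have "l b \<in> f X \<longleftrightarrow> span {l b} \<subseteq> f X" using span_subset_iff target.subspace[OF f_in[OF X]] by simp
    also have "\<dots> \<longleftrightarrow> p b \<in> f X"
      unfolding l(3)[OF False] using span_subset_iff target.subspace[OF f_in[OF X]] by simp
    finally show ?thesis using p[OF False X] by simp
  qed
  have "f X = l ` X" if X: "X \<in> C" for X
  proof
    show "l ` X \<subseteq> f X" using mem[OF X] by blast
    have "bij l" using l(1) semilinear_automorphism_def by blast
    then show "f X \<subseteq> l ` X" using mem[OF X] by (metis bij_pointE image_eqI subsetI)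
  qed
  then show ?thesis using l(1) by blast
qed

end

theorem theorem2:
  fixes scale :: "'k::division_ring \<Rightarrow> 'v::ab_group_add \<Rightarrow> 'v"
    and \<alpha> :: "'a rel" and \<beta> :: "'b rel"
    and \<G> :: "'v set set" and \<C> \<C>' :: "'v set set"
    and f :: "'v set \<Rightarrow> 'v set"
  assumes "left_vector_space scale"
    and "Cinfinite \<alpha>" and "left_vector_space.has_dim scale UNIV \<alpha>"
    and "Cinfinite \<beta>" and "\<beta> \<le>o \<alpha>"
    and "\<G> = left_vector_space.grassmannian scale \<beta> \<alpha> \<or>
         \<G> = left_vector_space.grassmannian scale \<alpha> \<beta>"
    and "\<C> \<in> left_vector_space.components scale \<G>"
    and "\<C>' \<in> left_vector_space.components scale \<G>"
    and "bij_betw f \<C> \<C>'"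
    and "\<And>A. A \<in> left_vector_space.component_apartments scale \<G> \<C> \<Longrightarrow>
           f ` A \<in> left_vector_space.component_apartments scale \<G> \<C>'"
    and "\<And>A'. A' \<in> left_vector_space.component_apartments scale \<G> \<C>' \<Longrightarrow>
           inv_into \<C> f ` A' \<in> left_vector_space.component_apartments scale \<G> \<C>"
  shows "\<exists>l. left_vector_space.semilinear_automorphism scale l \<and> (\<forall>X\<in>\<C>. f X = l ` X)"
proof -
  interpret left_vector_space scale
    by fact
  have C: "commensurability_class scale \<C>" "\<C> \<subseteq> \<G>" "commensurability_class scale \<C>'" "\<C>' \<subseteq> \<G>"
  proof -
    have "commensurability_class scale \<D> \<and> \<D> \<subseteq> \<G>" if "\<D> \<in> components \<G>" for \<D>
      using assms(6)
    proof
      assume \<G>: "\<G> = grassmannian \<beta> \<alpha>"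
      show ?thesis using component_class[OF assms(4,2)] that unfolding \<G> by simp
    next
      assume \<G>: "\<G> = grassmannian \<alpha> \<beta>"
      show ?thesis using component_class[OF assms(2,4)] that unfolding \<G> by simp
    qed
    then show "commensurability_class scale \<C>" "\<C> \<subseteq> \<G>" "commensurability_class scale \<C>'" "\<C>' \<subseteq> \<G>"
      using assms(7,8) by simp_all
  qed
  interpret source: commensurability_class scale \<C>
    by (rule C(1))
  interpret target: commensurability_class scale \<C>'
    by (rule C(3))
  have "apartment \<G> B \<inter> \<C> = source.apt B" "apartment \<G> B \<inter> \<C>' = target.apt B" for B
    unfolding apartment_def source.apt_def target.apt_def adapted_iff using C by auto
  then have apts: "component_apartments \<G> \<C> = source.apts" "component_apartments \<G> \<C>' = target.apts"
    unfolding component_apartments_def source.apts_def target.apts_def by auto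
  interpret apartment_isomorphism scale \<C> \<C>' f "inv_into \<C> f"
  proof unfold_locales
    show "f X \<in> \<C>'" if "X \<in> \<C>" for X using that assms(9) bij_betwE by blast
    show "inv_into \<C> f Y \<in> \<C>" if "Y \<in> \<C>'" for Y
      using that assms(9) bij_betw_inv_into bij_betwE by blast
    show "inv_into \<C> f (f X) = X" if "X \<in> \<C>" for X using bij_betw_inv_into_left[OF assms(9) that] .
    show "f (inv_into \<C> f Y) = Y" if "Y \<in> \<C>'" for Y
      using bij_betw_inv_into_right[OF assms(9) that] .
    show "f ` A \<in> target.apts" if "A \<in> source.apts" for A using assms(10) that apts by blast
    show "inv_into \<C> f ` A \<in> source.apts" if "A \<in> target.apts" for A
      using assms(11) that apts by blast
  qed
  show ?thesis by (rule induced_by_semilinear)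
qed

end
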